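(* Let $K$ be a totally real number field of degree $d$ over $\mathbb Q$ with ring of integers $\mathcal O$ and discriminant $d_K$, and let $\Lambda$ be a positive definite $\mathcal O$-lattice of rank $n$. There exists a free sublattice $L$ of $\Lambda$ such that $\min(L) = \min(\Lambda)$ and (1) $L$ has an HKZ-reduced basis; (2) $[\Lambda : L] \leq \left(\frac{d!}{d^d}\sqrt{|d_K|}\right)^{n^2}$; (3) $\Lambda = L$ if the class number of $K$ is $1$.
   Context: A positive definite $\mathcal O$-lattice of rank $n$ is a finitely generated $\mathcal O$-submodule $\Lambda$ of an $n$-dimensional quadratic space $(V,Q)$ over $K$, with associated bilinear form $B$, such that $K\Lambda=V$ and $Q(\mathbf x)$ is totally positive for all nonzero $\mathbf x\in V$. $\min(\Lambda):=\min\{\mathrm N_{K/\mathbb Q}(Q(\mathbf x)):\mathbf 0\ne\mathbf x\in\Lambda\}$. $[\Lambda:L]$ is the cardinality of $\Lambda/L$. A basis $\mathbf u_1,\ldots,\mathbf u_n$ of $L$ is HKZ-reduced if the quadratic form with Gram matrix $(B(\mathbf u_i,\mathbf u_j))$ is HKZ-reduced, defined as follows. For $a\in K$ and a real embedding $\nu$, $a^{(\nu)}=\nu(a)$. A positive definite quadratic form $Q$ in $n$ variables over $K$ has a unique Lagrange expansion $Q(x)=\sum_{i=1}^n h_i\big(x_i+\sum_{j>i}u_{ij}x_j\big)^2$, $h_i,u_{ij}\in K$ (outer coefficients $h_i$, inner coefficients $u_{ij}$); $\min(Q):=\min\{\mathrm N_{K/\mathbb Q}(Q(\mathbf x)):\mathbf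 0\ne\mathbf x\in\mathcal O^n\}$. For $k\ge1$ let $\omega_k=\pi^{k/2}/\Gamma(k/2+1)$, $\sigma_k=4^d\omega_k^{-2d/k}|d_K|$; for $m\ge1$, $\alpha(m)=\sigma_{m+1}\prod_{k=2}^{m+1}\sigma_k^{1/(k-1)}$, $\Sigma(m)=\sum_{k=1}^m\frac1k$, and $\bar\alpha(m):=D_1|d_K|^{1+\Sigma(m)}e^{\frac d2(\ln m)^2}$ with $D_1$ a constant depending only on $d$ chosen so that $\alpha(m)\le\bar\alpha(m)$ and $\bar\alpha(m)\ge1$ for all $m\ge1$. $\lambda$ is a fixed constant depending only on $K$ such that for every totally positive $h\in\mathcal O$ there is a unit $\epsilon$ with $(\epsilon^2h)^{(\nu)}\le\lambda(\epsilon^2h)^{(\mu)}$ for all real embeddings $\nu,\mu$. $Q$ is weakly reduced if (1) $\mathrm N_{K/\mathbb Q}(h_1)=\min(Q)$ and $\mathrm N_{K/\mathbb Q}(h_i)\le\bar\alpha(j-i)\mathrm N_{K/\mathbb Q}(h_j)$ for $1\le i<j\le n$, and (2) $h_i^{(\nu)}\le\lambda h_i^{(\mu)}$ for all $i,\nu,\mu$. Let $K_\infty=\prod_\nu\mathbb R$ with $\mathcal O\hookrightarrow K_\infty$ via $a\mapsto(a^{(\nu)})$, $\beta:=\inf\{r>0:\forall(\alpha_\nu)\in K_\infty\ \exists a\in\mathcal O,\ |\alpha_\nu-a^{(\nu)}|<r\ \forall\nu\}$, $\mathcal B_K:=\{(\alpha_\nu):|\alpha_\nu|\le\beta\ \forall\nu\}$.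 $Q$ is HKZ-reduced if it is weakly reduced and each $u_{ij}$ (as $(u_{ij}^{(\nu)})_\nu$) lies in $\mathcal B_K$. *)

theory Defs
  imports
    "HOL-Analysis.Ball_Volume"
    "HOL-Analysis.Harmonic_Numbers"
    "HOL-Algebra.Ideal"
    "Jordan_Normal_Form.Determinant"
begin

unbundle no vec_syntax

section \<open>Totally real number fields\<close>

text \<open>The number field $K$ is the universe of a type of characteristic 0.\<close>

definition rat_scale :: "rat \<Rightarrow> 'k::field_char_0 \<Rightarrow> 'k" where
  "rat_scale q a = of_rat q * a"

definition number_field_degree :: "'k::field_char_0 itself \<Rightarrow> nat" where
  "number_field_degree _ = Vector_Spaces.vector_space.dim rat_scale (UNIV :: 'k set)"

definition totally_real_number_field :: "'k::field_char_0 itself \<Rightarrow> bool" where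
  "totally_real_number_field _ \<longleftrightarrow>
     (\<exists>S :: 'k set. finite S \<and> Modules.module.span rat_scale S = UNIV) \<and>
     (\<forall>\<sigma> :: 'k \<Rightarrow> complex. field_hom \<sigma> \<longrightarrow> range \<sigma> \<subseteq> \<real>)"

definition real_embeddings :: "('k::field_char_0 \<Rightarrow> real) set" where
  "real_embeddings = {\<nu>. field_hom \<nu>}"

text \<open>For totally real $K$ the real embeddings are all the embeddings into the complex numbers,
  so the following are the norm and trace from $K$ down to the rationals, viewed as reals.\<close>

definition field_norm :: "'k::field_char_0 \<Rightarrow> real" where
  "field_norm a = (\<Prod>\<nu>\<in>real_embeddings. \<nu> a)"

definition field_trace :: "'k::field_char_0 \<Rightarrow> real" where
  "field_trace a = (\<Sum>\<nu>\<in>real_embeddings. \<nu> a)"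

definition totally_positive :: "'k::field_char_0 \<Rightarrow> bool" where
  "totally_positive a \<longleftrightarrow> (\<forall>\<nu>\<in>real_embeddings. 0 < \<nu> a)"

definition integer_ring :: "'k::field_char_0 ring" where
  "integer_ring = \<lparr>carrier = {a. algebraic_int a}, monoid.mult = (*), one = 1,
                    ring.zero = 0, add = (+)\<rparr>"

abbreviation integers :: "'k::field_char_0 set" ("\<O>") where
  "\<O> \<equiv> carrier integer_ring"

definition integral_vecs :: "nat \<Rightarrow> 'k::field_char_0 Matrix.vec set" where
  "integral_vecs n = {x \<in> carrier_vec n. \<forall>i<n. x $ i \<in> \<O>}"

definition integral_basis :: "(nat \<Rightarrow> 'k::field_char_0) \<Rightarrow> bool" where
  "integral_basis w \<longleftrightarrow>
     bij_betw (\<lambda>c :: int Matrix.vec. \<Sum>i<number_field_degree TYPE('k). of_int (c $ i) * w i)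
       (carrier_vec (number_field_degree TYPE('k))) \<O>"

definition field_discriminant :: "'k::field_char_0 itself \<Rightarrow> real" where
  "field_discriminant _ =
     (THE D. \<exists>w :: nat \<Rightarrow> 'k. integral_basis w \<and>
        D = Determinant.det
              (mat (number_field_degree TYPE('k)) (number_field_degree TYPE('k))
                 (\<lambda>(i, j). field_trace (w i * w j))))"

definition nonzero_ideals :: "'k::field_char_0 set set" where
  "nonzero_ideals = {I. ideal I integer_ring \<and> I \<noteq> {0}}"

definition ideal_equivalence :: "('k::field_char_0 set \<times> 'k set) set" where
  "ideal_equivalence = {(I, J). I \<in> nonzero_ideals \<and> J \<in> nonzero_ideals \<and>
     (\<exists>a\<in>\<O> - {0}. \<exists>b\<in>\<O> - {0}. (\<lambda>x. a * x) ` I = (\<lambda>x. b * x) ` J)}"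

definition class_number :: "'k::field_char_0 itself \<Rightarrow> nat" where
  "class_number _ = card ((nonzero_ideals :: 'k set set) // ideal_equivalence)"

section \<open>The constants\<close>

definition sigma_const :: "'k::field_char_0 itself \<Rightarrow> nat \<Rightarrow> real" where
  "sigma_const K k =
     4 ^ number_field_degree K *
     unit_ball_vol (real k) powr (- 2 * real (number_field_degree K) / real k) *
     \<bar>field_discriminant K\<bar>"

definition alpha_const :: "'k::field_char_0 itself \<Rightarrow> nat \<Rightarrow> real" where
  "alpha_const K m =
     sigma_const K (m + 1) * (\<Prod>k=2..m+1. sigma_const K k powr (1 / (real k - 1)))"

definition alpha_bar :: "'k::field_char_0 itself \<Rightarrow> real \<Rightarrow> nat \<Rightarrow> real" where
  "alpha_bar K D\<^sub>1 m =
     D\<^sub>1 * \<bar>field_discriminant K\<bar> powr (1 + harm m) *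
     exp (real (number_field_degree K) / 2 * (ln (real m))\<^sup>2)"

definition admissible_D1 :: "'k::field_char_0 itself \<Rightarrow> real \<Rightarrow> bool" where
  "admissible_D1 K D\<^sub>1 \<longleftrightarrow>
     (\<forall>m\<ge>1. alpha_const K m \<le> alpha_bar K D\<^sub>1 m \<and> 1 \<le> alpha_bar K D\<^sub>1 m)"

definition admissible_lambda :: "'k::field_char_0 itself \<Rightarrow> real \<Rightarrow> bool" where
  "admissible_lambda _ l \<longleftrightarrow>
     (\<forall>h\<in>(\<O> :: 'k set). totally_positive h \<longrightarrow>
        (\<exists>\<epsilon>\<in>Units integer_ring. \<forall>\<nu>\<in>real_embeddings. \<forall>\<mu>\<in>real_embeddings.
           \<nu> (\<epsilon>\<^sup>2 * h) \<le> l * \<mu> (\<epsilon>\<^sup>2 * h)))"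

text \<open>Elements of $K_\infty$ are functions on the set of real embeddings.\<close>

definition beta_const :: "'k::field_char_0 itself \<Rightarrow> real" where
  "beta_const _ =
     Inf {r. 0 < r \<and>
        (\<forall>\<alpha> :: ('k \<Rightarrow> real) \<Rightarrow> real. \<exists>a\<in>\<O>. \<forall>\<nu>\<in>real_embeddings. \<bar>\<alpha> \<nu> - \<nu> a\<bar> < r)}"

section \<open>Reduced quadratic forms\<close>

text \<open>A quadratic form in $n$ variables over $K$ is given by its $n \times n$ Gram matrix;
  variables are numbered from 0.\<close>

definition form_value :: "'k::field_char_0 mat \<Rightarrow> 'k Matrix.vec \<Rightarrow> 'k" where
  "form_value A x = x \<bullet> (A *\<^sub>v x)"

definition form_min :: "nat \<Rightarrow> 'k::field_char_0 mat \<Rightarrow> real" where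
  "form_min n A =
     (LEAST r. \<exists>x\<in>integral_vecs n. x \<noteq> 0\<^sub>v n \<and> r = field_norm (form_value A x))"

definition lagrange_expansion ::
  "nat \<Rightarrow> 'k::field_char_0 mat \<Rightarrow> (nat \<Rightarrow> 'k) \<Rightarrow> (nat \<Rightarrow> nat \<Rightarrow> 'k) \<Rightarrow> bool" where
  "lagrange_expansion n A h u \<longleftrightarrow>
     (\<forall>x\<in>carrier_vec n.
        form_value A x = (\<Sum>i<n. h i * (x $ i + (\<Sum>j\<in>{i<..<n}. u i j * x $ j))\<^sup>2))"

text \<open>The outer coefficients \<open>h\<close> of the Lagrange expansion are passed explicitly.
  The guard \<open>0 < n\<close> only concerns the form in no variables.\<close>

definition weakly_reduced ::
  "real \<Rightarrow> real \<Rightarrow> nat \<Rightarrow> 'k::field_char_0 mat \<Rightarrow> (nat \<Rightarrow> 'k) \<Rightarrow> bool" where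
  "weakly_reduced D\<^sub>1 l n A h \<longleftrightarrow>
     (0 < n \<longrightarrow> field_norm (h 0) = form_min n A) \<and>
     (\<forall>i j. i < j \<and> j < n \<longrightarrow>
        field_norm (h i) \<le> alpha_bar TYPE('k) D\<^sub>1 (j - i) * field_norm (h j)) \<and>
     (\<forall>i<n. \<forall>\<nu>\<in>real_embeddings. \<forall>\<mu>\<in>real_embeddings. \<nu> (h i) \<le> l * \<mu> (h i))"

text \<open>The Lagrange expansion of a positive definite form is unique, so for such forms the
  existential quantifier picks out its coefficients.\<close>

definition HKZ_reduced :: "real \<Rightarrow> real \<Rightarrow> nat \<Rightarrow> 'k::field_char_0 mat \<Rightarrow> bool" where
  "HKZ_reduced D\<^sub>1 l n A \<longleftrightarrow>
     (\<exists>h u. lagrange_expansion n A h u \<and> weakly_reduced D\<^sub>1 l n A h \<and>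
        (\<forall>i j. i < j \<and> j < n \<longrightarrow>
           (\<forall>\<nu>\<in>real_embeddings. \<bar>\<nu> (u i j)\<bar> \<le> beta_const TYPE('k))))"

section \<open>Lattices\<close>

text \<open>The normalisation of the associated bilinear form is \<open>B x x = Q x\<close>, so that the form with
  Gram matrix $(B(u_i,u_j))$ is $Q$ in the coordinates given by the $u_i$.\<close>

definition bilinear_form_of ::
  "('v::ab_group_add \<Rightarrow> 'k::field_char_0) \<Rightarrow> 'v \<Rightarrow> 'v \<Rightarrow> 'k" where
  "bilinear_form_of Q x y = (Q (x + y) - Q x - Q y) / 2"

definition quadratic_space ::
  "('k::field_char_0 \<Rightarrow> 'v::ab_group_add \<Rightarrow> 'v) \<Rightarrow> ('v \<Rightarrow> 'k) \<Rightarrow> bool" where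
  "quadratic_space smul Q \<longleftrightarrow>
     Vector_Spaces.vector_space smul \<and>
     (\<forall>a x. Q (smul a x) = a\<^sup>2 * Q x) \<and>
     (\<forall>y. Vector_Spaces.linear smul (*) (\<lambda>x. bilinear_form_of Q x y))"

definition integral_span ::
  "('k::field_char_0 \<Rightarrow> 'v::ab_group_add \<Rightarrow> 'v) \<Rightarrow> 'v set \<Rightarrow> 'v set" where
  "integral_span smul S = {\<Sum>s\<in>T. smul (c s) s | T c. finite T \<and> T \<subseteq> S \<and> c ` T \<subseteq> \<O>}"

text \<open>The quadratic space $V$ is the universe of the type \<open>'v\<close>.\<close>

definition positive_definite_lattice ::
  "('k::field_char_0 \<Rightarrow> 'v::ab_group_add \<Rightarrow> 'v) \<Rightarrow> ('v \<Rightarrow> 'k) \<Rightarrow> nat \<Rightarrow> 'v set \<Rightarrow> bool" where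
  "positive_definite_lattice smul Q n \<Lambda> \<longleftrightarrow>
     quadratic_space smul Q \<and>
     Vector_Spaces.vector_space.dim smul (UNIV :: 'v set) = n \<and>
     (\<exists>S. finite S \<and> \<Lambda> = integral_span smul S) \<and>
     Modules.module.span smul \<Lambda> = UNIV \<and>
     (\<forall>x. x \<noteq> 0 \<longrightarrow> totally_positive (Q x))"

definition lattice_min :: "('v::ab_group_add \<Rightarrow> 'k::field_char_0) \<Rightarrow> 'v set \<Rightarrow> real" where
  "lattice_min Q \<Lambda> = (LEAST r. \<exists>x\<in>\<Lambda>. x \<noteq> 0 \<and> r = field_norm (Q x))"

definition lattice_basis ::
  "('k::field_char_0 \<Rightarrow> 'v::ab_group_add \<Rightarrow> 'v) \<Rightarrow> nat \<Rightarrow> (nat \<Rightarrow> 'v) \<Rightarrow> 'v set \<Rightarrow> bool" where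
  "lattice_basis smul n u L \<longleftrightarrow>
     bij_betw (\<lambda>c. \<Sum>i<n. smul (c $ i) (u i)) (integral_vecs n) L"

definition free_lattice ::
  "('k::field_char_0 \<Rightarrow> 'v::ab_group_add \<Rightarrow> 'v) \<Rightarrow> 'v set \<Rightarrow> bool" where
  "free_lattice smul L \<longleftrightarrow> (\<exists>m u. lattice_basis smul m u L)"

definition HKZ_reduced_basis ::
  "('k::field_char_0 \<Rightarrow> 'v::ab_group_add \<Rightarrow> 'v) \<Rightarrow> ('v \<Rightarrow> 'k) \<Rightarrow> real \<Rightarrow> real \<Rightarrow>
     nat \<Rightarrow> (nat \<Rightarrow> 'v) \<Rightarrow> 'v set \<Rightarrow> bool" where
  "HKZ_reduced_basis smul Q D\<^sub>1 l n u L \<longleftrightarrow>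
     lattice_basis smul n u L \<and>
     HKZ_reduced D\<^sub>1 l n (mat n n (\<lambda>(i, j). bilinear_form_of Q (u i) (u j)))"

definition lattice_quotient :: "'v::ab_group_add set \<Rightarrow> 'v set \<Rightarrow> 'v set set" where
  "lattice_quotient \<Lambda> L = \<Lambda> // {(x, y). x \<in> \<Lambda> \<and> y \<in> \<Lambda> \<and> x - y \<in> L}"

end

theory Submission
  imports Defs "Jordan_Normal_Form.Char_Poly"
begin

text \<open>Choose a vector \<open>v\<close> of \<open>\<Lambda>\<close> for which the norm of \<open>Q v\<close> is minimal, project \<open>\<Lambda>\<close> orthogonally along \<open>v\<close>,
  and lift a reduced basis of the projection. Multiplying \<open>v\<close> by a unit balances the conjugates of
  \<open>Q v\<close>, and subtracting multiples of \<open>v\<close> from the lifts bounds the inner coefficients. By minimality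
  of \<open>v\<close>, the fractional ideal of all \<open>a\<close> with \<open>a v \<in> \<Lambda>\<close> contains no nonzero element of norm
  less than 1, so translates of a cross-polytope by its elements do not overlap; comparing volumes
  bounds its index over the ring of integers by Minkowski's constant, which gives the index bound
  one projection at a time. Each outer coefficient is the minimum of a projected lattice that contains
  the corresponding tail of the form, so Minkowski's theorem, applied to a product of ellipsoids,
  bounds it by the determinants of the blocks that follow; multiplying these bounds up yields the
  constants \<open>\<alpha>\<close>. The number of real embeddings and the nonvanishing of their determinant come from
  diagonalising the action of the field on its rational-linear functionals.\<close>

section \<open>Embeddings of a number field\<close>

text \<open>The lattice need not be free, and the norm of the form is a product over embeddings
  rather than one convex function. Hence the convex bodies: the inequality of arithmetic and
  geometric means puts a cross-polytope inside the region of norm below 1, and bounding each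
  conjugate of the form separately gives a product of ellipsoids. Both enter through one packing
  lemma. The induction lowers the dimension of the span of the generators, while the ambient space
  and the number of generators stay fixed; generators may thus become dependent or zero. One
  projection costs one factor \<open>minkowski_const\<close>, so the exponent is n; as the constant
  is at least 1, n^2 follows. With class number 1 the coefficient ideal of a minimal vector is
  principal. Passing to a generator keeps the vector minimal and makes the ideal integral, so no
  index is lost. The factor for k in \<alpha> has exponent 1/(k-1) because Minkowski's bound for an
  outer coefficient contains that coefficient itself under a k-th root. As the dimensions vary
  within the proof, measures live on \<open>PiM\<close> over finite index sets and determinants are
  those of explicit matrices.\<close>

lemma vector_space_rat_scale:
  "Vector_Spaces.vector_space (rat_scale :: rat \<Rightarrow> 'k::field_char_0 \<Rightarrow> 'k)"
  by unfold_locales (auto simp: rat_scale_def algebra_simps of_rat_add of_rat_mult)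

text \<open>Writing T for the operator that sends a functional \<phi> to its composite with
  multiplication by a, this is p(T) \<phi> evaluated at x. The complex coefficients have no meaning
  inside the field, so a polynomial acts on functionals instead of on elements.\<close>

definition poly_act :: "'k::field_char_0 \<Rightarrow> ('k \<Rightarrow> complex) \<Rightarrow> complex poly \<Rightarrow> 'k \<Rightarrow> complex" where
  "poly_act a \<phi> p x = (\<Sum>i\<le>degree p. coeff p i * \<phi> (a ^ i * x))"

lemma poly_act_bound:
  assumes "degree p \<le> N"
  shows "poly_act a \<phi> p x = (\<Sum>i\<le>N. coeff p i * \<phi> (a ^ i * x))"
  unfolding poly_act_def using assms
  by (intro sum.mono_neutral_left) (auto simp: coeff_eq_0)

lemma poly_act_linear_factor:
  "poly_act a \<phi> ([:- z, 1:] * p) x = poly_act a (\<lambda>x. \<phi> (a * x) - z * \<phi> x) p x"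
proof -
  define N where "N = Suc (degree p)"
  have "degree ([:- z, 1:] * p) \<le> N"
    using degree_mult_le[of "[:- z, 1:]" p] by (simp add: N_def)
  hence "poly_act a \<phi> ([:- z, 1:] * p) x = (\<Sum>i\<le>N. coeff ([:- z, 1:] * p) i * \<phi> (a ^ i * x))"
    by (rule poly_act_bound)
  also have "[:- z, 1:] * p = pCons 0 p - smult z p"
    by simp
  also have "(\<Sum>i\<le>N. coeff (pCons 0 p - smult z p) i * \<phi> (a ^ i * x)) =
     (\<Sum>i\<le>N. coeff (pCons 0 p) i * \<phi> (a ^ i * x)) - z * (\<Sum>i\<le>N. coeff p i * \<phi> (a ^ i * x))"
    by (simp add: algebra_simps sum_subtractf sum_distrib_left)
  also have "(\<Sum>i\<le>N. coeff (pCons 0 p) i * \<phi> (a ^ i * x)) =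
      (\<Sum>i\<le>degree p. coeff p i * \<phi> (a ^ i * (a * x)))"
    unfolding N_def by (subst sum.atMost_Suc_shift) (simp add: mult_ac)
  also have "(\<Sum>i\<le>N. coeff p i * \<phi> (a ^ i * x)) = (\<Sum>i\<le>degree p. coeff p i * \<phi> (a ^ i * x))"
    using poly_act_bound[of p N a \<phi> x] by (simp add: N_def poly_act_def)
  finally show ?thesis
    by (simp add: poly_act_def algebra_simps sum_subtractf sum_distrib_left)
qed

definition rat_linear :: "('k::field_char_0 \<Rightarrow> complex) \<Rightarrow> bool" where
  "rat_linear \<phi> \<longleftrightarrow> (\<forall>x y. \<phi> (x + y) = \<phi> x + \<phi> y) \<and> (\<forall>q x. \<phi> (of_rat q * x) = of_rat q * \<phi> x)"

lemma rat_linear_0: "rat_linear \<phi> \<Longrightarrow> \<phi> 0 = 0"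
  unfolding rat_linear_def by (metis add_cancel_right_right add_0)

lemma rat_linear_sum:
  assumes "rat_linear \<phi>"
  shows "\<phi> (\<Sum>i\<in>I. of_rat (c i) * f i) = (\<Sum>i\<in>I. of_rat (c i) * \<phi> (f i))"
proof (cases "finite I")
  case True
  thus ?thesis
    by induction (use assms in \<open>auto simp: rat_linear_0 rat_linear_def\<close>)
qed (use assms in \<open>auto simp: rat_linear_0\<close>)

text \<open>A common eigenvector of the multiplications by elements of A on the space of
  rational-linear functionals, with eigenvalue \<open>e a\<close> at a. The zero functional counts
  as one, so components of a decomposition may vanish.\<close>

definition eigenform :: "'k::field_char_0 set \<Rightarrow> ('k \<Rightarrow> complex) \<Rightarrow> ('k \<Rightarrow> complex) \<Rightarrow> bool" where
  "eigenform A e \<phi> \<longleftrightarrow> rat_linear \<phi> \<and> (\<forall>a\<in>A. \<forall>x. \<phi> (a * x) = e a * \<phi> x)"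

lemma eigenform_shift:
  "eigenform A e \<phi> \<Longrightarrow> eigenform A e (\<lambda>x. \<phi> (a * x) - z * \<phi> x)"
  unfolding eigenform_def rat_linear_def
proof (safe, goal_cases)
  case (2 q x)
  thus ?case by (metis (no_types, lifting) mult.left_commute right_diff_distrib)
next
  case (3 b x)
  have "\<phi> (a * (b * x)) = e b * \<phi> (a * x)" "\<phi> (b * x) = e b * \<phi> x"
    using 3 by (metis mult.left_commute)+
  thus ?case by (simp add: algebra_simps)
qed (simp add: distrib_left)

lemma eigenform_scale: "eigenform A e \<phi> \<Longrightarrow> eigenform A e (\<lambda>x. c * \<phi> x)"
  unfolding eigenform_def rat_linear_def by (auto simp: algebra_simps)

lemma eigenform_diff:
  "eigenform A e \<phi> \<Longrightarrow> eigenform A e \<psi> \<Longrightarrow> eigenform A e (\<lambda>x. \<phi> x - \<psi> x)"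
  unfolding eigenform_def rat_linear_def by (auto simp: algebra_simps)

lemma eigenform_sum:
  assumes "finite Z" "\<And>z. z \<in> Z \<Longrightarrow> eigenform A e (g z)"
  shows "eigenform A e (\<lambda>x. \<Sum>z\<in>Z. g z x)"
  using assms unfolding eigenform_def rat_linear_def
  by (simp add: sum.distrib sum_distrib_left)

text \<open>Diagonalisation of an operator T annihilated by a product of distinct linear factors.
  The functional (T - z) \<phi> is killed by the factors other than that of z and decomposes by
  induction; dividing its component for y by y - z and subtracting the results from \<phi> leaves an
  eigenvector for z.\<close>

lemma eigenform_decompose:
  fixes Z :: "complex set"
  assumes "finite Z" "eigenform A e \<phi>" "\<And>x. poly_act a \<phi> (\<Prod>z\<in>Z. [:- z, 1:]) x = 0"
  shows "\<exists>g. (\<forall>z\<in>Z. eigenform A e (g z) \<and> (\<forall>x. g z (a * x) = z * g z x)) \<and>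
             (\<forall>x. \<phi> x = (\<Sum>z\<in>Z. g z x))"
  using assms
proof (induction arbitrary: \<phi> rule: finite_induct)
  case empty
  thus ?case by (simp add: poly_act_def)
next
  case (insert z Z)
  define \<psi> where "\<psi> = (\<lambda>x. \<phi> (a * x) - z * \<phi> x)"
  have "eigenform A e \<psi>"
    unfolding \<psi>_def by (rule eigenform_shift) (rule insert.prems)
  moreover have "poly_act a \<psi> (\<Prod>z\<in>Z. [:- z, 1:]) x = 0" for x
    using insert.prems(2)[of x] insert.hyps
    by (simp add: \<psi>_def poly_act_linear_factor del: mult_pCons_left)
  ultimately obtain g where g: "\<And>y. y \<in> Z \<Longrightarrow> eigenform A e (g y)"
    "\<And>y x. y \<in> Z \<Longrightarrow> g y (a * x) = y * g y x" "\<And>x. \<psi> x = (\<Sum>y\<in>Z. g y x)"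
    using insert.IH by blast
  define f where "f = (\<lambda>y x. 1 / (y - z) * g y x)"
  define f0 where "f0 = (\<lambda>x. \<phi> x - (\<Sum>y\<in>Z. f y x))"
  have f: "eigenform A e (f y)" "f y (a * x) = y * f y x" if "y \<in> Z" for y x
    unfolding f_def by (intro eigenform_scale g that) (simp add: g that)
  have "eigenform A e f0"
    unfolding f0_def using f insert by (intro eigenform_diff eigenform_sum) auto
  moreover have "f0 (a * x) = z * f0 x" for x
  proof -
    have "(\<Sum>y\<in>Z. f y (a * x)) - z * (\<Sum>y\<in>Z. f y x) = (\<Sum>y\<in>Z. (y - z) * f y x)"
      by (simp add: f sum_distrib_left sum_subtractf algebra_simps)
    also have "\<dots> = (\<Sum>y\<in>Z. g y x)"
      unfolding f_def using insert.hyps by (intro sum.cong) auto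
    also have "\<dots> = \<phi> (a * x) - z * \<phi> x"
      using g(3)[of x] by (simp add: \<psi>_def)
    finally show ?thesis
      by (simp add: f0_def algebra_simps)
  qed
  ultimately show ?case
    using f insert.hyps
    by (intro exI[of _ "f(z := f0)"]) (auto simp: f0_def intro!: sum.cong)
qed

lemma minimal_degree_poly_dvd:
  fixes z :: "'a::field_char_0"
  assumes "q \<noteq> 0" "poly (map_poly of_rat q) z = 0"
  obtains r :: "rat poly" where "r \<noteq> 0" "poly (map_poly of_rat r) z = 0" "0 < degree r"
    "\<And>p. poly (map_poly of_rat p) z = 0 \<Longrightarrow> r dvd p"
proof -
  interpret k: map_poly_inj_idom_hom "of_rat :: rat \<Rightarrow> 'a" ..
  define P where "P = (\<lambda>p :: rat poly. p \<noteq> 0 \<and> poly (map_poly of_rat p) z = 0)"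
  obtain r where r: "P r" "\<And>p. P p \<Longrightarrow> degree r \<le> degree p"
    using ex_has_least_nat[of P q degree] assms unfolding P_def by blast
  have "degree r > 0"
  proof (rule ccontr)
    assume "\<not> degree r > 0"
    then obtain c where "r = [:c:]" using degree_eq_zeroE by blast
    thus False using r(1) by (auto simp: P_def map_poly_pCons)
  qed
  moreover have "r dvd p" if "poly (map_poly of_rat p) z = 0" for p
  proof -
    have "p mod r = p - p div r * r" by (simp add: minus_div_mult_eq_mod)
    hence "poly (map_poly of_rat (p mod r)) z = 0"
      using that r(1) by (simp add: P_def k.hom_mult k.hom_minus)
    moreover have "p mod r = 0 \<or> degree (p mod r) < degree r"
      using degree_mod_less[of r p] r(1) by (auto simp: P_def)
    ultimately have "p mod r = 0"
      using r(2)[of "p mod r"] by (force simp: P_def)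
    thus ?thesis by auto
  qed
  ultimately show ?thesis using that[of r] r(1) by (auto simp: P_def)
qed

text \<open>Take p of least degree over the rationals. If p had a double complex root z, the minimal
  polynomial r of z would divide p and its derivative, so it would have smaller degree than p and p
  = r s. Then a is a root of r or of s, and p would divide a nonzero polynomial of smaller
  degree.\<close>

lemma squarefree_annihilator:
  fixes a :: "'k::field_char_0"
  assumes "q \<noteq> 0" "poly (map_poly of_rat q) a = 0"
  shows "\<exists>p :: rat poly. p \<noteq> 0 \<and> poly (map_poly of_rat p) a = 0 \<and>
           rsquarefree (map_poly of_rat p :: complex poly)"
proof -
  interpret k: map_poly_inj_idom_hom "of_rat :: rat \<Rightarrow> 'k" ..
  obtain p :: "rat poly" where p: "p \<noteq> 0" "poly (map_poly of_rat p) a = 0" "0 < degree p"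
    "\<And>r. poly (map_poly of_rat r) a = 0 \<Longrightarrow> p dvd r"
    using minimal_degree_poly_dvd[OF assms] by blast
  have "rsquarefree (map_poly of_rat p :: complex poly)"
    unfolding rsquarefree_roots
  proof safe
    fix z :: complex
    assume z: "poly (map_poly of_rat p) z = 0" "poly (pderiv (map_poly of_rat p)) z = 0"
    obtain r :: "rat poly" where r: "r \<noteq> 0" "poly (map_poly of_rat r) z = 0" "0 < degree r"
      "\<And>p. poly (map_poly of_rat p) z = 0 \<Longrightarrow> r dvd p"
      using minimal_degree_poly_dvd[OF p(1) z(1)] by blast
    have "r dvd pderiv p"
      using z(2) by (intro r(4)) (simp add: of_rat_hom.map_poly_pderiv)
    moreover have "pderiv p \<noteq> 0" using p(3) by (simp add: pderiv_eq_0_iff)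
    ultimately have "degree r \<le> degree (pderiv p)"
      by (intro dvd_imp_degree_le)
    hence dr: "degree r < degree p" using p(3) by (simp add: degree_pderiv)
    obtain s where s: "p = r * s" using r(4)[OF z(1)] by (elim dvdE)
    have s0: "s \<noteq> 0" using s p(1) by auto
    have ds: "degree s < degree p" using s r(3) r(1) s0 by (simp add: degree_mult_eq)
    have "poly (map_poly of_rat r) a * poly (map_poly of_rat s) a = 0"
      using p(2) s by (simp add: k.hom_mult)
    hence "p dvd r \<or> p dvd s"
      using p(4) by auto
    thus False
      using dr ds dvd_imp_degree_le[of p r] dvd_imp_degree_le[of p s] r(1) s0 by auto
  qed
  thus ?thesis using p by blast
qed

text \<open>Finite sums of functions from a class. The inductive form lets a decomposition be
  refined summand by summand through rule induction.\<close>

inductive sum_closure :: "(('k \<Rightarrow> complex) \<Rightarrow> bool) \<Rightarrow> ('k \<Rightarrow> complex) \<Rightarrow> bool" for P where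
  zero: "sum_closure P (\<lambda>_. 0)"
| add: "P f \<Longrightarrow> sum_closure P g \<Longrightarrow> sum_closure P (\<lambda>x. f x + g x)"

lemma sum_closure_plus:
  assumes "sum_closure P f" "sum_closure P g"
  shows "sum_closure P (\<lambda>x. f x + g x)"
  using assms by induction (auto simp: add.assoc intro: sum_closure.add)

lemma sum_closure_sum:
  assumes "finite Z" "\<And>z. z \<in> Z \<Longrightarrow> P (g z)"
  shows "sum_closure P (\<lambda>x. \<Sum>z\<in>Z. g z x)"
  using assms by induction (auto intro: sum_closure.intros)

lemma sum_closure_trans:
  assumes "sum_closure P f" "\<And>g. P g \<Longrightarrow> sum_closure P' g"
  shows "sum_closure P' f"
  using assms by induction (auto intro: sum_closure.zero sum_closure_plus)

text \<open>Multiplications commute, so the eigencomponents for a new element remain eigenvectors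
  for the earlier ones. Each multiplication is diagonalisable because its annihilating polynomial
  can be chosen with distinct complex roots.\<close>

lemma rat_linear_sum_of_eigenforms:
  fixes A :: "'k::field_char_0 set"
  assumes "finite A" "rat_linear \<phi>"
    "\<And>a. a \<in> A \<Longrightarrow> \<exists>q. q \<noteq> 0 \<and> poly (map_poly of_rat q) a = 0"
  shows "sum_closure (\<lambda>\<psi>. \<exists>e. eigenform A e \<psi>) \<phi>"
  using assms
proof (induction rule: finite_induct)
  case empty
  have "sum_closure (\<lambda>\<psi>. \<exists>e. eigenform {} e \<psi>) (\<lambda>x. \<phi> x + 0)"
    using empty by (intro sum_closure.intros) (auto simp: eigenform_def)
  thus ?case by simp
next
  case (insert a A)
  obtain q :: "rat poly" where q: "q \<noteq> 0" "poly (map_poly of_rat q) a = 0"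
    "rsquarefree (map_poly of_rat q :: complex poly)"
    using squarefree_annihilator insert.prems(2)[of a] by blast
  define qc where "qc = (map_poly of_rat q :: complex poly)"
  define Z where "Z = {z. poly qc z = 0}"
  have qc0: "qc \<noteq> 0" using q(3) by (auto simp: qc_def rsquarefree_def)
  have fin: "finite Z" unfolding Z_def using qc0 by (rule poly_roots_finite)
  have fact: "smult (lead_coeff qc) (\<Prod>z\<in>Z. [:- z, 1:]) = qc"
    unfolding Z_def by (rule complex_poly_decompose_rsquarefree) (use q in \<open>simp add: qc_def\<close>)
  have annih: "poly_act a \<psi> (\<Prod>z\<in>Z. [:- z, 1:]) x = 0" if "rat_linear \<psi>" for \<psi> x
  proof -
    have "lead_coeff qc * poly_act a \<psi> (\<Prod>z\<in>Z. [:- z, 1:]) x =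
          poly_act a \<psi> (smult (lead_coeff qc) (\<Prod>z\<in>Z. [:- z, 1:])) x"
      using qc0 by (simp add: poly_act_def sum_distrib_left mult_ac)
    also have "\<dots> = poly_act a \<psi> qc x" by (simp add: fact)
    also have "\<dots> = (\<Sum>i\<le>degree q. of_rat (coeff q i) * \<psi> (a ^ i * x))"
      by (simp add: poly_act_def qc_def)
    also have "\<dots> = \<psi> (\<Sum>i\<le>degree q. of_rat (coeff q i) * (a ^ i * x))"
      by (rule rat_linear_sum[OF that, symmetric])
    also have "(\<Sum>i\<le>degree q. of_rat (coeff q i) * (a ^ i * x)) = poly (map_poly of_rat q) a * x"
      unfolding poly_altdef sum_distrib_right by (simp add: mult_ac)
    also have "\<dots> = 0" using q by simp
    finally show ?thesis using qc0 rat_linear_0[OF that] by simp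
  qed
  have step: "sum_closure (\<lambda>\<psi>. \<exists>e. eigenform (insert a A) e \<psi>) \<psi>" if e: "eigenform A e \<psi>" for \<psi> e
  proof -
    have lin: "rat_linear \<psi>" using e by (simp add: eigenform_def)
    obtain g where g: "\<And>z. z \<in> Z \<Longrightarrow> eigenform A e (g z)" "\<And>z x. z \<in> Z \<Longrightarrow> g z (a * x) = z * g z x"
      "\<And>x. \<psi> x = (\<Sum>z\<in>Z. g z x)"
      using eigenform_decompose[OF fin e annih[OF lin]] by blast
    have "sum_closure (\<lambda>\<psi>. \<exists>e. eigenform (insert a A) e \<psi>) (\<lambda>x. \<Sum>z\<in>Z. g z x)"
    proof (rule sum_closure_sum[OF fin])
      fix z assume z: "z \<in> Z"
      have "eigenform (insert a A) (e(a := z)) (g z)"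
        using g(1,2)[OF z] insert.hyps by (auto simp: eigenform_def)
      thus "\<exists>e. eigenform (insert a A) e (g z)" by blast
    qed
    moreover have "\<psi> = (\<lambda>x. \<Sum>z\<in>Z. g z x)" using g(3) by auto
    ultimately show ?thesis by simp
  qed
  have "sum_closure (\<lambda>\<psi>. \<exists>e. eigenform A e \<psi>) \<phi>"
    by (rule insert.IH[OF insert.prems(1)], rule insert.prems(2)) simp
  thus ?case
    by (rule sum_closure_trans) (use step in blast)
qed

text \<open>An eigenvector of a spanning set of multiplications is an eigenvector of all of them.
  The eigenvalue at a equals \<open>\<psi> a / \<psi> 1\<close>, hence is both additive and
  multiplicative in a. The zero functional is the case c = 0.\<close>

lemma eigenform_spanning_is_hom:
  fixes B :: "'k::field_char_0 set"
  assumes "Modules.module.span rat_scale B = UNIV" "eigenform B e \<psi>"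
  shows "\<exists>c \<sigma>. \<psi> = (\<lambda>x. c * \<sigma> x) \<and> (c = 0 \<or> field_hom \<sigma>)"
proof (cases "\<psi> = (\<lambda>_. 0)")
  case True
  thus ?thesis by (intro exI[of _ 0] exI[of _ \<psi>]) auto
next
  case False
  interpret V: Vector_Spaces.vector_space "rat_scale :: rat \<Rightarrow> 'k \<Rightarrow> 'k"
    by (rule vector_space_rat_scale)
  have lin: "rat_linear \<psi>" using assms(2) by (simp add: eigenform_def)
  have "a \<in> V.span B \<Longrightarrow> \<exists>z. \<forall>x. \<psi> (a * x) = z * \<psi> x" for a
  proof (induction rule: V.span_induct_alt)
    case base
    show ?case using rat_linear_0[OF lin] by (intro exI[of _ 0]) auto
  next
    case (step c b y)
    then obtain z where z: "\<And>x. \<psi> (y * x) = z * \<psi> x" by blast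
    have "\<psi> ((rat_scale c b + y) * x) = (of_rat c * e b + z) * \<psi> x" for x
      using lin assms(2) step(1) z[of x]
      by (simp add: rat_linear_def eigenform_def rat_scale_def distrib_right mult.assoc)
    thus ?case by blast
  qed
  hence ex: "\<exists>z. \<forall>x. \<psi> (a * x) = z * \<psi> x" for a using assms(1) by auto
  then obtain \<sigma> where \<sigma>: "\<And>a x. \<psi> (a * x) = \<sigma> a * \<psi> x" by metis
  have eq: "\<psi> a = \<psi> 1 * \<sigma> a" for a using \<sigma>[of a 1] by simp
  have nz: "\<psi> 1 \<noteq> 0"
  proof
    assume "\<psi> 1 = 0"
    hence "\<psi> a = 0" for a by (subst eq) simp
    with False show False by auto
  qed
  have \<sigma>': "\<sigma> a = \<psi> a / \<psi> 1" for a by (subst eq) (simp add: nz)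
  have "field_hom \<sigma>"
  proof unfold_locales
    show "\<sigma> 0 = 0" by (simp add: \<sigma>' rat_linear_0[OF lin])
    show "\<sigma> 1 = 1" by (subst \<sigma>') (simp add: nz)
    show "\<sigma> (x + y) = \<sigma> x + \<sigma> y" for x y
      using lin by (simp add: \<sigma>' rat_linear_def add_divide_distrib)
    show "\<sigma> (x * y) = \<sigma> x * \<sigma> y" for x y
      by (subst (1 3) \<sigma>') (simp add: \<sigma>)
  qed
  thus ?thesis using eq by blast
qed

text \<open>Dedekind's independence of characters: the relation taken at \<open>a * x\<close>, minus
  \<open>\<tau> a\<close> times the relation at x, no longer involves \<tau> and multiplies each
  other coefficient by \<open>\<sigma> a - \<tau> a\<close>, which is nonzero for a suitable
  a.\<close>

lemma homs_independent:
  fixes F :: "('k::field_char_0 \<Rightarrow> 'b::field) set"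
  assumes "finite F" "\<And>\<sigma>. \<sigma> \<in> F \<Longrightarrow> field_hom \<sigma>" "\<And>x. (\<Sum>\<sigma>\<in>F. c \<sigma> * \<sigma> x) = 0" "\<sigma> \<in> F"
  shows "c \<sigma> = 0"
  using assms
proof (induction arbitrary: c \<sigma> rule: finite_induct)
  case empty
  thus ?case by simp
next
  case (insert \<tau> F)
  have hom: "\<sigma> (a * x) = \<sigma> a * \<sigma> x" if "\<sigma> \<in> insert \<tau> F" for \<sigma> a x
  proof -
    interpret field_hom \<sigma> using insert.prems(1)[OF that] .
    show ?thesis by (rule hom_mult)
  qed
  have z: "c \<sigma> = 0" if "\<sigma> \<in> F" for \<sigma>
  proof -
    have "\<sigma> \<noteq> \<tau>" using that insert.hyps by auto
    then obtain a where a: "\<sigma> a \<noteq> \<tau> a" by auto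
    have "(\<Sum>\<sigma>\<in>F. (c \<sigma> * (\<sigma> a - \<tau> a)) * \<sigma> x) = 0" for x
    proof -
      have "(\<Sum>\<sigma>\<in>F. (c \<sigma> * (\<sigma> a - \<tau> a)) * \<sigma> x) = (\<Sum>\<sigma>\<in>insert \<tau> F. (c \<sigma> * (\<sigma> a - \<tau> a)) * \<sigma> x)"
        using insert.hyps by simp
      also have "\<dots> = (\<Sum>\<sigma>\<in>insert \<tau> F. c \<sigma> * \<sigma> (a * x) - \<tau> a * (c \<sigma> * \<sigma> x))"
        by (intro sum.cong) (auto simp: hom algebra_simps)
      also have "\<dots> = (\<Sum>\<sigma>\<in>insert \<tau> F. c \<sigma> * \<sigma> (a * x)) - \<tau> a * (\<Sum>\<sigma>\<in>insert \<tau> F. c \<sigma> * \<sigma> x)"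
        by (simp only: sum_subtractf sum_distrib_left)
      also have "\<dots> = 0" by (simp only: insert.prems(2)) simp
      finally show ?thesis .
    qed
    hence "c \<sigma> * (\<sigma> a - \<tau> a) = 0"
      using that insert.prems(1) by (intro insert.IH[of "\<lambda>\<sigma>. c \<sigma> * (\<sigma> a - \<tau> a)" \<sigma>]) auto
    thus ?thesis using a by simp
  qed
  show ?case
  proof (cases "\<sigma> = \<tau>")
    case True
    interpret field_hom \<tau> using insert.prems(1)[of \<tau>] by simp
    have "(\<Sum>\<sigma>\<in>insert \<tau> F. c \<sigma> * \<sigma> 1) = c \<tau>"
      using insert.hyps z by simp
    thus ?thesis using insert.prems(2)[of 1] True by simp
  qed (use insert.prems z in auto)
qed

lemma field_hom_of_rat:
  assumes "field_hom (\<sigma> :: 'a::field_char_0 \<Rightarrow> 'b::field_char_0)"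
  shows "\<sigma> (of_rat q) = of_rat q"
proof -
  interpret field_hom \<sigma> by fact
  obtain a b where q: "q = Rat.Fract a b" "b > 0" by (cases q) auto
  have i: "\<sigma> (of_int n) = of_int n" for n by (rule hom_of_int)
  have "\<sigma> (of_rat q) = \<sigma> (of_int a / of_int b)" using q by (simp add: of_rat_rat)
  also have "\<dots> = of_int a / of_int b" by (simp only: hom_div i)
  finally show ?thesis using q by (simp add: of_rat_rat)
qed

lemma algebraic_over_rat:
  fixes a :: "'k::field_char_0"
  assumes "finite S" "Modules.module.span rat_scale S = (UNIV :: 'k set)"
  shows "\<exists>q. q \<noteq> 0 \<and> poly (map_poly of_rat q) a = 0"
proof -
  interpret V: Vector_Spaces.vector_space "rat_scale :: rat \<Rightarrow> 'k \<Rightarrow> 'k"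
    by (rule vector_space_rat_scale)
  interpret k: map_poly_inj_idom_hom "of_rat :: rat \<Rightarrow> 'k" ..
  define T where "T = (\<lambda>i. a ^ i) ` {..card S}"
  show ?thesis
  \<comment> \<open>If two powers coincide, the set of powers may be too small for the dimension
    count, but the coincidence is itself a polynomial equation.\<close>
  proof (cases "inj_on (\<lambda>i. a ^ i) {..card S}")
    case False
    then obtain i j where ij: "i \<noteq> j" "a ^ i = a ^ j" by (auto simp: inj_on_def)
    have "coeff (monom 1 i - monom 1 j :: rat poly) i = 1" using ij(1) by simp
    hence "monom 1 i - monom 1 j \<noteq> (0 :: rat poly)" by (metis coeff_0 zero_neq_one)
    moreover have "poly (map_poly of_rat (monom 1 i - monom 1 j)) a = 0"
      using ij(2) by (simp add: k.hom_minus poly_monom)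
    ultimately show ?thesis by blast
  next
    case True
    hence "card T = Suc (card S)" by (simp add: T_def card_image)
    hence "V.dependent T"
      using V.independent_span_bound[OF assms(1), of T] assms(2) by auto
    moreover have "finite T" by (simp add: T_def)
    ultimately obtain u v where u: "v \<in> T" "u v \<noteq> 0" "(\<Sum>v\<in>T. rat_scale (u v) v) = 0"
      using V.dependent_finite by blast
    define q where "q = (\<Sum>i\<le>card S. monom (u (a ^ i)) i)"
    have cq: "coeff q i = (if i \<le> card S then u (a ^ i) else 0)" for i
      by (simp add: q_def coeff_sum)
    from u(1) obtain i where "v = a ^ i" "i \<le> card S" by (auto simp: T_def)
    hence "coeff q i \<noteq> 0" using u(2) cq by simp
    hence "q \<noteq> 0" by auto
    moreover have "poly (map_poly of_rat q) a = (\<Sum>i\<le>card S. of_rat (u (a ^ i)) * a ^ i)"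
      by (simp add: q_def k.hom_sum poly_sum poly_monom)
    hence "poly (map_poly of_rat q) a = 0"
      using u(3) True by (simp add: T_def sum.reindex rat_scale_def)
    ultimately show ?thesis by blast
  qed
qed

section \<open>Rational bases and the matrix of embeddings\<close>

definition rat_basis :: "nat \<Rightarrow> (nat \<Rightarrow> 'k::field_char_0) \<Rightarrow> bool" where
  "rat_basis d b \<longleftrightarrow> (\<forall>x. \<exists>c. x = (\<Sum>i<d. of_rat (c i) * b i)) \<and>
     (\<forall>c. (\<Sum>i<d. of_rat (c i) * b i) = 0 \<longrightarrow> (\<forall>i<d. c i = 0))"

lemma rat_basis_unique:
  assumes "rat_basis d b" "(\<Sum>i<d. of_rat (c i) * b i) = (\<Sum>i<d. of_rat (c' i) * b i)" "i < d"
  shows "c i = c' i"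
proof -
  have "(\<Sum>i<d. of_rat (c i - c' i) * b i) = 0"
    using assms(2) by (simp add: of_rat_diff left_diff_distrib sum_subtractf)
  thus ?thesis using assms(1,3) unfolding rat_basis_def by (metis eq_iff_diff_eq_0)
qed

lemma rat_basis_exists:
  assumes "totally_real_number_field TYPE('k::field_char_0)"
  shows "\<exists>b :: nat \<Rightarrow> 'k. rat_basis (number_field_degree TYPE('k)) b"
proof -
  interpret V: Vector_Spaces.vector_space "rat_scale :: rat \<Rightarrow> 'k \<Rightarrow> 'k"
    by (rule vector_space_rat_scale)
  define d where "d = number_field_degree TYPE('k)"
  from assms obtain S :: "'k set" where S: "finite S" "V.span S = UNIV"
    unfolding totally_real_number_field_def by blast
  obtain B where B: "B \<subseteq> UNIV" "V.independent B" "UNIV \<subseteq> V.span B" "card B = V.dim UNIV"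
    using V.basis_exists[of UNIV] by blast
  have fin: "finite B"
    using V.independent_span_bound[OF S(1) B(2)] S(2) by auto
  have "card B = d" using B(4) by (simp add: d_def number_field_degree_def)
  then obtain b where b: "bij_betw b {..<d} B"
    using ex_bij_betw_nat_finite[OF fin] by (auto simp: atLeast0LessThan)
  have inj: "inj_on b {..<d}" and im: "b ` {..<d} = B" using b by (auto simp: bij_betw_def)
  have sum: "(\<Sum>i<d. of_rat (c (b i)) * b i) = (\<Sum>v\<in>B. rat_scale (c v) v)" for c
    unfolding im[symmetric] by (simp add: sum.reindex[OF inj] rat_scale_def)
  have "rat_basis d b"
    unfolding rat_basis_def
  proof (intro conjI allI impI)
    fix x :: 'k
    have "x \<in> V.span B" using B(3) by auto
    then obtain c where "x = (\<Sum>v\<in>B. rat_scale (c v) v)"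
      unfolding V.span_finite[OF fin] by auto
    thus "\<exists>c. x = (\<Sum>i<d. of_rat (c i) * b i)"
      using sum[of c] by (intro exI[of _ "\<lambda>i. c (b i)"]) simp
  next
    fix c i assume c: "(\<Sum>i<d. of_rat (c i) * b i) = 0" and i: "i < d"
    define c' where "c' = (\<lambda>v. c (the_inv_into {..<d} b v))"
    have c': "c' (b i) = c i" if "i < d" for i
      using that inj by (simp add: c'_def the_inv_into_f_f)
    have "(\<Sum>v\<in>B. rat_scale (c' v) v) = 0"
      using c by (subst sum[symmetric]) (simp add: c')
    hence "c' (b i) = 0"
      using B(2) fin i im V.independentD[of B B c' "b i"] by auto
    thus "c i = 0" using c' i by simp
  qed
  thus ?thesis by (auto simp: d_def)
qed

lemma rat_basis_span:
  fixes b :: "nat \<Rightarrow> 'k::field_char_0"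
  assumes "rat_basis d b"
  shows "Modules.module.span rat_scale (b ` {..<d}) = UNIV"
proof -
  interpret V: Vector_Spaces.vector_space "rat_scale :: rat \<Rightarrow> 'k \<Rightarrow> 'k"
    by (rule vector_space_rat_scale)
  have "x \<in> V.span (b ` {..<d})" for x
  proof -
    obtain c where "x = (\<Sum>i<d. rat_scale (c i) (b i))"
      using assms unfolding rat_basis_def rat_scale_def by blast
    moreover have "(\<Sum>i<d. rat_scale (c i) (b i)) \<in> V.span (b ` {..<d})"
      by (intro V.span_sum V.span_scale V.span_base) auto
    ultimately show ?thesis by simp
  qed
  thus ?thesis by auto
qed

text \<open>A homomorphism is determined by its values at the basis, and each value is a root of a
  rational polynomial annihilating that basis element.\<close>

lemma finite_complex_homs:
  fixes b :: "nat \<Rightarrow> 'k::field_char_0"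
  assumes "rat_basis d b"
  shows "finite {\<sigma> :: 'k \<Rightarrow> complex. field_hom \<sigma>}"
proof -
  have "\<exists>q. q \<noteq> 0 \<and> poly (map_poly of_rat q) a = 0" for a :: 'k
    using algebraic_over_rat[OF _ rat_basis_span[OF assms]] by auto
  then obtain q where q: "\<And>a :: 'k. q a \<noteq> 0" "\<And>a :: 'k. poly (map_poly of_rat (q a)) a = 0"
    by metis
  define R where "R = (\<lambda>i. {z :: complex. poly (map_poly of_rat (q (b i))) z = 0})"
  have fin: "finite (PiE {..<d} R)"
    unfolding R_def using q(1) by (intro finite_PiE poly_roots_finite) auto
  have lin: "\<sigma> (\<Sum>i<d. of_rat (c i) * b i) = (\<Sum>i<d. of_rat (c i) * \<sigma> (b i))"
    if "field_hom \<sigma>" for \<sigma> :: "'k \<Rightarrow> complex" and c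
  proof -
    interpret field_hom \<sigma> by fact
    show ?thesis by (simp add: hom_sum hom_mult field_hom_of_rat[OF that])
  qed
  show ?thesis
  proof (rule inj_on_finite[OF _ _ fin])
    show "inj_on (\<lambda>\<sigma>. restrict (\<lambda>i. \<sigma> (b i)) {..<d}) {\<sigma> :: 'k \<Rightarrow> complex. field_hom \<sigma>}"
    proof (rule inj_onI, clarsimp, rule ext)
      fix \<sigma> \<tau> :: "'k \<Rightarrow> complex" and x
      assume h: "field_hom \<sigma>" "field_hom \<tau>" and eq: "restrict (\<lambda>i. \<sigma> (b i)) {..<d} = restrict (\<lambda>i. \<tau> (b i)) {..<d}"
      have "\<sigma> (b i) = \<tau> (b i)" if "i < d" for i
        using fun_cong[OF eq, of i] that by simp
      moreover obtain c where "x = (\<Sum>i<d. of_rat (c i) * b i)"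
        using assms unfolding rat_basis_def by blast
      ultimately show "\<sigma> x = \<tau> x" by (simp add: lin h)
    qed
    show "(\<lambda>\<sigma>. restrict (\<lambda>i. \<sigma> (b i)) {..<d}) ` {\<sigma> :: 'k \<Rightarrow> complex. field_hom \<sigma>} \<subseteq> PiE {..<d} R"
    proof (clarsimp simp: R_def)
      fix \<sigma> :: "'k \<Rightarrow> complex" and i
      assume h: "field_hom \<sigma>" "i < d"
      interpret field_hom \<sigma> by fact
      have "poly (map_poly of_rat p) (\<sigma> a) = \<sigma> (poly (map_poly of_rat p) a)" for p a
        by (simp add: poly_altdef hom_sum hom_mult hom_power field_hom_of_rat[OF h(1)])
      thus "poly (map_poly of_rat (q (b i))) (\<sigma> (b i)) = 0"
        using q(2) by simp
    qed
  qed
qed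

lemma rat_linear_combination_of_homs:
  fixes \<phi> :: "'k::field_char_0 \<Rightarrow> complex" and b :: "nat \<Rightarrow> 'k"
  assumes "rat_basis d b" "rat_linear \<phi>"
  shows "\<exists>c. \<forall>x. \<phi> x = (\<Sum>\<sigma> | field_hom \<sigma>. c \<sigma> * \<sigma> x)"
proof -
  have span: "Modules.module.span rat_scale (b ` {..<d}) = UNIV" by (rule rat_basis_span[OF assms(1)])
  have fin: "finite {\<sigma> :: 'k \<Rightarrow> complex. field_hom \<sigma>}" by (rule finite_complex_homs[OF assms(1)])
  have "sum_closure (\<lambda>\<psi>. \<exists>e. eigenform (b ` {..<d}) e \<psi>) \<phi>"
    using algebraic_over_rat[OF _ span] assms(2) by (intro rat_linear_sum_of_eigenforms) auto
  thus ?thesis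
  proof induction
    case zero
    show ?case by (intro exI[of _ "\<lambda>_. 0"]) auto
  next
    case (add f g)
    then obtain c where c: "\<And>x. g x = (\<Sum>\<sigma> | field_hom \<sigma>. c \<sigma> * \<sigma> x)" by blast
    from add(1) obtain e where "eigenform (b ` {..<d}) e f" by blast
    then obtain z \<tau> where f: "f = (\<lambda>x. z * \<tau> x)" "z = 0 \<or> field_hom \<tau>"
      using eigenform_spanning_is_hom[OF span] by blast
    have "f x + g x = (\<Sum>\<sigma> | field_hom \<sigma>. (c \<sigma> + (if \<sigma> = \<tau> then z else 0)) * \<sigma> x)" for x
    proof -
      have "(\<Sum>\<sigma> | field_hom \<sigma>. (if \<sigma> = \<tau> then z else 0) * \<sigma> x) = (\<Sum>\<sigma> | field_hom \<sigma>. if \<sigma> = \<tau> then z * \<tau> x else 0)"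
        by (intro sum.cong) auto
      also have "\<dots> = f x"
        unfolding f(1) using f(2) by (subst sum.delta[OF fin]) auto
      finally show ?thesis by (simp add: distrib_right sum.distrib c)
    qed
    thus ?case by (intro exI[of _ "\<lambda>\<sigma>. c \<sigma> + (if \<sigma> = \<tau> then z else 0)"] allI)
  qed
qed

text \<open>Coordinates with respect to b are rational-linear, hence complex combinations of the
  embeddings. As all embeddings are real, the real parts of the coefficients give a real left
  inverse C of the matrix of embeddings.\<close>

lemma real_embedding_coordinates:
  fixes b :: "nat \<Rightarrow> 'k::field_char_0"
  assumes tr: "totally_real_number_field TYPE('k)" and b: "rat_basis d b"
  shows "finite (real_embeddings :: ('k \<Rightarrow> real) set)"
    and "\<exists>C. \<forall>i<d. \<forall>j<d. (\<Sum>\<nu>\<in>real_embeddings. C i \<nu> * \<nu> (b j)) = (if i = j then 1 else 0)"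
proof -
  define E where "E = {\<sigma> :: 'k \<Rightarrow> complex. field_hom \<sigma>}"
  define R where "R = (real_embeddings :: ('k \<Rightarrow> real) set)"
  define \<iota> where "\<iota> = (\<lambda>(\<nu> :: 'k \<Rightarrow> real) x. complex_of_real (\<nu> x))"
  have inj: "inj_on \<iota> R" by (auto simp: inj_on_def \<iota>_def fun_eq_iff)
  have im: "\<iota> ` R = E"
  proof safe
    fix \<nu> assume "\<nu> \<in> R"
    then interpret field_hom \<nu> by (simp add: R_def real_embeddings_def)
    have "field_hom (\<iota> \<nu>)" by unfold_locales (auto simp: \<iota>_def hom_add hom_mult)
    thus "\<iota> \<nu> \<in> E" by (simp add: E_def)
  next
    fix \<sigma> assume \<sigma>: "\<sigma> \<in> E"
    then interpret field_hom \<sigma> by (simp add: E_def)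
    have "range \<sigma> \<subseteq> \<real>" using tr \<sigma> by (auto simp: E_def totally_real_number_field_def)
    hence eq: "complex_of_real (Re (\<sigma> x)) = \<sigma> x" for x
      by (meson Reals_cases of_real_Re range_subsetD)
    have "field_hom (\<lambda>x. Re (\<sigma> x))"
    proof unfold_locales
      fix x y
      have "complex_of_real (Re (\<sigma> (x * y))) = complex_of_real (Re (\<sigma> x) * Re (\<sigma> y))"
        unfolding of_real_mult eq by (rule hom_mult)
      thus "Re (\<sigma> (x * y)) = Re (\<sigma> x) * Re (\<sigma> y)" by (simp only: of_real_eq_iff)
    qed (auto simp: hom_add)
    moreover have "\<iota> (\<lambda>x. Re (\<sigma> x)) = \<sigma>" by (auto simp: \<iota>_def eq)
    ultimately show "\<sigma> \<in> \<iota> ` R" unfolding R_def real_embeddings_def by (metis image_eqI mem_Collect_eq)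
  qed
  have finE: "finite E" unfolding E_def by (rule finite_complex_homs[OF b])
  thus "finite (real_embeddings :: ('k \<Rightarrow> real) set)"
    using im inj by (metis R_def finite_image_iff)
  have "\<exists>c. \<forall>j<d. (\<Sum>\<nu>\<in>R. c \<nu> * \<nu> (b j)) = (if i = j then 1 else 0)" if i: "i < d" for i
  proof -
    obtain co where co: "\<And>x. x = (\<Sum>i<d. of_rat (co x i) * b i)"
      using b unfolding rat_basis_def by metis
    have co': "co x i = c i" if "x = (\<Sum>i<d. of_rat (c i) * b i)" for x c
      by (rule rat_basis_unique[OF b _ i]) (use co[of x] that in metis)
    have "rat_linear (\<lambda>x. of_rat (co x i))"
      unfolding rat_linear_def
    proof safe
      fix x y :: 'k
      have "x + y = (\<Sum>i<d. of_rat (co x i + co y i) * b i)"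
        unfolding of_rat_add distrib_right sum.distrib by (rule arg_cong2[OF co co])
      from co'[OF this] show "complex_of_rat (co (x + y) i) = of_rat (co x i) + of_rat (co y i)"
        by (simp add: of_rat_add)
    next
      fix q and x :: 'k
      have "of_rat q * x = (\<Sum>i<d. of_rat (q * co x i) * b i)"
        by (subst co[of x]) (simp add: of_rat_mult sum_distrib_left mult.assoc)
      from co'[OF this] show "complex_of_rat (co (of_rat q * x) i) = of_rat q * of_rat (co x i)"
        by (simp add: of_rat_mult)
    qed
    from rat_linear_combination_of_homs[OF b this]
    obtain c where c: "\<And>x. of_rat (co x i) = (\<Sum>\<sigma>\<in>E. c \<sigma> * \<sigma> x)"
      unfolding E_def by blast
    have "(\<Sum>\<nu>\<in>R. Re (c (\<iota> \<nu>)) * \<nu> (b j)) = (if i = j then 1 else 0)" if "j < d" for j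
    proof -
      have "b j = (\<Sum>i<d. of_rat (if i = j then 1 else 0) * b i)"
        using that by (subst sum.cong[OF refl, of _ _ "\<lambda>i. if i = j then b i else 0"]) auto
      from co'[OF this] have "of_rat (co (b j) i) = (if i = j then 1 else 0 :: complex)" by simp
      also have "of_rat (co (b j) i) = (\<Sum>\<nu>\<in>R. c (\<iota> \<nu>) * of_real (\<nu> (b j)))"
        unfolding c im[symmetric] sum.reindex[OF inj] by (simp add: \<iota>_def)
      finally have "Re (\<Sum>\<nu>\<in>R. c (\<iota> \<nu>) * of_real (\<nu> (b j))) = (if i = j then 1 else 0)" by simp
      thus ?thesis by simp
    qed
    thus ?thesis by (intro exI[of _ "\<lambda>\<nu>. Re (c (\<iota> \<nu>))"] allI impI)
  qed
  thus "\<exists>C. \<forall>i<d. \<forall>j<d. (\<Sum>\<nu>\<in>real_embeddings. C i \<nu> * \<nu> (b j)) = (if i = j then 1 else 0)"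
    unfolding R_def by (intro choice_iff'[THEN iffD1]) blast
qed

lemma field_hom_rat_combination:
  assumes "field_hom (\<sigma> :: 'a::field_char_0 \<Rightarrow> 'b::field_char_0)"
  shows "\<sigma> (\<Sum>i\<in>I. of_rat (c i) * b i) = (\<Sum>i\<in>I. of_rat (c i) * \<sigma> (b i))"
proof -
  interpret field_hom \<sigma> by fact
  show ?thesis by (simp add: hom_sum hom_mult field_hom_of_rat[OF assms])
qed

text \<open>The matrix is not yet known to be square, so the second identity requires its own
  argument. For fixed \<nu>, the defect of that identity gives the coefficients of a linear relation
  between the embeddings; the relation holds on the basis, hence everywhere, and independence of
  homomorphisms makes the coefficients vanish.\<close>

lemma embedding_matrix_inverse:
  fixes b :: "nat \<Rightarrow> 'k::field_char_0"
  assumes tr: "totally_real_number_field TYPE('k)" and b: "rat_basis d b"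
  shows "\<exists>C. (\<forall>i<d. \<forall>j<d. (\<Sum>\<nu>\<in>real_embeddings. C i \<nu> * \<nu> (b j)) = (if i = j then 1 else 0)) \<and>
    (\<forall>\<nu>\<in>real_embeddings. \<forall>\<mu>\<in>real_embeddings. (\<Sum>i<d. \<nu> (b i) * C i \<mu>) = (if \<mu> = \<nu> then 1 else 0))"
proof -
  define R where "R = (real_embeddings :: ('k \<Rightarrow> real) set)"
  have fin: "finite R" unfolding R_def by (rule real_embedding_coordinates[OF assms])
  obtain C where C: "\<And>i j. i < d \<Longrightarrow> j < d \<Longrightarrow> (\<Sum>\<nu>\<in>R. C i \<nu> * \<nu> (b j)) = (if i = j then 1 else 0)"
    using real_embedding_coordinates(2)[OF assms] unfolding R_def by blast
  have D: "(\<Sum>i<d. \<nu> (b i) * C i \<mu>) = (if \<mu> = \<nu> then 1 else 0)" if \<nu>: "\<nu> \<in> R" and \<mu>: "\<mu> \<in> R" for \<nu> \<mu>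
  proof -
    define e where "e = (\<lambda>\<mu>. (\<Sum>i<d. \<nu> (b i) * C i \<mu>) - (if \<mu> = \<nu> then 1 else 0))"
    have z: "(\<Sum>\<mu>\<in>R. e \<mu> * \<mu> (b j)) = 0" if "j < d" for j
    proof -
      have "(\<Sum>\<mu>\<in>R. (\<Sum>i<d. \<nu> (b i) * C i \<mu>) * \<mu> (b j)) = (\<Sum>i<d. \<nu> (b i) * (\<Sum>\<mu>\<in>R. C i \<mu> * \<mu> (b j)))"
        unfolding sum_distrib_right sum_distrib_left by (subst sum.swap) (simp add: mult_ac)
      also have "\<dots> = (\<Sum>i<d. if i = j then \<nu> (b i) else 0)"
        using that by (intro sum.cong) (auto simp: C)
      also have "\<dots> = \<nu> (b j)" using that by simp
      finally have 1: "(\<Sum>\<mu>\<in>R. (\<Sum>i<d. \<nu> (b i) * C i \<mu>) * \<mu> (b j)) = \<nu> (b j)" .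
      have "(\<Sum>\<mu>\<in>R. (if \<mu> = \<nu> then 1 else 0) * \<mu> (b j)) = (\<Sum>\<mu>\<in>R. if \<mu> = \<nu> then \<mu> (b j) else 0)"
        by (intro sum.cong) auto
      also have "\<dots> = \<nu> (b j)" using fin \<nu> by simp
      finally show ?thesis using 1 by (simp add: e_def left_diff_distrib sum_subtractf)
    qed
    have e0: "(\<Sum>\<mu>\<in>R. e \<mu> * \<mu> x) = 0" for x
    proof -
      obtain c where x: "x = (\<Sum>i<d. of_rat (c i) * b i)"
        using b unfolding rat_basis_def by blast
      have "(\<Sum>\<mu>\<in>R. e \<mu> * \<mu> x) = (\<Sum>\<mu>\<in>R. \<Sum>i<d. of_rat (c i) * (e \<mu> * \<mu> (b i)))"
      proof (rule sum.cong[OF refl])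
        fix \<mu> assume "\<mu> \<in> R"
        hence "field_hom \<mu>" by (simp add: R_def real_embeddings_def)
        hence "\<mu> x = (\<Sum>i<d. of_rat (c i) * \<mu> (b i))"
          unfolding x by (rule field_hom_rat_combination)
        thus "e \<mu> * \<mu> x = (\<Sum>i<d. of_rat (c i) * (e \<mu> * \<mu> (b i)))"
          by (simp add: sum_distrib_left mult_ac)
      qed
      also have "\<dots> = (\<Sum>i<d. of_rat (c i) * (\<Sum>\<mu>\<in>R. e \<mu> * \<mu> (b i)))"
        unfolding sum_distrib_left by (rule sum.swap)
      also have "\<dots> = 0" by (simp add: z)
      finally show ?thesis .
    qed
    have hom: "field_hom \<mu>" if "\<mu> \<in> R" for \<mu>
      using that by (simp add: R_def real_embeddings_def)
    have "e \<mu> = 0"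
      by (rule homs_independent[OF fin hom e0 \<mu>])
    thus ?thesis by (simp add: e_def)
  qed
  show ?thesis using C D unfolding R_def by (intro exI[of _ C]) simp
qed

text \<open>The two products of mutually inverse matrices have the same trace; one trace counts
  embeddings, the other basis elements.\<close>

lemma card_real_embeddings:
  fixes b :: "nat \<Rightarrow> 'k::field_char_0"
  assumes tr: "totally_real_number_field TYPE('k)" and b: "rat_basis d b"
  shows "card (real_embeddings :: ('k \<Rightarrow> real) set) = d"
proof -
  let ?R = "real_embeddings :: ('k \<Rightarrow> real) set"
  obtain C where C: "\<And>i j. i < d \<Longrightarrow> j < d \<Longrightarrow> (\<Sum>\<nu>\<in>?R. C i \<nu> * \<nu> (b j)) = (if i = j then 1 else 0)"
    and D: "\<And>\<nu> \<mu>. \<nu> \<in> ?R \<Longrightarrow> \<mu> \<in> ?R \<Longrightarrow> (\<Sum>i<d. \<nu> (b i) * C i \<mu>) = (if \<mu> = \<nu> then 1 else 0)"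
    using embedding_matrix_inverse[OF assms] by blast
  have "real (card ?R) = (\<Sum>\<nu>\<in>?R. \<Sum>i<d. \<nu> (b i) * C i \<nu>)" by (simp add: D)
  also have "\<dots> = (\<Sum>i<d. \<Sum>\<nu>\<in>?R. \<nu> (b i) * C i \<nu>)" by (rule sum.swap)
  also have "\<dots> = (\<Sum>i<d. \<Sum>\<nu>\<in>?R. C i \<nu> * \<nu> (b i))" by (simp add: mult.commute)
  also have "\<dots> = real d" by (simp add: C)
  finally show ?thesis by simp
qed


lemma det_embedding_matrix_nonzero:
  fixes b :: "nat \<Rightarrow> 'k::field_char_0" and \<nu> :: "nat \<Rightarrow> 'k \<Rightarrow> real"
  assumes tr: "totally_real_number_field TYPE('k)" and b: "rat_basis d b"
    and \<nu>: "bij_betw \<nu> {..<d} real_embeddings"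
  shows "Determinant.det (mat d d (\<lambda>(i, j). \<nu> i (b j))) \<noteq> 0"
proof -
  obtain C where C: "\<And>i j. i < d \<Longrightarrow> j < d \<Longrightarrow>
      (\<Sum>\<nu>\<in>real_embeddings. C i \<nu> * \<nu> (b j)) = (if i = j then 1 else 0)"
    using real_embedding_coordinates(2)[OF tr b] by blast
  define W where "W = mat d d (\<lambda>(i, j). \<nu> i (b j))"
  define M where "M = mat d d (\<lambda>(i, j). C i (\<nu> j))"
  have "M * W = 1\<^sub>m d"
  proof (rule eq_matI)
    fix i j assume ij: "i < dim_row (1\<^sub>m d :: real mat)" "j < dim_col (1\<^sub>m d :: real mat)"
    hence "(M * W) $$ (i, j) = (\<Sum>k<d. C i (\<nu> k) * \<nu> k (b j))"
      by (simp add: M_def W_def scalar_prod_def atLeast0LessThan)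
    also have "\<dots> = (\<Sum>\<nu>\<in>real_embeddings. C i \<nu> * \<nu> (b j))"
      using sum.reindex_bij_betw[OF \<nu>, of "\<lambda>\<nu>. C i \<nu> * \<nu> (b j)"] by simp
    also have "\<dots> = 1\<^sub>m d $$ (i, j)" using ij by (simp add: C)
    finally show "(M * W) $$ (i, j) = 1\<^sub>m d $$ (i, j)" .
  qed (auto simp: M_def W_def)
  moreover have "Determinant.det (M * W) = Determinant.det M * Determinant.det W"
    by (rule det_mult[of _ d]) (simp_all add: M_def W_def)
  ultimately have "Determinant.det M * Determinant.det W = 1" by simp
  thus ?thesis unfolding W_def[symmetric] by auto
qed

section \<open>Algebraic integers and integral bases\<close>

abbreviation int_span :: "'k::field_char_0 set \<Rightarrow> 'k set" where
  "int_span \<equiv> Modules.module.span (\<lambda>n x. of_int n * x)"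

lemma module_int_mult: "Modules.module (\<lambda>n x. of_int n * x :: 'k::field_char_0)"
  by unfold_locales (auto simp: algebra_simps)

text \<open>The vector listing S is an eigenvector, with eigenvalue a, of an integer matrix
  describing multiplication by a on the generators; it is nonzero because of \<open>s0\<close>. The
  characteristic polynomial of that matrix is monic with integer coefficients.\<close>

lemma algebraic_int_finite_module:
  fixes a :: "'k::field_char_0"
  assumes fin: "finite S" and s0: "s0 \<in> S" "s0 \<noteq> 0" and st: "\<And>s. s \<in> S \<Longrightarrow> a * s \<in> int_span S"
  shows "algebraic_int a"
proof -
  interpret Z: Modules.module "\<lambda>n x. of_int n * x :: 'k" by (rule module_int_mult)
  define n where "n = card S"
  obtain v where v: "bij_betw v {0..<n} S"
    using ex_bij_betw_nat_finite[OF fin] by (auto simp: n_def)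
  have vim: "v i \<in> S" if "i < n" for i using v that by (auto simp: bij_betw_def)
  have "\<forall>s\<in>S. \<exists>c. a * s = (\<Sum>t\<in>S. of_int (c t) * t)"
    using st unfolding Z.span_finite[OF fin] by blast
  then obtain c where c: "\<And>s. s \<in> S \<Longrightarrow> a * s = (\<Sum>t\<in>S. of_int (c s t) * t)"
    unfolding bchoice_iff by blast
  define A where "A = mat n n (\<lambda>(i, j). c (v i) (v j))"
  define B where "B = (map_mat of_int A :: 'k mat)"
  have A: "A \<in> carrier_mat n n" and B: "B \<in> carrier_mat n n" by (auto simp: A_def B_def)
  have "B *\<^sub>v vec n v = a \<cdot>\<^sub>v vec n v"
  proof (rule eq_vecI)
    fix i assume "i < dim_vec (a \<cdot>\<^sub>v vec n v)"
    hence i: "i < n" by simp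
    have "(B *\<^sub>v vec n v) $ i = (\<Sum>j=0..<n. of_int (c (v i) (v j)) * v j)"
      using i by (simp add: B_def A_def scalar_prod_def)
    also have "\<dots> = (\<Sum>t\<in>S. of_int (c (v i) t) * t)"
      using sum.reindex_bij_betw[OF v, of "\<lambda>t. of_int (c (v i) t) * t"] .
    also have "\<dots> = a * v i" using c[OF vim[OF i]] by simp
    finally show "(B *\<^sub>v vec n v) $ i = (a \<cdot>\<^sub>v vec n v) $ i" using i by simp
  qed (auto simp: B_def A_def)
  moreover have "vec n v \<noteq> 0\<^sub>v n"
  proof
    assume *: "vec n v = 0\<^sub>v n"
    obtain i where i: "i < n" "v i = s0" using s0(1) v by (auto simp: bij_betw_def)
    have "vec n v $ i = 0\<^sub>v n $ i" by (simp only: *)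
    thus False using i s0(2) by simp
  qed
  ultimately have "eigenvalue B a"
    unfolding eigenvalue_def eigenvector_def using B by (intro exI[of _ "vec n v"]) auto
  hence "poly (char_poly B) a = 0" using eigenvalue_root_char_poly[OF B] by simp
  moreover have "char_poly B = map_poly of_int (char_poly A)"
    unfolding B_def by (rule of_int_hom.char_poly_hom[OF A])
  moreover have "lead_coeff (char_poly A) = 1"
    using degree_monic_char_poly[OF A] by simp
  ultimately show ?thesis
    unfolding algebraic_int_altdef_ipoly by auto
qed

lemma monic_power_reduce:
  fixes a :: "'k::field_char_0"
  assumes "poly (map_poly of_int p) a = 0" "lead_coeff p = 1"
  shows "a ^ degree p = - (\<Sum>i<degree p. of_int (coeff p i) * a ^ i)"
proof -
  have "0 = (\<Sum>i\<le>degree p. of_int (coeff p i) * a ^ i)"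
    using assms(1) by (simp add: poly_altdef degree_map_poly coeff_map_poly)
  also have "{..degree p} = insert (degree p) {..<degree p}" by auto
  finally have "a ^ degree p + (\<Sum>i<degree p. of_int (coeff p i) * a ^ i) = 0"
    using assms(2) by simp
  thus ?thesis by (simp add: eq_neg_iff_add_eq_0)
qed

text \<open>The monomials in a and b with exponents below the degrees of their monic equations span
  a module stable under multiplication by a and by b, hence by the sum and the product.\<close>

lemma
  fixes a b :: "'k::field_char_0"
  assumes "algebraic_int a" "algebraic_int b"
  shows algebraic_int_plus: "algebraic_int (a + b)"
    and algebraic_int_times: "algebraic_int (a * b)"
proof -
  interpret Z: Modules.module "\<lambda>n x. of_int n * x :: 'k" by (rule module_int_mult)
  obtain p where p: "poly (map_poly of_int p) a = 0" "lead_coeff p = 1"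
    using assms(1) unfolding algebraic_int_altdef_ipoly by auto
  obtain q where q: "poly (map_poly of_int q) b = 0" "lead_coeff q = 1"
    using assms(2) unfolding algebraic_int_altdef_ipoly by auto
  define m where "m = degree p" define n where "n = degree q"
  have m0: "0 < m"
  proof (rule ccontr)
    assume "\<not> 0 < m"
    then obtain c where "p = [:c:]" unfolding m_def using degree_eq_zeroE by blast
    thus False using p by (simp add: map_poly_pCons)
  qed
  have n0: "0 < n"
  proof (rule ccontr)
    assume "\<not> 0 < n"
    then obtain c where "q = [:c:]" unfolding n_def using degree_eq_zeroE by blast
    thus False using q by (simp add: map_poly_pCons)
  qed
  define S where "S = (\<lambda>(i, j). a ^ i * b ^ j) ` ({..<m} \<times> {..<n})"
  have fin: "finite S" by (simp add: S_def)
  have mem: "a ^ i * b ^ j \<in> S" if "i < m" "j < n" for i j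
    using that by (auto simp: S_def)
  have 1: "1 \<in> S" using mem[OF m0 n0] by simp
  have sa: "a * s \<in> int_span S" if s: "s \<in> S" for s
  proof -
    obtain i j where ij: "s = a ^ i * b ^ j" "i < m" "j < n" using s by (auto simp: S_def)
    show ?thesis
    proof (cases "Suc i < m")
      case True
      thus ?thesis using Z.span_base[OF mem[OF True ij(3)]] ij by (simp add: mult.assoc)
    next
      case False
      hence "Suc i = m" using ij by simp
      hence "a * s = a ^ m * b ^ j" unfolding ij by (simp add: mult.assoc[symmetric] flip: power_Suc)
      also have "\<dots> = - (\<Sum>i<m. of_int (coeff p i) * (a ^ i * b ^ j))"
        unfolding m_def monic_power_reduce[OF p] by (simp add: sum_distrib_right mult.assoc)
      also have "\<dots> \<in> int_span S"
        using mem ij by (intro Z.span_neg Z.span_sum Z.span_scale Z.span_base) auto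
      finally show ?thesis .
    qed
  qed
  have sb: "b * s \<in> int_span S" if s: "s \<in> S" for s
  proof -
    obtain i j where ij: "s = a ^ i * b ^ j" "i < m" "j < n" using s by (auto simp: S_def)
    show ?thesis
    proof (cases "Suc j < n")
      case True
      thus ?thesis using Z.span_base[OF mem[OF ij(2) True]] ij by (simp add: mult_ac)
    next
      case False
      hence "Suc j = n" using ij by simp
      hence "b * s = a ^ i * b ^ n" unfolding ij by (metis mult.left_commute power_Suc)
      also have "\<dots> = - (\<Sum>j<n. of_int (coeff q j) * (a ^ i * b ^ j))"
        unfolding n_def monic_power_reduce[OF q] by (simp add: sum_distrib_left mult_ac)
      also have "\<dots> \<in> int_span S"
        using mem ij by (intro Z.span_neg Z.span_sum Z.span_scale Z.span_base) auto
      finally show ?thesis .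
    qed
  qed
  have sa': "a * x \<in> int_span S" if "x \<in> int_span S" for x
    using that
  proof (induction rule: Z.span_induct_alt)
    case (step c x y)
    have "a * (of_int c * x + y) = of_int c * (a * x) + a * y" by (simp add: algebra_simps)
    thus ?case using step sa by (simp only:) (intro Z.span_add Z.span_scale)
  qed (simp add: Z.span_zero)
  show "algebraic_int (a + b)"
  proof (rule algebraic_int_finite_module[OF fin 1])
    fix s assume "s \<in> S"
    thus "(a + b) * s \<in> int_span S" unfolding distrib_right by (intro Z.span_add sa sb)
  qed simp
  show "algebraic_int (a * b)"
  proof (rule algebraic_int_finite_module[OF fin 1])
    fix s assume "s \<in> S"
    thus "(a * b) * s \<in> int_span S" unfolding mult.assoc by (intro sa' sb)
  qed simp
qed

section \<open>The ring of integers\<close>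

lemma integers_iff: "a \<in> \<O> \<longleftrightarrow> algebraic_int a"
  by (simp add: integer_ring_def)

lemma integers_add: "a \<in> \<O> \<Longrightarrow> b \<in> \<O> \<Longrightarrow> a + b \<in> (\<O> :: 'k::field_char_0 set)"
  by (simp add: integers_iff algebraic_int_plus)

lemma integers_mult: "a \<in> \<O> \<Longrightarrow> b \<in> \<O> \<Longrightarrow> a * b \<in> (\<O> :: 'k::field_char_0 set)"
  by (simp add: integers_iff algebraic_int_times)

lemma integers_minus: "a \<in> \<O> \<Longrightarrow> - a \<in> (\<O> :: 'k::field_char_0 set)"
  by (simp add: integers_iff)

lemma integers_diff: "a \<in> \<O> \<Longrightarrow> b \<in> \<O> \<Longrightarrow> a - b \<in> (\<O> :: 'k::field_char_0 set)"
  using integers_add[of a "- b"] integers_minus[of b] by simp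

lemma integers_of_int: "of_int n \<in> (\<O> :: 'k::field_char_0 set)"
  by (simp add: integers_iff int_imp_algebraic_int)

lemma integers_0: "0 \<in> (\<O> :: 'k::field_char_0 set)" and integers_1: "1 \<in> (\<O> :: 'k::field_char_0 set)"
  using integers_of_int[of 0] integers_of_int[of 1] by simp_all

lemma integers_sum: "(\<And>i. i \<in> I \<Longrightarrow> f i \<in> \<O>) \<Longrightarrow> sum f I \<in> (\<O> :: 'k::field_char_0 set)"
  by (induction I rule: infinite_finite_induct) (auto simp: integers_0 integers_add)

lemma integers_prod: "(\<And>i. i \<in> I \<Longrightarrow> f i \<in> \<O>) \<Longrightarrow> prod f I \<in> (\<O> :: 'k::field_char_0 set)"
  by (induction I rule: infinite_finite_induct) (auto simp: integers_1 integers_mult)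

lemma field_hom_algebraic_int:
  assumes "field_hom (\<sigma> :: 'a::field_char_0 \<Rightarrow> 'b::field_char_0)" "algebraic_int a"
  shows "algebraic_int (\<sigma> a)"
proof -
  interpret field_hom \<sigma> by fact
  obtain p where p: "poly (map_poly of_int p) a = 0" "lead_coeff p = 1"
    using assms(2) unfolding algebraic_int_altdef_ipoly by auto
  have i: "\<sigma> (of_int n) = of_int n" for n by (rule hom_of_int)
  have "poly (map_poly of_int p) (\<sigma> a) = \<sigma> (poly (map_poly of_int p) a)"
    by (simp add: poly_altdef degree_map_poly coeff_map_poly hom_sum hom_mult hom_power i)
  thus ?thesis using p unfolding algebraic_int_altdef_ipoly by auto
qed

lemma common_denominator:
  fixes q :: "'i \<Rightarrow> rat"
  assumes "finite I"
  shows "\<exists>D::int. 0 < D \<and> (\<forall>i\<in>I. of_int D * q i \<in> \<int>)"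
  using assms
proof induction
  case empty
  show ?case by (intro exI[of _ 1]) auto
next
  case (insert i I)
  then obtain D :: int where D: "0 < D" "\<And>i. i \<in> I \<Longrightarrow> of_int D * q i \<in> \<int>" by blast
  obtain a b where ab: "q i = of_int a / of_int b" "b > 0"
    by (metis Rat.of_int_def quotient_of_denom_pos quotient_of_div surj_pair)
  have "of_int (D * b) * q j \<in> \<int>" if "j \<in> insert i I" for j
  proof (cases "j = i")
    case True
    thus ?thesis using ab by simp
  next
    case False
    have "of_int (D * b) * q j = of_int b * (of_int D * q j)" by simp
    also have "\<dots> \<in> \<int>"
      by (rule Ints_mult[OF Ints_of_int D(2)]) (use False that in simp)
    finally show ?thesis .
  qed
  thus ?case using D(1) ab(2) by (intro exI[of _ "D * b"]) auto
qed

text \<open>Let D be a common denominator of the monic equation of a. Then y = D a satisfies an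
  equation in which y^i has the coefficient D^(n-i) r_i, an integer since n - i is at least 1. The
  powers of y below n therefore span a module that y preserves.\<close>

lemma ex_integral_multiple:
  fixes a :: "'k::field_char_0"
  assumes "q \<noteq> 0" "poly (map_poly of_rat q) a = 0"
  shows "\<exists>D::int. 0 < D \<and> of_int D * a \<in> \<O>"
proof -
  interpret Z: Modules.module "\<lambda>n x. of_int n * x :: 'k" by (rule module_int_mult)
  define n where "n = degree q"
  define r where "r = (\<lambda>i. coeff q i / lead_coeff q)"
  have "(\<Sum>i\<le>n. of_rat (coeff q i) * a ^ i) = 0"
    using assms(2) by (simp add: poly_altdef n_def)
  moreover have "{..n} = insert n {..<n}" by auto
  ultimately have "of_rat (lead_coeff q) * a ^ n + (\<Sum>i<n. of_rat (coeff q i) * a ^ i) = 0"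
    by (simp add: n_def)
  hence "of_rat (inverse (lead_coeff q)) * (of_rat (lead_coeff q) * a ^ n + (\<Sum>i<n. of_rat (coeff q i) * a ^ i)) = 0"
    by simp
  hence "a ^ n + (\<Sum>i<n. of_rat (r i) * a ^ i) = 0"
    using assms(1) by (simp add: distrib_left sum_distrib_left mult.assoc[symmetric] r_def divide_inverse
       flip: of_rat_mult) (simp add: mult_ac)
  hence an: "a ^ n = - (\<Sum>i<n. of_rat (r i) * a ^ i)" by (simp add: eq_neg_iff_add_eq_0)
  obtain D :: int where D: "0 < D" "\<And>i. i < n \<Longrightarrow> of_int D * r i \<in> \<int>"
    using common_denominator[of "{..<n}" r] by auto
  define y where "y = of_int D * a"
  have n0: "0 < n"
  proof (rule ccontr)
    assume "\<not> 0 < n"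
    then obtain c where "q = [:c:]" unfolding n_def using degree_eq_zeroE by blast
    thus False using assms by (simp add: map_poly_pCons)
  qed
  define S where "S = (\<lambda>i. y ^ i) ` {..<n}"
  have "algebraic_int y"
  proof (rule algebraic_int_finite_module)
    show "finite S" by (simp add: S_def)
    show "1 \<in> S" unfolding S_def using n0 by (intro image_eqI[of _ _ 0]) auto
    fix s assume "s \<in> S"
    then obtain i where i: "s = y ^ i" "i < n" by (auto simp: S_def)
    show "y * s \<in> int_span S"
    proof (cases "Suc i < n")
      case True
      have "y ^ Suc i \<in> S" unfolding S_def using True by blast
      thus ?thesis using i by (auto intro: Z.span_base)
    next
      case False
      hence "Suc i = n" using i by simp
      hence "y * s = y ^ n" unfolding i by auto
      also have "\<dots> = - (\<Sum>i<n. of_int (D ^ n) * (of_rat (r i) * a ^ i))"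
        unfolding y_def power_mult_distrib an by (simp add: sum_distrib_left)
      also have "\<dots> = - (\<Sum>i<n. of_int (floor (of_int (D ^ (n - i)) * r i)) * y ^ i)"
      proof (intro arg_cong[of _ _ uminus] sum.cong refl)
        fix i assume "i \<in> {..<n}"
        hence i: "i < n" by simp
        have "of_int (D ^ (n - i)) * r i = of_int (D ^ (n - i - 1)) * (of_int D * r i)"
          using i by (metis (no_types, lifting) Suc_diff_1 mult.assoc mult.commute of_int_mult power_Suc zero_less_diff)
        also have "\<dots> \<in> \<int>" by (rule Ints_mult[OF Ints_of_int D(2)[OF i]])
        finally have "rat_of_int (floor (of_int (D ^ (n - i)) * r i)) = of_int (D ^ (n - i)) * r i"
          by (simp add: of_int_floor)
        hence "(of_rat (rat_of_int (floor (of_int (D ^ (n - i)) * r i))) :: 'k) = of_rat (of_int (D ^ (n - i)) * r i)"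
          by (simp only:)
        hence "(of_int (floor (of_int (D ^ (n - i)) * r i)) :: 'k) = of_int (D ^ (n - i)) * of_rat (r i)"
          by (simp only: of_rat_mult of_rat_of_int_eq)
        moreover have "(of_int (D ^ n) :: 'k) = of_int (D ^ (n - i)) * of_int (D ^ i)"
          using i by (simp flip: power_add)
        ultimately show "of_int (D ^ n) * (of_rat (r i) * a ^ i) =
            of_int (floor (of_int (D ^ (n - i)) * r i)) * y ^ i"
          by (simp only: y_def power_mult_distrib) (simp add: mult_ac)
      qed
      also have "\<dots> \<in> int_span S"
        by (intro Z.span_neg Z.span_sum Z.span_scale Z.span_base) (auto simp: S_def)
      finally show ?thesis .
    qed
  qed simp
  thus ?thesis using D(1) by (auto simp: y_def integers_iff)
qed

section \<open>Rationality and integrality of trace and norm\<close>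

lemma rat_basis_multiplication_matrix:
  assumes "rat_basis d b"
  shows "\<exists>M. \<forall>j. a * b j = (\<Sum>i<d. of_rat (M i j) * b i)"
proof -
  have "\<forall>j. \<exists>c. a * b j = (\<Sum>i<d. of_rat (c i) * b i)"
    using assms unfolding rat_basis_def by blast
  then obtain M where M: "\<And>j. a * b j = (\<Sum>i<d. of_rat (M j i) * b i)"
    unfolding choice_iff by blast
  show ?thesis by (intro exI[of _ "\<lambda>i j. M j i"] allI) (rule M)
qed

lemma rat_basis_independent:
  "rat_basis d b \<Longrightarrow> (\<Sum>i<d. of_rat (c i) * b i) = 0 \<Longrightarrow> i < d \<Longrightarrow> c i = 0"
  unfolding rat_basis_def by (elim conjE) (drule spec[of _ c], simp)

text \<open>The embedding matrix conjugates the rational matrix of multiplication by a into the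
  diagonal matrix of the conjugates of a, and traces are invariant under conjugation.\<close>

lemma field_trace_rational:
  fixes b :: "nat \<Rightarrow> 'k::field_char_0"
  assumes tr: "totally_real_number_field TYPE('k)" and b: "rat_basis d b"
  shows "field_trace (a :: 'k) \<in> \<rat>"
proof -
  let ?R = "real_embeddings :: ('k \<Rightarrow> real) set"
  obtain C where C: "\<And>i j. i < d \<Longrightarrow> j < d \<Longrightarrow> (\<Sum>\<nu>\<in>?R. C i \<nu> * \<nu> (b j)) = (if i = j then 1 else 0)"
    and D: "\<And>\<nu> \<mu>. \<nu> \<in> ?R \<Longrightarrow> \<mu> \<in> ?R \<Longrightarrow> (\<Sum>i<d. \<nu> (b i) * C i \<mu>) = (if \<mu> = \<nu> then 1 else 0)"
    using embedding_matrix_inverse[OF assms] by blast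
  obtain M where M: "\<And>j. a * b j = (\<Sum>i<d. of_rat (M i j) * b i)"
    using rat_basis_multiplication_matrix[OF b, of a] by blast
  have \<nu>M: "\<nu> a * \<nu> (b j) = (\<Sum>i<d. of_rat (M i j) * \<nu> (b i))" if "\<nu> \<in> ?R" for \<nu> j
  proof -
    have h: "field_hom \<nu>" using that by (simp add: real_embeddings_def)
    interpret field_hom \<nu> by (rule h)
    have "\<nu> (a * b j) = (\<Sum>i<d. of_rat (M i j) * \<nu> (b i))"
      unfolding M by (rule field_hom_rat_combination[OF h])
    thus ?thesis by (simp only: hom_mult)
  qed
  \<comment> \<open>The factor inserted here is a diagonal entry, equal to 1, of the product of the
    embedding matrix with its inverse.\<close>
  have "field_trace a = (\<Sum>\<nu>\<in>?R. \<nu> a * (\<Sum>j<d. \<nu> (b j) * C j \<nu>))"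
    unfolding field_trace_def by (intro sum.cong refl) (simp add: D)
  also have "\<dots> = (\<Sum>\<nu>\<in>?R. \<Sum>j<d. \<Sum>i<d. of_rat (M i j) * (C j \<nu> * \<nu> (b i)))"
  proof (intro sum.cong refl)
    fix \<nu> assume \<nu>: "\<nu> \<in> ?R"
    have "\<nu> a * (\<Sum>j<d. \<nu> (b j) * C j \<nu>) = (\<Sum>j<d. (\<nu> a * \<nu> (b j)) * C j \<nu>)"
      by (simp add: sum_distrib_left mult.assoc)
    also have "\<dots> = (\<Sum>j<d. \<Sum>i<d. of_rat (M i j) * (C j \<nu> * \<nu> (b i)))"
      unfolding \<nu>M[OF \<nu>] sum_distrib_right by (simp add: mult_ac)
    finally show "\<nu> a * (\<Sum>j<d. \<nu> (b j) * C j \<nu>) = (\<Sum>j<d. \<Sum>i<d. of_rat (M i j) * (C j \<nu> * \<nu> (b i)))" .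
  qed
  also have "\<dots> = (\<Sum>j<d. \<Sum>i<d. \<Sum>\<nu>\<in>?R. of_rat (M i j) * (C j \<nu> * \<nu> (b i)))"
    by (subst sum.swap, rule sum.cong[OF refl], rule sum.swap)
  also have "\<dots> = (\<Sum>j<d. \<Sum>i<d. if i = j then of_rat (M i j) else 0)"
    unfolding sum_distrib_left[symmetric] by (intro sum.cong refl) (auto simp: C)
  also have "\<dots> = (\<Sum>j<d. of_rat (M j j))" by simp
  also have "\<dots> \<in> \<rat>" by (rule Rats_sum) auto
  finally show ?thesis .
qed

lemma
  fixes f :: "'i \<Rightarrow> real"
  assumes "\<And>i. i \<in> I \<Longrightarrow> algebraic_int (f i)"
  shows algebraic_int_sum: "algebraic_int (sum f I)" and algebraic_int_prod: "algebraic_int (prod f I)"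
  using assms integers_sum[of I f] integers_prod[of I f] unfolding integers_iff by blast+

lemma field_trace_integer:
  fixes b :: "nat \<Rightarrow> 'k::field_char_0"
  assumes tr: "totally_real_number_field TYPE('k)" and b: "rat_basis d b" and a: "a \<in> (\<O> :: 'k set)"
  shows "field_trace a \<in> \<int>"
proof (rule rational_algebraic_int_is_int)
  show "field_trace a \<in> \<rat>" by (rule field_trace_rational[OF tr b])
  show "algebraic_int (field_trace a)"
    unfolding field_trace_def using a
    by (intro algebraic_int_sum) (auto simp: real_embeddings_def integers_iff intro: field_hom_algebraic_int)
qed

lemma det_diag_mat_fun: "Determinant.det (mat d d (\<lambda>(i, j). if i = j then f i else 0)) = (\<Prod>i<d. f i :: 'a::comm_ring_1)"
proof -
  let ?A = "mat d d (\<lambda>(i, j). if i = j then f i else 0)"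
  have "Determinant.det ?A = prod_list (diag_mat ?A)"
    by (rule det_upper_triangular[of _ d]) (auto simp: upper_triangular_def)
  also have "diag_mat ?A = map f [0..<d]" by (auto simp: diag_mat_def)
  also have "prod_list \<dots> = (\<Prod>i<d. f i)"
    by (subst prod.distinct_set_conv_list[symmetric]) (auto simp: atLeast0LessThan)
  finally show ?thesis .
qed

abbreviation embedding_det :: "nat \<Rightarrow> (nat \<Rightarrow> 'k \<Rightarrow> real) \<Rightarrow> (nat \<Rightarrow> 'k::field_char_0) \<Rightarrow> real" where
  "embedding_det d \<nu> b \<equiv> Determinant.det (mat d d (\<lambda>(i, j). \<nu> i (b j)))"

text \<open>Taking determinants in D W = W A', where D is the diagonal matrix of conjugates and W
  the invertible embedding matrix, identifies the norm with the determinant of a rational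
  matrix.\<close>

lemma field_norm_rational:
  fixes b :: "nat \<Rightarrow> 'k::field_char_0" and \<nu> :: "nat \<Rightarrow> 'k \<Rightarrow> real"
  assumes tr: "totally_real_number_field TYPE('k)" and b: "rat_basis d b"
    and \<nu>: "bij_betw \<nu> {..<d} real_embeddings"
  shows "field_norm (a :: 'k) \<in> \<rat>"
proof -
  obtain M where M: "\<And>j. a * b j = (\<Sum>i<d. of_rat (M i j) * b i)"
    using rat_basis_multiplication_matrix[OF b, of a] by blast
  define W where "W = mat d d (\<lambda>(i, j). \<nu> i (b j))"
  define D where "D = mat d d (\<lambda>(i, j). if i = j then \<nu> i a else 0)"
  define A where "A = mat d d (\<lambda>(i, j). M i j)"
  define A' where "A' = (map_mat of_rat A :: real mat)"
  have [simp]: "W \<in> carrier_mat d d" "D \<in> carrier_mat d d" "A \<in> carrier_mat d d" "A' \<in> carrier_mat d d"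
    by (auto simp: W_def D_def A_def A'_def)
  have "D * W = W * A'"
  proof (rule eq_matI)
    fix i j assume "i < dim_row (W * A')" "j < dim_col (W * A')"
    hence ij: "i < d" "j < d" by (auto simp: W_def A'_def A_def)
    have "\<nu> i \<in> real_embeddings" using \<nu> ij by (auto simp: bij_betw_def)
    hence h: "field_hom (\<nu> i)" by (simp add: real_embeddings_def)
    interpret field_hom "\<nu> i" by (rule h)
    have "(D * W) $$ (i, j) = (\<Sum>k<d. (if i = k then \<nu> i a else 0) * \<nu> k (b j))"
      using ij by (simp add: D_def W_def scalar_prod_def atLeast0LessThan)
    also have "\<dots> = (\<Sum>k<d. if i = k then \<nu> i a * \<nu> k (b j) else 0)"
      by (intro sum.cong) auto
    also have "\<dots> = \<nu> i (a * b j)" using ij by (simp add: hom_mult)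
    also have "\<dots> = (\<Sum>k<d. of_rat (M k j) * \<nu> i (b k))"
      unfolding M by (rule field_hom_rat_combination[OF h])
    also have "\<dots> = (W * A') $$ (i, j)"
      using ij by (simp add: A'_def A_def W_def scalar_prod_def atLeast0LessThan mult.commute)
    finally show "(D * W) $$ (i, j) = (W * A') $$ (i, j)" .
  qed (auto simp: W_def D_def A'_def A_def)
  hence "Determinant.det D * Determinant.det W = Determinant.det W * Determinant.det A'"
    by (simp flip: det_mult[of D d W] det_mult[of W d A'])
  moreover have "Determinant.det W \<noteq> 0"
    unfolding W_def by (rule det_embedding_matrix_nonzero[OF tr b \<nu>])
  ultimately have "Determinant.det D = Determinant.det A'" by simp
  also have "\<dots> = of_rat (Determinant.det A)"
    unfolding A'_def by (rule of_rat_hom.hom_det)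
  finally have "Determinant.det D \<in> \<rat>" by simp
  moreover have "Determinant.det D = (\<Prod>i<d. \<nu> i a)"
    unfolding D_def by (rule det_diag_mat_fun)
  moreover have "(\<Prod>i<d. \<nu> i a) = field_norm a"
    unfolding field_norm_def by (rule prod.reindex_bij_betw[OF \<nu>])
  ultimately show ?thesis by simp
qed

lemma field_norm_integer:
  fixes b :: "nat \<Rightarrow> 'k::field_char_0" and \<nu> :: "nat \<Rightarrow> 'k \<Rightarrow> real"
  assumes tr: "totally_real_number_field TYPE('k)" and b: "rat_basis d b"
    and \<nu>: "bij_betw \<nu> {..<d} real_embeddings" and a: "a \<in> (\<O> :: 'k set)"
  shows "field_norm a \<in> \<int>"
proof (rule rational_algebraic_int_is_int)
  show "field_norm a \<in> \<rat>" by (rule field_norm_rational[OF tr b \<nu>])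
  show "algebraic_int (field_norm a)"
    unfolding field_norm_def using a
    by (intro algebraic_int_prod) (auto simp: real_embeddings_def integers_iff intro: field_hom_algebraic_int)
qed

text \<open>The matrix of traces is the transpose of the embedding matrix times the embedding
  matrix.\<close>

lemma det_trace_matrix:
  fixes b :: "nat \<Rightarrow> 'k::field_char_0"
  assumes \<nu>: "bij_betw \<nu> {..<d} real_embeddings"
  shows "Determinant.det (mat d d (\<lambda>(i, j). field_trace (b i * b j))) = (embedding_det d \<nu> b)\<^sup>2"
proof -
  define W where "W = mat d d (\<lambda>(i, j). \<nu> i (b j))"
  have W: "W \<in> carrier_mat d d" by (simp add: W_def)
  have "mat d d (\<lambda>(i, j). field_trace (b i * b j)) = transpose_mat W * W"
  proof (rule eq_matI)
    fix i j assume "i < dim_row (transpose_mat W * W)" "j < dim_col (transpose_mat W * W)"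
    hence ij: "i < d" "j < d" by (auto simp: W_def)
    have "field_trace (b i * b j) = (\<Sum>k<d. \<nu> k (b i * b j))"
      unfolding field_trace_def by (rule sum.reindex_bij_betw[OF \<nu>, symmetric])
    also have "\<dots> = (\<Sum>k<d. \<nu> k (b i) * \<nu> k (b j))"
    proof (rule sum.cong[OF refl])
      fix k assume "k \<in> {..<d}"
      hence "\<nu> k \<in> real_embeddings" using \<nu> by (auto simp: bij_betw_def)
      then interpret field_hom "\<nu> k" by (simp add: real_embeddings_def)
      show "\<nu> k (b i * b j) = \<nu> k (b i) * \<nu> k (b j)" by (rule hom_mult)
    qed
    also have "\<dots> = (transpose_mat W * W) $$ (i, j)"
      using ij by (simp add: W_def scalar_prod_def atLeast0LessThan)
    finally show "mat d d (\<lambda>(i, j). field_trace (b i * b j)) $$ (i, j) = (transpose_mat W * W) $$ (i, j)"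
      using ij by simp
  qed (auto simp: W_def)
  also have "Determinant.det \<dots> = Determinant.det (transpose_mat W) * Determinant.det W"
    using W by (intro det_mult) auto
  also have "\<dots> = (Determinant.det W)\<^sup>2"
    by (simp add: det_transpose[OF W] power2_eq_square)
  finally show ?thesis by (simp add: W_def)
qed

lemma Ints_det:
  fixes A :: "real mat"
  assumes "A \<in> carrier_mat n n" "\<And>i j. i < n \<Longrightarrow> j < n \<Longrightarrow> A $$ (i, j) \<in> \<int>"
  shows "Determinant.det A \<in> \<int>"
proof -
  define B where "B = mat n n (\<lambda>(i, j). floor (A $$ (i, j)))"
  have "A = map_mat of_int B"
    using assms by (intro eq_matI) (auto simp: B_def of_int_floor)
  thus ?thesis by (simp add: of_int_hom.hom_det)
qed

section \<open>Integral bases and the discriminant\<close>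

lemma integral_rat_basis_exists:
  assumes tr: "totally_real_number_field TYPE('k::field_char_0)" and d: "d = number_field_degree TYPE('k)"
  shows "\<exists>w :: nat \<Rightarrow> 'k. rat_basis d w \<and> (\<forall>i<d. w i \<in> \<O>)"
proof -
  obtain b :: "nat \<Rightarrow> 'k" where b: "rat_basis d b" using rat_basis_exists[OF tr] d by blast
  have span: "Modules.module.span rat_scale (b ` {..<d}) = UNIV" by (rule rat_basis_span[OF b])
  have "\<exists>D::int. 0 < D \<and> of_int D * a \<in> \<O>" for a :: 'k
    using algebraic_over_rat[OF _ span, of a] ex_integral_multiple[of _ a] by auto
  hence "\<forall>i. \<exists>D::int. 0 < D \<and> of_int D * b i \<in> \<O>" by blast
  then obtain D :: "nat \<Rightarrow> int" where D: "\<And>i. 0 < D i" "\<And>i. of_int (D i) * b i \<in> \<O>"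
    unfolding choice_iff by blast
  define w where "w = (\<lambda>i. of_int (D i) * b i)"
  have "rat_basis d w"
    unfolding rat_basis_def
  proof (intro conjI allI impI)
    fix x :: 'k
    obtain c where c: "x = (\<Sum>i<d. of_rat (c i) * b i)" using b unfolding rat_basis_def by blast
    have "of_rat (c i) * b i = of_rat (c i / of_int (D i)) * w i" for i
      using D(1)[of i] by (simp add: w_def of_rat_divide)
    thus "\<exists>c. x = (\<Sum>i<d. of_rat (c i) * w i)"
      by (intro exI[of _ "\<lambda>i. c i / of_int (D i)"]) (simp add: c)
  next
    fix c i assume c: "(\<Sum>i<d. of_rat (c i) * w i) = 0" and i: "i < d"
    have "(\<Sum>i<d. of_rat (c i * of_int (D i)) * b i) = 0"
      using c by (simp add: w_def of_rat_mult mult.assoc)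
    hence "c i * of_int (D i) = 0" by (rule rat_basis_independent[OF b _ i])
    thus "c i = 0" using D(1)[of i] by simp
  qed
  thus ?thesis using D(2) by (intro exI[of _ w]) (simp add: w_def)
qed

lemma rat_basis_exchange:
  fixes w :: "nat \<Rightarrow> 'k::field_char_0"
  assumes w: "rat_basis d w" and i: "i < d" and f: "c i \<noteq> 0"
  shows "rat_basis d (w(i := \<Sum>j<d. of_rat (c j) * w j))"
proof -
  define w' where "w' = w(i := \<Sum>j<d. of_rat (c j) * w j)"
  have eq: "(\<Sum>j<d. of_rat (y j) * w' j) = (\<Sum>j<d. of_rat (if j = i then y i * c i else y j + y i * c j) * w j)"
    (is "?L = ?R") for y
  proof -
    have "?L = of_rat (y i) * (\<Sum>j<d. of_rat (c j) * w j) + (\<Sum>j\<in>{..<d} - {i}. of_rat (y j) * w j)"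
      using i by (subst sum.remove[of _ i]) (auto simp: w'_def intro!: sum.cong)
    also have "(\<Sum>j<d. of_rat (c j) * w j) = of_rat (c i) * w i + (\<Sum>j\<in>{..<d} - {i}. of_rat (c j) * w j)"
      using i by (subst sum.remove[of _ i]) auto
    finally have L: "?L = of_rat (y i * c i) * w i + (\<Sum>j\<in>{..<d} - {i}. of_rat (y j + y i * c j) * w j)"
      by (simp add: of_rat_mult of_rat_add algebra_simps sum.distrib sum_distrib_left)
    have "?R = of_rat (y i * c i) * w i + (\<Sum>j\<in>{..<d} - {i}. of_rat (y j + y i * c j) * w j)"
      using i by (subst sum.remove[of _ i]) (auto intro!: sum.cong)
    with L show ?thesis by simp
  qed
  show ?thesis
    unfolding w'_def[symmetric] rat_basis_def
  proof (intro conjI allI impI)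
    fix x :: 'k
    obtain b where b: "x = (\<Sum>j<d. of_rat (b j) * w j)" using w unfolding rat_basis_def by blast
    define y where "y = (\<lambda>j. if j = i then b i / c i else b j - b i / c i * c j)"
    have "(\<Sum>j<d. of_rat (y j) * w' j) = x"
      unfolding eq b using f by (intro sum.cong) (auto simp: y_def)
    thus "\<exists>y. x = (\<Sum>j<d. of_rat (y j) * w' j)" by (intro exI[of _ y]) simp
  next
    fix y j assume y: "(\<Sum>j<d. of_rat (y j) * w' j) = 0" and j: "j < d"
    have z: "(if j = i then y i * c i else y j + y i * c j) = 0" if "j < d" for j
      by (rule rat_basis_independent[OF w y[unfolded eq] that])
    have "y i = 0" using z[OF i] f by simp
    thus "y j = 0" using z[OF j] f by (auto split: if_splits)
  qed
qed

text \<open>Cramer's rule: the exchange replaces column i of the embedding matrix W by W x, where x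
  is the vector of coefficients.\<close>

lemma embedding_det_exchange:
  fixes w :: "nat \<Rightarrow> 'k::field_char_0" and \<nu> :: "nat \<Rightarrow> 'k \<Rightarrow> real"
  assumes \<nu>: "bij_betw \<nu> {..<d} real_embeddings" and i: "i < d"
  shows "embedding_det d \<nu> (w(i := \<Sum>j<d. of_rat (c j) * w j)) = of_rat (c i) * embedding_det d \<nu> w"
proof -
  define W where "W = mat d d (\<lambda>(i, j). \<nu> i (w j))"
  define x where "x = vec d (\<lambda>j. real_of_rat (c j))"
  have W: "W \<in> carrier_mat d d" and x: "x \<in> carrier_vec d" by (auto simp: W_def x_def)
  have "mat d d (\<lambda>(k, j). \<nu> k ((w(i := \<Sum>j<d. of_rat (c j) * w j)) j)) = replace_col W (W *\<^sub>v x) i"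
  proof (rule eq_matI)
    fix k j assume "k < dim_row (replace_col W (W *\<^sub>v x) i)" "j < dim_col (replace_col W (W *\<^sub>v x) i)"
    hence kj: "k < d" "j < d" using W by (auto simp: replace_col_def)
    have "\<nu> k \<in> real_embeddings" using \<nu> kj by (auto simp: bij_betw_def)
    hence "field_hom (\<nu> k)" by (simp add: real_embeddings_def)
    hence "\<nu> k (\<Sum>j<d. of_rat (c j) * w j) = (\<Sum>j<d. of_rat (c j) * \<nu> k (w j))"
      by (rule field_hom_rat_combination)
    thus "mat d d (\<lambda>(k, j). \<nu> k ((w(i := \<Sum>j<d. of_rat (c j) * w j)) j)) $$ (k, j) = replace_col W (W *\<^sub>v x) i $$ (k, j)"
      using kj by (auto simp: replace_col_def W_def x_def scalar_prod_def atLeast0LessThan mult.commute)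
  qed (auto simp: replace_col_def W_def)
  thus ?thesis using cramer_lemma_mat[OF W x i] i by (simp add: W_def x_def)
qed

text \<open>Among the rational bases consisting of integers, take one whose squared embedding
  determinant, a positive integer, is least. If some integer had a non-integral coordinate, an
  exchange would multiply this value by the square of a number strictly between 0 and 1.\<close>

lemma integral_basis_exists:
  fixes \<nu> :: "nat \<Rightarrow> 'k::field_char_0 \<Rightarrow> real"
  assumes tr: "totally_real_number_field TYPE('k)" and d: "d = number_field_degree TYPE('k)"
    and \<nu>: "bij_betw \<nu> {..<d} real_embeddings"
  shows "\<exists>w :: nat \<Rightarrow> 'k. rat_basis d w \<and> (\<forall>a. a \<in> \<O> \<longleftrightarrow> (\<exists>c::nat \<Rightarrow> int. a = (\<Sum>i<d. of_int (c i) * w i)))"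
proof -
  define P where "P = (\<lambda>w :: nat \<Rightarrow> 'k. rat_basis d w \<and> (\<forall>i<d. w i \<in> \<O>))"
  define m where "m = (\<lambda>w. nat (floor ((embedding_det d \<nu> w)\<^sup>2)))"
  obtain w0 where "P w0" using integral_rat_basis_exists[OF tr d] unfolding P_def by blast
  then obtain w where w: "P w" "\<And>w'. P w' \<Longrightarrow> m w \<le> m w'"
    using ex_has_least_nat[of P w0 m] by blast
  have wb: "rat_basis d w" and wO: "\<And>i. i < d \<Longrightarrow> w i \<in> \<O>" using w(1) by (auto simp: P_def)
  have int: "(embedding_det d \<nu> w)\<^sup>2 \<in> \<int>" if "P w" for w
    unfolding det_trace_matrix[OF \<nu>, symmetric]
    using that by (intro Ints_det[of _ d]) (auto simp: P_def intro!: field_trace_integer[OF tr] integers_mult)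
  have m: "real (m w) = (embedding_det d \<nu> w)\<^sup>2" if "P w" for w
    using int[OF that] by (simp add: m_def of_int_floor)
  have "\<exists>c::nat \<Rightarrow> int. a = (\<Sum>i<d. of_int (c i) * w i)" if a: "a \<in> \<O>" for a
  proof -
    obtain q where q: "a = (\<Sum>i<d. of_rat (q i) * w i)" using wb unfolding rat_basis_def by blast
    have qi: "q i \<in> \<int>" if i: "i < d" for i
    proof (rule ccontr)
      assume ni: "q i \<notin> \<int>"
      \<comment> \<open>Subtracting \<open>floor (q i)\<close> times \<open>w i\<close> from a keeps
        it an integer and leaves the fractional part as its coordinate i.\<close>
      define c where "c = (\<lambda>j. if j = i then frac (q i) else q j)"
      define w' where "w' = w(i := \<Sum>j<d. of_rat (c j) * w j)"
      have f: "0 < c i" "c i < 1" using ni by (auto simp: c_def frac_lt_1 frac_gt_0_iff)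
      have "(\<Sum>j<d. of_rat (c j) * w j) = (\<Sum>j<d. of_rat (q j) * w j - (if j = i then of_int (floor (q i)) * w i else 0))"
        by (intro sum.cong refl) (auto simp: c_def frac_def of_rat_diff algebra_simps)
      also have "\<dots> = a - of_int (floor (q i)) * w i"
        using i by (simp add: sum_subtractf q)
      finally have wi: "(\<Sum>j<d. of_rat (c j) * w j) = a - of_int (floor (q i)) * w i" .
      have "P w'"
        unfolding P_def
      proof (intro conjI allI impI)
        show "rat_basis d w'" unfolding w'_def using f by (intro rat_basis_exchange wb i) simp
        show "w' j \<in> \<O>" if "j < d" for j
          using that wO a i unfolding w'_def wi by (auto intro!: integers_diff integers_mult integers_of_int)
      qed
      hence "m w \<le> m w'" by (rule w(2))
      hence "(embedding_det d \<nu> w)\<^sup>2 \<le> (embedding_det d \<nu> w')\<^sup>2"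
        using m[OF \<open>P w'\<close>] m[OF w(1)] by (metis of_nat_le_iff)
      also have "\<dots> = (of_rat (c i))\<^sup>2 * (embedding_det d \<nu> w)\<^sup>2"
        unfolding w'_def embedding_det_exchange[OF \<nu> i] by (simp add: power_mult_distrib)
      finally have "(1 - (of_rat (c i))\<^sup>2) * (embedding_det d \<nu> w)\<^sup>2 \<le> 0" by (simp add: algebra_simps)
      moreover have "(of_rat (c i) :: real)\<^sup>2 < 1"
        using f by (intro power_less_one_iff[THEN iffD2]) (auto simp: of_rat_less_1_iff)
      moreover have "embedding_det d \<nu> w \<noteq> 0" by (rule det_embedding_matrix_nonzero[OF tr wb \<nu>])
      ultimately show False by (simp add: mult_le_0_iff)
    qed
    have "of_rat (q i) = (of_int (floor (q i)) :: 'k)" if "i < d" for i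
      using qi[OF that] by (metis Ints_cases floor_of_int of_rat_of_int_eq)
    hence "a = (\<Sum>i<d. of_int (floor (q i)) * w i)" unfolding q by (intro sum.cong) auto
    thus ?thesis by (intro exI[of _ "\<lambda>i. floor (q i)"])
  qed
  moreover have "(\<Sum>i<d. of_int (c i) * w i) \<in> \<O>" for c :: "nat \<Rightarrow> int"
    using wO by (intro integers_sum integers_mult integers_of_int) auto
  ultimately show ?thesis using wb by (intro exI[of _ w]) auto
qed

lemma integral_basis_iff:
  fixes w :: "nat \<Rightarrow> 'k::field_char_0"
  assumes w: "rat_basis d w" and d: "d = number_field_degree TYPE('k)"
    and O: "\<And>a. a \<in> \<O> \<longleftrightarrow> (\<exists>c::nat \<Rightarrow> int. a = (\<Sum>i<d. of_int (c i) * w i))"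
  shows "integral_basis w"
  unfolding integral_basis_def d[symmetric] bij_betw_def
proof
  show "inj_on (\<lambda>c :: int Matrix.vec. \<Sum>i<d. of_int (c $ i) * w i) (carrier_vec d)"
  proof (rule inj_onI)
    fix x y :: "int Matrix.vec"
    assume xy: "x \<in> carrier_vec d" "y \<in> carrier_vec d"
      and eq: "(\<Sum>i<d. of_int (x $ i) * w i) = (\<Sum>i<d. of_int (y $ i) * w i)"
    have "rat_of_int (x $ i) = rat_of_int (y $ i)" if "i < d" for i
      by (rule rat_basis_unique[OF w _ that]) (simp add: eq)
    thus "x = y" using xy by (intro eq_vecI) auto
  qed
  show "(\<lambda>c :: int Matrix.vec. \<Sum>i<d. of_int (c $ i) * w i) ` carrier_vec d = \<O>"
  proof safe
    fix x :: "int Matrix.vec"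
    show "(\<Sum>i<d. of_int (x $ i) * w i) \<in> \<O>" unfolding O by (intro exI[of _ "\<lambda>i. x $ i"]) simp
  next
    fix a :: 'k assume "a \<in> \<O>"
    then obtain c :: "nat \<Rightarrow> int" where c: "a = (\<Sum>i<d. of_int (c i) * w i)" unfolding O by blast
    show "a \<in> (\<lambda>c :: int Matrix.vec. \<Sum>i<d. of_int (c $ i) * w i) ` carrier_vec d"
      by (rule image_eqI[of _ _ "vec d c"]) (auto simp: c)
  qed
qed

lemma embedding_det_int_combination:
  fixes w :: "nat \<Rightarrow> 'k::field_char_0" and \<nu> :: "nat \<Rightarrow> 'k \<Rightarrow> real" and A :: "nat \<Rightarrow> nat \<Rightarrow> int"
  assumes \<nu>: "bij_betw \<nu> {..<d} real_embeddings" and v: "\<And>j. j < d \<Longrightarrow> v j = (\<Sum>i<d. of_int (A i j) * w i)"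
  shows "embedding_det d \<nu> v = embedding_det d \<nu> w * of_int (Determinant.det (mat d d (\<lambda>(i, j). A i j)))"
proof -
  define B where "B = mat d d (\<lambda>(i, j). A i j)"
  define W where "W = mat d d (\<lambda>(i, j). \<nu> i (w j))"
  have "mat d d (\<lambda>(k, j). \<nu> k (v j)) = W * map_mat of_int B"
  proof (rule eq_matI)
    fix k j assume "k < dim_row (W * map_mat of_int B)" "j < dim_col (W * map_mat of_int B)"
    hence kj: "k < d" "j < d" by (auto simp: W_def B_def)
    have "\<nu> k \<in> real_embeddings" using \<nu> kj by (auto simp: bij_betw_def)
    hence h: "field_hom (\<nu> k)" by (simp add: real_embeddings_def)
    have "v j = (\<Sum>i<d. of_rat (of_int (A i j)) * w i)" using v[OF kj(2)] by simp
    hence "\<nu> k (v j) = (\<Sum>i<d. of_rat (of_int (A i j)) * \<nu> k (w i))"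
      using field_hom_rat_combination[OF h, of "\<lambda>i. of_int (A i j)" w "{..<d}"] by simp
    thus "mat d d (\<lambda>(k, j). \<nu> k (v j)) $$ (k, j) = (W * map_mat of_int B) $$ (k, j)"
      using kj by (simp add: W_def B_def scalar_prod_def atLeast0LessThan mult.commute)
  qed (auto simp: W_def B_def)
  also have "Determinant.det \<dots> = Determinant.det W * Determinant.det (map_mat of_int B)"
    by (rule det_mult[of _ d]) (auto simp: W_def B_def)
  also have "Determinant.det (map_mat of_int B) = real_of_int (Determinant.det B)"
    by (rule of_int_hom.hom_det)
  finally show ?thesis by (simp add: W_def B_def)
qed

text \<open>Two integral bases express each other through integer matrices whose determinants
  multiply to 1. Both determinants are thus 1 or -1, the squared embedding determinant is the same
  for all integral bases, and the definite description in the definition is meaningful.\<close>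

lemma field_discriminant_eq:
  fixes w :: "nat \<Rightarrow> 'k::field_char_0" and \<nu> :: "nat \<Rightarrow> 'k \<Rightarrow> real"
  assumes tr: "totally_real_number_field TYPE('k)" and d: "d = number_field_degree TYPE('k)"
    and \<nu>: "bij_betw \<nu> {..<d} real_embeddings" and w: "rat_basis d w"
    and O: "\<And>a. a \<in> \<O> \<longleftrightarrow> (\<exists>c::nat \<Rightarrow> int. a = (\<Sum>i<d. of_int (c i) * w i))"
  shows "field_discriminant TYPE('k) = (embedding_det d \<nu> w)\<^sup>2"
proof -
  have ib: "integral_basis w" by (rule integral_basis_iff[OF w d O])
  have nz: "embedding_det d \<nu> w \<noteq> 0" by (rule det_embedding_matrix_nonzero[OF tr w \<nu>])
  have uniq: "(embedding_det d \<nu> v)\<^sup>2 = (embedding_det d \<nu> w)\<^sup>2" if "integral_basis v" for v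
  proof -
    have v: "\<O> = (\<lambda>c :: int Matrix.vec. \<Sum>i<d. of_int (c $ i) * v i) ` carrier_vec d"
      using that unfolding integral_basis_def d[symmetric] bij_betw_def by blast
    have vO: "v i \<in> \<O>" if "i < d" for i
    proof -
      have "v i = (\<Sum>j<d. of_int (unit_vec d i $ j) * v j)"
        using that by (subst sum.cong[OF refl, of _ _ "\<lambda>j. if j = i then v j else 0"]) (auto simp: unit_vec_def)
      thus ?thesis unfolding v by (intro image_eqI[of _ _ "unit_vec d i"]) auto
    qed
    have wO: "w i \<in> \<O>" if "i < d" for i
      unfolding O using that
      by (intro exI[of _ "\<lambda>j. if j = i then 1 else 0"])
         (subst sum.cong[OF refl, of _ _ "\<lambda>j. if j = i then w j else 0"], auto)
    have "\<forall>j. \<exists>c::nat \<Rightarrow> int. j < d \<longrightarrow> v j = (\<Sum>i<d. of_int (c i) * w i)"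
      using vO unfolding O by blast
    then obtain A where A: "\<And>j. j < d \<Longrightarrow> v j = (\<Sum>i<d. of_int (A j i) * w i)"
      unfolding choice_iff by blast
    have "\<forall>j. \<exists>c::nat \<Rightarrow> int. j < d \<longrightarrow> w j = (\<Sum>i<d. of_int (c i) * v i)"
    proof (intro allI)
      fix j
      show "\<exists>c::nat \<Rightarrow> int. j < d \<longrightarrow> w j = (\<Sum>i<d. of_int (c i) * v i)"
      proof (cases "j < d")
        case True
        then obtain x :: "int Matrix.vec" where "w j = (\<Sum>i<d. of_int (x $ i) * v i)"
          using wO[OF True] unfolding v by blast
        thus ?thesis by (intro exI[of _ "\<lambda>i. x $ i"]) simp
      qed simp
    qed
    then obtain B where B: "\<And>j. j < d \<Longrightarrow> w j = (\<Sum>i<d. of_int (B j i) * v i)"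
      unfolding choice_iff by blast
    define p where "p = Determinant.det (mat d d (\<lambda>(i, j). A j i))"
    define q where "q = Determinant.det (mat d d (\<lambda>(i, j). B j i))"
    have 1: "embedding_det d \<nu> v = embedding_det d \<nu> w * of_int p"
      unfolding p_def by (rule embedding_det_int_combination[OF \<nu> A])
    have 2: "embedding_det d \<nu> w = embedding_det d \<nu> v * of_int q"
      unfolding q_def by (rule embedding_det_int_combination[OF \<nu> B])
    have "embedding_det d \<nu> w * of_int (p * q) = (embedding_det d \<nu> w * of_int p) * of_int q"
      by (simp add: mult.assoc)
    also have "\<dots> = embedding_det d \<nu> w * 1"
      unfolding 1[symmetric] 2[symmetric] by simp
    finally have "embedding_det d \<nu> w * of_int (p * q) = embedding_det d \<nu> w * 1" .
    hence "real_of_int (p * q) = 1" using nz by (metis mult_cancel_left)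
    hence "p * q = 1" by linarith
    hence "p\<^sup>2 = 1" by (metis zmult_eq_1_iff power2_minus power_one)
    hence "(real_of_int p)\<^sup>2 = 1" by (metis of_int_1 of_int_power)
    thus ?thesis unfolding 1 power_mult_distrib by simp
  qed
  show ?thesis
    unfolding field_discriminant_def d[symmetric] det_trace_matrix[OF \<nu>]
  proof (rule the_equality)
    show "\<exists>v. integral_basis v \<and> (embedding_det d \<nu> w)\<^sup>2 = (embedding_det d \<nu> v)\<^sup>2"
      by (intro exI[of _ w] conjI ib refl)
  next
    fix D assume "\<exists>v. integral_basis v \<and> D = (embedding_det d \<nu> v)\<^sup>2"
    then obtain v where v: "integral_basis v" "D = (embedding_det d \<nu> v)\<^sup>2" by blast
    show "D = (embedding_det d \<nu> w)\<^sup>2" unfolding v(2) by (rule uniq[OF v(1)])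
  qed
qed

section \<open>Totally real number fields\<close>

text \<open>Fixes one ordering of the embeddings and one integral basis, so that embeddings become
  the rows and basis elements the columns of a square matrix.\<close>

locale number_field =
  fixes d :: nat and w :: "nat \<Rightarrow> 'k::field_char_0" and \<nu> :: "nat \<Rightarrow> 'k \<Rightarrow> real"
  assumes totally_real: "totally_real_number_field TYPE('k)"
    and degree: "d = number_field_degree TYPE('k)"
    and embeddings: "bij_betw \<nu> {..<d} real_embeddings"
    and basis: "rat_basis d w"
    and integers: "\<And>a. a \<in> \<O> \<longleftrightarrow> (\<exists>c::nat \<Rightarrow> int. a = (\<Sum>i<d. of_int (c i) * w i))"

lemma number_field_exists:
  assumes tr: "totally_real_number_field TYPE('k::field_char_0)" and d: "d = number_field_degree TYPE('k)"
  shows "\<exists>(w :: nat \<Rightarrow> 'k) \<nu>. number_field d w \<nu>"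
proof -
  obtain b :: "nat \<Rightarrow> 'k" where b: "rat_basis d b" using rat_basis_exists[OF tr] d by blast
  have "finite (real_embeddings :: ('k \<Rightarrow> real) set)" by (rule real_embedding_coordinates(1)[OF tr b])
  then obtain \<nu> :: "nat \<Rightarrow> 'k \<Rightarrow> real" where \<nu>: "bij_betw \<nu> {..<d} real_embeddings"
    using ex_bij_betw_nat_finite card_real_embeddings[OF tr b] by (metis atLeast0LessThan)
  obtain w :: "nat \<Rightarrow> 'k" where "rat_basis d w"
    "\<And>a. a \<in> \<O> \<longleftrightarrow> (\<exists>c::nat \<Rightarrow> int. a = (\<Sum>i<d. of_int (c i) * w i))"
    using integral_basis_exists[OF tr d \<nu>] by blast
  thus ?thesis using tr d \<nu> by (intro exI[of _ w] exI[of _ \<nu>]) (unfold_locales, auto)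
qed

context number_field
begin

lemma nu_in: "i < d \<Longrightarrow> \<nu> i \<in> real_embeddings"
  using embeddings by (auto simp: bij_betw_def)

lemma ball_embeddings: "(\<forall>\<mu>\<in>real_embeddings. P \<mu>) \<longleftrightarrow> (\<forall>i<d. P (\<nu> i))"
  using embeddings unfolding bij_betw_def by (metis imageE imageI lessThan_iff)

lemma nu_hom: "i < d \<Longrightarrow> field_hom (\<nu> i)"
  using nu_in by (simp add: real_embeddings_def)

lemma
  assumes "i < d"
  shows nu_add: "\<nu> i (a + b) = \<nu> i a + \<nu> i b"
    and nu_mult: "\<nu> i (a * b) = \<nu> i a * \<nu> i b"
    and nu_diff: "\<nu> i (a - b) = \<nu> i a - \<nu> i b"
    and nu_power: "\<nu> i (a ^ n) = \<nu> i a ^ n"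
    and nu_0: "\<nu> i 0 = 0"
    and nu_1: "\<nu> i 1 = 1"
    and nu_sum: "\<nu> i (sum f S) = (\<Sum>s\<in>S. \<nu> i (f s))"
    and nu_eq_0: "\<nu> i a = 0 \<longleftrightarrow> a = 0"
    and nu_of_int: "\<nu> i (of_int z) = of_int z"
proof -
  interpret field_hom "\<nu> i" by (rule nu_hom[OF assms])
  show "\<nu> i (a + b) = \<nu> i a + \<nu> i b" "\<nu> i (a * b) = \<nu> i a * \<nu> i b" by (rule hom_add hom_mult)+
  show "\<nu> i (a - b) = \<nu> i a - \<nu> i b" by (rule hom_minus)
  show "\<nu> i (a ^ n) = \<nu> i a ^ n" by (rule hom_power)
  show "\<nu> i 0 = 0" "\<nu> i 1 = 1" by simp_all
  show "\<nu> i (sum f S) = (\<Sum>s\<in>S. \<nu> i (f s))" by (rule hom_sum)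
  show "\<nu> i a = 0 \<longleftrightarrow> a = 0" by simp
  show "\<nu> i (of_int z) = of_int z" by (rule hom_of_int)
qed

lemma field_norm_eq: "field_norm a = (\<Prod>i<d. \<nu> i a)"
  unfolding field_norm_def by (rule prod.reindex_bij_betw[OF embeddings, symmetric])

lemma field_norm_mult: "field_norm (a * b :: 'k) = field_norm a * field_norm b"
  by (simp add: field_norm_eq nu_mult prod.distrib)

lemma field_norm_power: "field_norm (a ^ n :: 'k) = field_norm a ^ n"
  by (simp add: field_norm_eq nu_power prod_power_distrib)

lemma field_norm_1: "field_norm (1 :: 'k) = 1"
  by (simp add: field_norm_eq nu_1)

lemma degree_pos: "0 < d"
proof (rule ccontr)
  assume "\<not> 0 < d"
  hence "d = 0" by simp
  hence "x = 0" for x :: 'k using basis by (simp add: rat_basis_def)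
  thus False by (metis zero_neq_one)
qed

lemma field_norm_eq_0: "field_norm (a :: 'k) = 0 \<longleftrightarrow> a = 0"
  using degree_pos by (auto simp: field_norm_eq nu_eq_0 nu_0)

lemma field_norm_pos: "totally_positive (a :: 'k) \<Longrightarrow> 0 < field_norm a"
  unfolding totally_positive_def field_norm_def by (rule prod_pos) auto

lemma totally_positive_iff: "totally_positive a \<longleftrightarrow> (\<forall>i<d. 0 < \<nu> i a)"
  unfolding totally_positive_def ball_embeddings ..

lemma field_norm_Ints: "(a :: 'k) \<in> \<O> \<Longrightarrow> field_norm a \<in> \<int>"
  by (rule field_norm_integer[OF totally_real basis embeddings])

lemma field_norm_ge_1:
  assumes "(a :: 'k) \<in> \<O>" "a \<noteq> 0"
  shows "1 \<le> \<bar>field_norm a\<bar>"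
proof -
  obtain z :: int where z: "field_norm a = of_int z" using field_norm_Ints[OF assms(1)] by (auto elim: Ints_cases)
  have "z \<noteq> 0" using z assms(2) field_norm_eq_0[of a] by auto
  thus ?thesis unfolding z by linarith
qed

lemma discriminant_eq: "field_discriminant TYPE('k) = (embedding_det d \<nu> w)\<^sup>2"
  by (rule field_discriminant_eq[OF totally_real degree embeddings basis integers])

lemma embedding_det_nonzero: "embedding_det d \<nu> w \<noteq> 0"
  by (rule det_embedding_matrix_nonzero[OF totally_real basis embeddings])

lemma sqrt_abs_discriminant: "sqrt \<bar>field_discriminant TYPE('k)\<bar> = \<bar>embedding_det d \<nu> w\<bar>"
  by (simp add: discriminant_eq)

lemma unit_integers:
  assumes "\<epsilon> \<in> Units (integer_ring :: 'k ring)"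
  shows "\<epsilon> \<in> \<O>" "1 / \<epsilon> \<in> \<O>" "\<epsilon> \<noteq> 0"
proof -
  obtain \<delta> where \<delta>: "\<delta> \<in> \<O>" "\<epsilon> * \<delta> = 1" using assms by (auto simp: Units_def integer_ring_def)
  show "\<epsilon> \<in> \<O>" using assms by (auto simp: Units_def)
  show nz: "\<epsilon> \<noteq> 0" using \<delta>(2) by auto
  have "\<delta> = 1 / \<epsilon>" using \<delta>(2) nz by (simp add: field_simps)
  thus "1 / \<epsilon> \<in> \<O>" using \<delta>(1) by simp
qed

lemma field_norm_unit:
  assumes "(a :: 'k) \<in> \<O>" "1 / a \<in> \<O>" "a \<noteq> 0"
  shows "\<bar>field_norm a\<bar> = 1"
proof -
  have "\<bar>field_norm a\<bar> * \<bar>field_norm (1 / a)\<bar> = 1"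
    using assms(3) by (simp flip: abs_mult field_norm_mult add: field_norm_1)
  moreover have "1 \<le> \<bar>field_norm a\<bar>" "1 \<le> \<bar>field_norm (1 / a)\<bar>"
    using assms by (auto intro!: field_norm_ge_1)
  ultimately show ?thesis
    by (smt (verit) mult_le_cancel_left1)
qed

section \<open>Denominators, approximation by integers, balancing units\<close>

lemma integral_multiple: "\<exists>D::int. 0 < D \<and> of_int D * (a :: 'k) \<in> \<O>"
proof -
  obtain q where "q \<noteq> 0" "poly (map_poly of_rat q) a = 0"
    using algebraic_over_rat[OF _ rat_basis_span[OF basis], of a] by auto
  thus ?thesis by (rule ex_integral_multiple)
qed

lemma common_integral_multiple:
  assumes "finite S"
  shows "\<exists>D::int. 0 < D \<and> (\<forall>a\<in>S. of_int D * (a :: 'k) \<in> \<O>)"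
  using assms
proof induction
  case empty
  show ?case by (intro exI[of _ 1]) auto
next
  case (insert a S)
  then obtain D :: int where D: "0 < D" "\<forall>a\<in>S. of_int D * a \<in> \<O>" by blast
  obtain E :: int where E: "0 < E" "of_int E * a \<in> \<O>" using integral_multiple by blast
  have "of_int (E * D) * b \<in> \<O>" if b: "b \<in> insert a S" for b
  proof (cases "b = a")
    case True
    have "of_int (E * D) * b = of_int D * (of_int E * a)" unfolding True by (simp add: mult_ac)
    thus ?thesis using E(2) by (simp only: integers_mult[OF integers_of_int])
  next
    case False
    have "of_int (E * D) * b = of_int E * (of_int D * b)" by (simp add: mult_ac)
    thus ?thesis using D(2) b False by (simp only: integers_mult[OF integers_of_int] insert_iff simp_thms)
  qed
  thus ?case using D(1) E(1) by (intro exI[of _ "E * D"]) auto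
qed

lemma embedding_inverse:
  obtains C :: "nat \<Rightarrow> nat \<Rightarrow> real" where
    "\<forall>i<d. \<forall>j<d. (\<Sum>k<d. C i k * \<nu> k (w j)) = (if i = j then 1 else 0)"
    "\<forall>k<d. \<forall>l<d. (\<Sum>i<d. \<nu> k (w i) * C i l) = (if l = k then 1 else 0)"
proof -
  have inj: "inj_on \<nu> {..<d}" using embeddings by (auto simp: bij_betw_def)
  obtain C where C: "\<forall>i<d. \<forall>j<d. (\<Sum>\<nu>\<in>real_embeddings. C i \<nu> * \<nu> (w j)) = (if i = j then 1 else 0)"
    and D: "\<forall>\<nu>\<in>real_embeddings. \<forall>\<mu>\<in>real_embeddings. (\<Sum>i<d. \<nu> (w i) * C i \<mu>) = (if \<mu> = \<nu> then 1 else 0)"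
    using embedding_matrix_inverse[OF totally_real basis] by blast
  have 1: "\<forall>i<d. \<forall>j<d. (\<Sum>k<d. C i (\<nu> k) * \<nu> k (w j)) = (if i = j then 1 else 0)"
    using C by (subst sum.reindex_bij_betw[OF embeddings])
  have 2: "\<forall>k<d. \<forall>l<d. (\<Sum>i<d. \<nu> k (w i) * C i (\<nu> l)) = (if l = k then 1 else 0)"
    using D nu_in inj by (auto simp: inj_on_def)
  show ?thesis using that[of "\<lambda>i k. C i (\<nu> k)"] 1 2 by simp
qed

lemma nu_int_combination:
  "k < d \<Longrightarrow> \<nu> k (\<Sum>i<d. of_int (c i) * w i) = (\<Sum>i<d. of_int (c i) * \<nu> k (w i))"
  by (simp add: nu_sum nu_mult nu_of_int)

text \<open>The inverse of the embedding matrix expresses the integer coordinates through the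
  conjugates, so bounded conjugates leave only finitely many coordinate vectors.\<close>

lemma finite_bounded_integers: "finite {a \<in> \<O>. \<forall>k<d. \<bar>\<nu> k a\<bar> \<le> B}"
proof -
  obtain C :: "nat \<Rightarrow> nat \<Rightarrow> real" where C: "\<forall>i<d. \<forall>j<d. (\<Sum>k<d. C i k * \<nu> k (w j)) = (if i = j then 1 else 0)"
    by (rule embedding_inverse)
  define m where "m = (\<lambda>i. ceiling ((\<Sum>k<d. \<bar>C i k\<bar>) * B))"
  have "{a \<in> \<O>. \<forall>k<d. \<bar>\<nu> k a\<bar> \<le> B} \<subseteq> (\<lambda>c. \<Sum>i<d. of_int (c i) * w i) ` PiE {..<d} (\<lambda>i. {- m i..m i})"
  proof safe
    fix a :: 'k assume a: "a \<in> \<O>" and b: "\<forall>k<d. \<bar>\<nu> k a\<bar> \<le> B"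
    obtain c :: "nat \<Rightarrow> int" where c: "a = (\<Sum>i<d. of_int (c i) * w i)" using a integers by blast
    have "c i \<in> {- m i..m i}" if i: "i < d" for i
    proof -
      have "(\<Sum>k<d. C i k * \<nu> k a) = (\<Sum>k<d. \<Sum>j<d. of_int (c j) * (C i k * \<nu> k (w j)))"
        unfolding c by (intro sum.cong refl) (auto simp: nu_int_combination sum_distrib_left mult.left_commute)
      also have "\<dots> = (\<Sum>j<d. of_int (c j) * (\<Sum>k<d. C i k * \<nu> k (w j)))"
        unfolding sum_distrib_left by (rule sum.swap)
      also have "\<dots> = (\<Sum>j<d. if i = j then of_int (c j) else 0)"
        using C i by (intro sum.cong refl) auto
      also have "\<dots> = of_int (c i)" using i by simp
      finally have "\<bar>real_of_int (c i)\<bar> \<le> (\<Sum>k<d. \<bar>C i k * \<nu> k a\<bar>)"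
        by (metis sum_abs)
      also have "\<dots> \<le> (\<Sum>k<d. \<bar>C i k\<bar> * B)"
        using b by (intro sum_mono) (auto simp: abs_mult intro: mult_left_mono)
      also have "\<dots> \<le> of_int (m i)" unfolding m_def sum_distrib_right[symmetric] by (rule le_of_int_ceiling)
      finally have "\<bar>c i\<bar> \<le> m i" by linarith
      thus ?thesis by auto
    qed
    thus "a \<in> (\<lambda>c. \<Sum>i<d. of_int (c i) * w i) ` PiE {..<d} (\<lambda>i. {- m i..m i})"
      by (intro image_eqI[of _ _ "restrict c {..<d}"]) (auto simp: c)
  qed
  thus ?thesis by (rule finite_subset) (intro finite_imageI finite_PiE, auto)
qed

text \<open>Expressing the target in the basis and rounding the coordinates down leaves an error of
  at most the sum of the absolute conjugates of the basis. The added 1 makes the radius positive and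
  the inequality strict, so the set whose infimum is \<beta> is nonempty.\<close>

lemma approximation_radius:
  fixes \<alpha> :: "nat \<Rightarrow> real"
  shows "\<exists>a\<in>\<O>. \<forall>k<d. \<bar>\<alpha> k - \<nu> k a\<bar> < 1 + (\<Sum>k<d. \<Sum>i<d. \<bar>\<nu> k (w i)\<bar>)"
proof -
  obtain C :: "nat \<Rightarrow> nat \<Rightarrow> real" where C: "\<forall>k<d. \<forall>l<d. (\<Sum>i<d. \<nu> k (w i) * C i l) = (if l = k then 1 else 0)"
    by (rule embedding_inverse)
  define c where "c = (\<lambda>i. \<Sum>l<d. C i l * \<alpha> l)"
  define a where "a = (\<Sum>i<d. of_int (floor (c i)) * w i)"
  have "\<bar>\<alpha> k - \<nu> k a\<bar> < 1 + (\<Sum>k<d. \<Sum>i<d. \<bar>\<nu> k (w i)\<bar>)" if k: "k < d" for k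
  proof -
    have "(\<Sum>i<d. c i * \<nu> k (w i)) = (\<Sum>i<d. \<Sum>l<d. \<alpha> l * (\<nu> k (w i) * C i l))"
      unfolding c_def sum_distrib_right by (simp add: mult_ac)
    also have "\<dots> = (\<Sum>l<d. \<alpha> l * (\<Sum>i<d. \<nu> k (w i) * C i l))"
      unfolding sum_distrib_left by (rule sum.swap)
    also have "\<dots> = (\<Sum>l<d. if l = k then \<alpha> l else 0)"
      using C k by (intro sum.cong refl) auto
    also have "\<dots> = \<alpha> k" using k by simp
    finally have "\<alpha> k - \<nu> k a = (\<Sum>i<d. frac (c i) * \<nu> k (w i))"
      using k by (simp add: a_def nu_int_combination frac_def left_diff_distrib sum_subtractf)
    hence "\<bar>\<alpha> k - \<nu> k a\<bar> \<le> (\<Sum>i<d. \<bar>frac (c i) * \<nu> k (w i)\<bar>)" by (metis sum_abs)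
    also have "\<dots> \<le> (\<Sum>i<d. \<bar>\<nu> k (w i)\<bar>)"
      by (intro sum_mono) (auto simp: abs_mult frac_lt_1 less_imp_le intro!: mult_left_le_one_le)
    also have "\<dots> \<le> (\<Sum>k<d. \<Sum>i<d. \<bar>\<nu> k (w i)\<bar>)"
      using k by (intro member_le_sum) (auto intro: sum_nonneg)
    finally show ?thesis by simp
  qed
  moreover have "a \<in> \<O>" unfolding integers a_def by (intro exI[of _ "\<lambda>i. floor (c i)"] refl)
  ultimately show ?thesis by (intro bexI[of _ a]) auto
qed

text \<open>The infimum \<beta> need not itself be an admissible radius, as the definition uses a
  strict inequality. But only finitely many integers come within \<open>Inf S + 1\<close> of the
  target, so a best approximation exists; its error is at most every number above the infimum, hence
  at most the infimum.\<close>

lemma integer_within_beta: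
  fixes \<alpha> :: "nat \<Rightarrow> real"
  shows "\<exists>a\<in>\<O>. \<forall>k<d. \<bar>\<alpha> k - \<nu> k a\<bar> \<le> beta_const TYPE('k)"
proof -
  define S where "S = {r. 0 < r \<and> (\<forall>\<alpha> :: ('k \<Rightarrow> real) \<Rightarrow> real. \<exists>a\<in>\<O>. \<forall>\<nu>\<in>real_embeddings. \<bar>\<alpha> \<nu> - \<nu> a\<bar> < r)}"
  have \<beta>: "beta_const TYPE('k) = Inf S" by (simp add: beta_const_def S_def)
  define r0 where "r0 = 1 + (\<Sum>k<d. \<Sum>i<d. \<bar>\<nu> k (w i)\<bar>)"
  have "0 < r0" unfolding r0_def by (intro add_pos_nonneg sum_nonneg) auto
  hence "r0 \<in> S"
    unfolding S_def ball_embeddings using approximation_radius unfolding r0_def by auto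
  hence ne: "S \<noteq> {}" by auto
  have bdd: "bdd_below S" by (rule bdd_belowI[of _ 0]) (auto simp: S_def)
  define \<gamma> where "\<gamma> = (\<lambda>\<mu>. \<alpha> (the_inv_into {..<d} \<nu> \<mu>))"
  have \<gamma>: "\<gamma> (\<nu> k) = \<alpha> k" if "k < d" for k
    using embeddings that by (simp add: \<gamma>_def bij_betw_def the_inv_into_f_f)
  have ap: "\<exists>a\<in>\<O>. \<forall>k<d. \<bar>\<alpha> k - \<nu> k a\<bar> < Inf S + e" if e: "0 < e" for e
  proof -
    obtain r where r: "r \<in> S" "r < Inf S + e"
      using cInf_lessD[OF ne, of "Inf S + e"] e by auto
    then obtain a where "a \<in> \<O>" "\<forall>\<nu>\<in>real_embeddings. \<bar>\<gamma> \<nu> - \<nu> a\<bar> < r" by (auto simp: S_def)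
    hence "a \<in> \<O>" "\<forall>k<d. \<bar>\<alpha> k - \<nu> k a\<bar> < r" unfolding ball_embeddings by (auto simp: \<gamma>)
    thus ?thesis using r(2) by (intro bexI[of _ a]) (auto intro: less_trans)
  qed
  define ex where "ex = (\<lambda>a. Max ((\<lambda>k. \<bar>\<alpha> k - \<nu> k a\<bar>) ` {..<d}))"
  have ne': "(\<lambda>k. \<bar>\<alpha> k - \<nu> k a\<bar>) ` {..<d} \<noteq> {}" for a using degree_pos by auto
  have ex_less: "ex a < r \<longleftrightarrow> (\<forall>k<d. \<bar>\<alpha> k - \<nu> k a\<bar> < r)" for a r
    unfolding ex_def using ne' by (subst Max_less_iff) auto
  have ex_le: "ex a \<le> r \<longleftrightarrow> (\<forall>k<d. \<bar>\<alpha> k - \<nu> k a\<bar> \<le> r)" for a r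
    unfolding ex_def using ne' by (subst Max_le_iff) auto
  define F where "F = {a \<in> \<O>. ex a < Inf S + 1}"
  have finF: "finite F"
  proof (rule finite_subset[OF _ finite_bounded_integers[of "(\<Sum>k<d. \<bar>\<alpha> k\<bar>) + (Inf S + 1)"]], safe)
    fix a k assume a: "a \<in> F" and k: "k < d"
    have "\<bar>\<alpha> k\<bar> \<le> (\<Sum>k<d. \<bar>\<alpha> k\<bar>)" using k by (intro member_le_sum) auto
    moreover have "\<bar>\<alpha> k - \<nu> k a\<bar> < Inf S + 1" using a k by (simp add: F_def ex_less)
    ultimately show "\<bar>\<nu> k a\<bar> \<le> (\<Sum>k<d. \<bar>\<alpha> k\<bar>) + (Inf S + 1)" by linarith
  qed (auto simp: F_def)
  obtain a1 where a1: "a1 \<in> F" using ap[of 1] by (auto simp: F_def ex_less)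
  obtain a where a: "a \<in> F" "\<And>b. b \<in> F \<Longrightarrow> ex a \<le> ex b"
    using ex_min_if_finite[of "ex ` F"] finF a1
    by (metis (no_types, lifting) arg_min_if_finite(1) arg_min_least empty_iff)
  have "ex a \<le> Inf S + e" if "0 < e" for e
  proof -
    obtain b where b: "b \<in> \<O>" "ex b < Inf S + min e 1" using ap[of "min e 1"] \<open>0 < e\<close> by (auto simp: ex_less)
    hence "b \<in> F" by (auto simp: F_def)
    hence "ex a \<le> ex b" by (rule a(2))
    thus ?thesis using b(2) by linarith
  qed
  hence "ex a \<le> Inf S" by (rule field_le_epsilon)
  thus ?thesis using a(1) unfolding \<beta> ex_le by (auto simp: F_def)
qed

text \<open>Admissibility of l speaks of integral elements. Some positive integer multiple of h is
  integral, and the integer factor cancels from the inequality.\<close>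

lemma balancing_unit:
  assumes l: "admissible_lambda TYPE('k) l" and h: "totally_positive (h :: 'k)"
  shows "\<exists>\<epsilon>. \<epsilon> \<in> \<O> \<and> 1 / \<epsilon> \<in> \<O> \<and> \<epsilon> \<noteq> 0 \<and>
    (\<forall>\<nu>\<in>real_embeddings. \<forall>\<mu>\<in>real_embeddings. \<nu> (\<epsilon>\<^sup>2 * h) \<le> l * \<mu> (\<epsilon>\<^sup>2 * h))"
proof -
  obtain D :: int where D: "0 < D" "of_int D * h \<in> \<O>" using integral_multiple by blast
  define g where "g = of_int D * h"
  have "totally_positive g"
    using h D(1) by (simp add: totally_positive_iff g_def nu_mult nu_of_int)
  then obtain \<epsilon> where e: "\<epsilon> \<in> Units (integer_ring :: 'k ring)"
    "\<forall>\<nu>\<in>real_embeddings. \<forall>\<mu>\<in>real_embeddings. \<nu> (\<epsilon>\<^sup>2 * g) \<le> l * \<mu> (\<epsilon>\<^sup>2 * g)"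
    using l D(2) unfolding admissible_lambda_def g_def by blast
  have eq: "\<nu> i (\<epsilon>\<^sup>2 * g) = of_int D * \<nu> i (\<epsilon>\<^sup>2 * h)" if "i < d" for i
    using that by (simp add: g_def nu_mult nu_of_int mult_ac)
  have "\<nu> i (\<epsilon>\<^sup>2 * h) \<le> l * \<nu> j (\<epsilon>\<^sup>2 * h)" if "i < d" "j < d" for i j
  proof -
    have "of_int D * \<nu> i (\<epsilon>\<^sup>2 * h) \<le> of_int D * (l * \<nu> j (\<epsilon>\<^sup>2 * h))"
      using e(2) that unfolding ball_embeddings by (simp add: eq mult.left_commute)
    thus ?thesis using D(1) by simp
  qed
  thus ?thesis using unit_integers[OF e(1)] unfolding ball_embeddings by blast
qed

end

section \<open>Linear maps and product Lebesgue measure\<close>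

abbreviation lborel_pow :: "'i set \<Rightarrow> ('i \<Rightarrow> real) measure" where
  "lborel_pow I \<equiv> PiM I (\<lambda>_. lborel)"

text \<open>Says that F multiplies volumes by c, in terms of preimages: these are measurable
  whenever F is, and the property composes at once.\<close>

definition scaling_map :: "'i set \<Rightarrow> (('i \<Rightarrow> real) \<Rightarrow> 'i \<Rightarrow> real) \<Rightarrow> real \<Rightarrow> bool" where
  "scaling_map I F c \<longleftrightarrow> 0 < c \<and> F \<in> measurable (lborel_pow I) (lborel_pow I) \<and>
     (\<forall>T\<in>sets (lborel_pow I).
        ennreal c * emeasure (lborel_pow I) (F -` T \<inter> space (lborel_pow I)) = emeasure (lborel_pow I) T)"

lemma scaling_map_id: "scaling_map I (\<lambda>x. x) 1"
proof -
  have "T \<inter> space (lborel_pow I) = T" if "T \<in> sets (lborel_pow I)" for T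
    using sets.sets_into_space[OF that] by auto
  thus ?thesis by (auto simp: scaling_map_def)
qed

lemma scaling_mapD:
  "scaling_map I F c \<Longrightarrow> T \<in> sets (lborel_pow I) \<Longrightarrow>
     ennreal c * emeasure (lborel_pow I) (F -` T \<inter> space (lborel_pow I)) = emeasure (lborel_pow I) T"
  by (simp add: scaling_map_def)

lemma scaling_map_comp:
  assumes F: "scaling_map I F c" and G: "scaling_map I G c'"
  shows "scaling_map I (\<lambda>x. G (F x)) (c' * c)"
  unfolding scaling_map_def
proof (intro conjI ballI)
  have mF: "F \<in> measurable (lborel_pow I) (lborel_pow I)"
    and mG: "G \<in> measurable (lborel_pow I) (lborel_pow I)"
    and pos: "0 < c" "0 < c'" using F G by (auto simp: scaling_map_def)
  show "0 < c' * c" using pos by simp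
  show "(\<lambda>x. G (F x)) \<in> measurable (lborel_pow I) (lborel_pow I)"
    by (rule measurable_compose[OF mF mG])
  fix T assume T: "T \<in> sets (lborel_pow I)"
  let ?M = "lborel_pow I"
  have "(\<lambda>x. G (F x)) -` T \<inter> space ?M = F -` (G -` T \<inter> space ?M) \<inter> space ?M"
    using measurable_space[OF mF] by auto
  hence "ennreal (c' * c) * emeasure ?M ((\<lambda>x. G (F x)) -` T \<inter> space ?M) =
    ennreal c' * (ennreal c * emeasure ?M (F -` (G -` T \<inter> space ?M) \<inter> space ?M))"
    using pos by (simp add: ennreal_mult' mult.assoc)
  also have "ennreal c * emeasure ?M (F -` (G -` T \<inter> space ?M) \<inter> space ?M) = emeasure ?M (G -` T \<inter> space ?M)"
    by (rule scaling_mapD[OF F measurable_sets[OF mG T]])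
  also have "ennreal c' * \<dots> = emeasure ?M T" by (rule scaling_mapD[OF G T])
  finally show "ennreal (c' * c) * emeasure ?M ((\<lambda>x. G (F x)) -` T \<inter> space ?M) = emeasure ?M T" .
qed

text \<open>Integrate over coordinate i first: on each line in that direction the map is an affine
  substitution with slope a, since g does not vary along the line.\<close>

lemma scaling_map_elementary:
  fixes a :: real
  assumes fin: "finite I" and i: "i \<in> I" and a: "a \<noteq> 0"
    and g: "g \<in> borel_measurable (lborel_pow I)" and indep: "\<And>x t. g (x(i := t)) = g x"
  shows "scaling_map I (\<lambda>x. x(i := a * x i + g x)) \<bar>a\<bar>"
  unfolding scaling_map_def
proof (intro conjI ballI)
  let ?F = "\<lambda>x. x(i := a * x i + g x)"
  interpret product_sigma_finite "\<lambda>_ :: 'a. lborel :: real measure" by standard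
  show "0 < \<bar>a\<bar>" using a by simp
  have comp: "(\<lambda>x. x i) \<in> borel_measurable (lborel_pow I)"
    using i measurable_component_singleton[of i I "\<lambda>_. lborel"] by simp
  have "(\<lambda>x. a * x i + g x) \<in> borel_measurable (lborel_pow I)"
    using comp g by measurable
  hence "(\<lambda>x. a * x i + g x) \<in> measurable (lborel_pow I) lborel" by simp
  thus mF: "?F \<in> measurable (lborel_pow I) (lborel_pow I)"
    using i by (intro measurable_fun_upd[where J = I]) auto
  fix T assume T: "T \<in> sets (lborel_pow I)"
  define J where "J = I - {i}"
  have I: "I = insert i J" and J: "finite J" "i \<notin> J" using i fin by (auto simp: J_def)
  have T': "T \<in> sets (lborel_pow (insert i J))" using T I by simp
  have spc: "x(i := y) \<in> space (lborel_pow I)" if "x \<in> space (lborel_pow J)" for x y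
    using that by (auto simp: space_PiM I PiE_def extensional_def)
  have "emeasure (lborel_pow I) (?F -` T \<inter> space (lborel_pow I)) =
        (\<integral>\<^sup>+ x. indicator (?F -` T \<inter> space (lborel_pow I)) x \<partial>lborel_pow I)"
    using measurable_sets[OF mF T] by simp
  also have "\<dots> = (\<integral>\<^sup>+ x. \<integral>\<^sup>+ y. indicator (?F -` T \<inter> space (lborel_pow I)) (x(i := y)) \<partial>lborel \<partial>lborel_pow J)"
    using J measurable_sets[OF mF T] unfolding I by (intro product_nn_integral_insert) (auto simp: I)
  also have "\<dots> = (\<integral>\<^sup>+ x. \<integral>\<^sup>+ y. indicator T (x(i := g x + a * y)) \<partial>lborel \<partial>lborel_pow J)"
    by (intro nn_integral_cong) (auto simp: indicator_def indep spc add.commute)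
  finally have 1: "emeasure (lborel_pow I) (?F -` T \<inter> space (lborel_pow I)) =
    (\<integral>\<^sup>+ x. \<integral>\<^sup>+ y. indicator T (x(i := g x + a * y)) \<partial>lborel \<partial>lborel_pow J)" .
  have m1: "(\<lambda>y. indicator T (x(i := y)) :: ennreal) \<in> borel_measurable borel"
    if "x \<in> space (lborel_pow J)" for x
  proof -
    have "(\<lambda>y. x(i := y)) \<in> measurable lborel (lborel_pow (insert i J))"
      using that by (intro measurable_fun_upd[where J = J]) auto
    from measurable_compose[OF this borel_measurable_indicator[OF T']] show ?thesis by simp
  qed
  have "emeasure (lborel_pow I) T = (\<integral>\<^sup>+ x. indicator T x \<partial>lborel_pow I)" using T by simp
  also have "\<dots> = (\<integral>\<^sup>+ x. \<integral>\<^sup>+ y. indicator T (x(i := y)) \<partial>lborel \<partial>lborel_pow J)"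
    using J T' unfolding I by (intro product_nn_integral_insert) auto
  also have "\<dots> = (\<integral>\<^sup>+ x. ennreal \<bar>a\<bar> * (\<integral>\<^sup>+ y. indicator T (x(i := g x + a * y)) \<partial>lborel) \<partial>lborel_pow J)"
    by (intro nn_integral_cong nn_integral_real_affine[OF m1 a])
  also have "\<dots> = ennreal \<bar>a\<bar> * (\<integral>\<^sup>+ x. \<integral>\<^sup>+ y. indicator T (x(i := g x + a * y)) \<partial>lborel \<partial>lborel_pow J)"
  proof (rule nn_integral_cmult)
    have up: "(\<lambda>(x, y). x(i := y)) \<in> measurable (lborel_pow J \<Otimes>\<^sub>M lborel) (lborel_pow I)"
      unfolding I by (rule measurable_add_dim)
    have gJ: "g \<in> borel_measurable (lborel_pow J)"
    proof -
      have "(\<lambda>x. x(i := 0)) \<in> measurable (lborel_pow J) (lborel_pow I)"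
        unfolding I by (intro measurable_fun_upd[where J = J]) auto
      from measurable_compose[OF this g] show ?thesis by (simp add: indep)
    qed
    have "(\<lambda>p. (fst p, g (fst p) + a * snd p)) \<in> measurable (lborel_pow J \<Otimes>\<^sub>M lborel) (lborel_pow J \<Otimes>\<^sub>M lborel)"
      using gJ by (intro measurable_Pair) auto
    from measurable_compose[OF this measurable_compose[OF up borel_measurable_indicator[OF T]]]
    have "(\<lambda>p. indicator T ((fst p)(i := g (fst p) + a * snd p)) :: ennreal) \<in>
        borel_measurable (lborel_pow J \<Otimes>\<^sub>M lborel)"
      by (simp add: case_prod_beta)
    from lborel.borel_measurable_nn_integral_fst[OF this]
    show "(\<lambda>x. \<integral>\<^sup>+ y. indicator T (x(i := g x + a * y)) \<partial>lborel) \<in> borel_measurable (lborel_pow J)"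
      by simp
  qed
  finally show "ennreal \<bar>a\<bar> * emeasure (lborel_pow I) (?F -` T \<inter> space (lborel_pow I)) = emeasure (lborel_pow I) T"
    by (simp add: 1)
qed

text \<open>The coordinates in S are changed one at a time. The increments see only coordinates
  outside S, so the changes already made do not disturb them.\<close>

lemma scaling_map_shear:
  assumes fin: "finite I" and S: "S \<subseteq> I"
    and g: "\<And>j. j \<in> S \<Longrightarrow> g j \<in> borel_measurable (lborel_pow I)"
    and indep: "\<And>j x y. j \<in> S \<Longrightarrow> (\<And>i. i \<notin> S \<Longrightarrow> x i = y i) \<Longrightarrow> g j x = g j y"
  shows "scaling_map I (\<lambda>x j. if j \<in> S then x j + g j x else x j) 1"
proof -
  have "finite S" using fin S by (rule rev_finite_subset)
  thus ?thesis using S g indep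
  proof (induction rule: finite_induct)
    case empty
    show ?case using scaling_map_id[of I] by simp
  next
    case (insert k S)
    let ?F = "\<lambda>x j. if j \<in> S then x j + g j x else x j"
    have "scaling_map I ?F 1"
    proof (rule insert.IH)
      show "S \<subseteq> I" using insert.prems(1) by simp
      show "g j \<in> borel_measurable (lborel_pow I)" if "j \<in> S" for j
        using that by (intro insert.prems(2)) simp
      fix j and x y :: "'a \<Rightarrow> real" assume j: "j \<in> S" and xy: "\<And>i. i \<notin> S \<Longrightarrow> x i = y i"
      show "g j x = g j y" by (rule insert.prems(3)) (use j xy in simp_all)
    qed
    moreover have "scaling_map I (\<lambda>x. x(k := 1 * x k + g k x)) \<bar>1\<bar>"
    proof (rule scaling_map_elementary[OF fin])
      fix x :: "'a \<Rightarrow> real" and t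
      show "g k (x(k := t)) = g k x" by (rule insert.prems(3)) auto
      show "k \<in> I" using insert.prems(1) by simp
      show "g k \<in> borel_measurable (lborel_pow I)" by (rule insert.prems(2)) simp
    qed simp
    ultimately have "scaling_map I (\<lambda>x. (?F x)(k := 1 * ?F x k + g k (?F x))) (\<bar>1\<bar> * 1)"
      by (rule scaling_map_comp)
    moreover have "g k (?F x) = g k x" for x by (rule insert.prems(3)) auto
    hence "(\<lambda>x. (?F x)(k := 1 * ?F x k + g k (?F x))) = (\<lambda>x j. if j \<in> insert k S then x j + g j x else x j)"
      using insert.hyps by (auto simp: fun_eq_iff)
    ultimately show ?case by simp
  qed
qed

section \<open>Matrices acting on blocks of coordinates\<close>

definition block_linear :: "(nat \<Rightarrow> 'i) \<Rightarrow> nat \<Rightarrow> (nat \<Rightarrow> nat \<Rightarrow> real) \<Rightarrow> ('i \<Rightarrow> real) \<Rightarrow> 'i \<Rightarrow> real" where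
  "block_linear e n A x j = (if j \<in> e ` {..<n} then \<Sum>l<n. A (the_inv_into {..<n} e j) l * x (e l) else x j)"

lemma block_linear_in:
  "inj_on e {..<n} \<Longrightarrow> i < n \<Longrightarrow> block_linear e n A x (e i) = (\<Sum>l<n. A i l * x (e l))"
  by (simp add: block_linear_def the_inv_into_f_f)

lemma block_linear_out: "j \<notin> e ` {..<n} \<Longrightarrow> block_linear e n A x j = x j"
  by (simp add: block_linear_def)

lemma component_measurable:
  "j \<in> I \<Longrightarrow> (\<lambda>x. x j) \<in> borel_measurable (lborel_pow I)"
  using measurable_component_singleton[of j I "\<lambda>_. lborel"] by simp

text \<open>One step of Gaussian elimination: the matrix is a unipotent lower triangular factor
  times a matrix whose first column vanishes below the pivot.\<close>

lemma det_schur: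
  fixes A :: "nat \<Rightarrow> nat \<Rightarrow> 'a::field"
  assumes "A 0 0 \<noteq> 0"
  shows "Determinant.det (mat (Suc n) (Suc n) (\<lambda>(i, j). A i j)) =
    A 0 0 * Determinant.det (mat n n (\<lambda>(i, j). A (Suc i) (Suc j) - A (Suc i) 0 * A 0 (Suc j) / A 0 0))"
proof -
  define L where "L = mat (Suc n) (Suc n) (\<lambda>(i, j). if i = j then 1 else if j = 0 then A i 0 / A 0 0 else 0)"
  define B where "B = mat (Suc n) (Suc n) (\<lambda>(i, j). if i = 0 then A 0 j else A i j - A i 0 * A 0 j / A 0 0)"
  have "mat (Suc n) (Suc n) (\<lambda>(i, j). A i j) = L * B"
  proof (rule eq_matI)
    fix i j assume "i < dim_row (L * B)" "j < dim_col (L * B)"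
    hence ij: "i < Suc n" "j < Suc n" by (auto simp: L_def B_def)
    have "(L * B) $$ (i, j) = (\<Sum>k<Suc n. L $$ (i, k) * B $$ (k, j))"
      using ij by (simp add: L_def B_def scalar_prod_def atLeast0LessThan del: sum.lessThan_Suc)
    also have "\<dots> = (\<Sum>k<Suc n. (if k = i then B $$ (i, j) else 0) + (if k = 0 then (if i = 0 then 0 else A i 0 / A 0 0 * B $$ (0, j)) else 0))"
      using ij by (intro sum.cong) (auto simp: L_def)
    also have "\<dots> = B $$ (i, j) + (if i = 0 then 0 else A i 0 / A 0 0 * B $$ (0, j))"
      using ij by (simp add: sum.distrib del: sum.lessThan_Suc)
    also have "\<dots> = A i j" using ij assms by (auto simp: B_def)
    finally show "mat (Suc n) (Suc n) (\<lambda>(i, j). A i j) $$ (i, j) = (L * B) $$ (i, j)"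
      using ij by simp
  qed (auto simp: L_def B_def)
  hence "Determinant.det (mat (Suc n) (Suc n) (\<lambda>(i, j). A i j)) = Determinant.det L * Determinant.det B"
    using det_mult[of L "Suc n" B] by (simp add: L_def B_def)
  also have "Determinant.det L = prod_list (diag_mat L)"
    by (rule det_lower_triangular[of "Suc n"]) (auto simp: L_def)
  also have "diag_mat L = map (\<lambda>_. 1) [0..<Suc n]"
    by (intro nth_equalityI) (auto simp: diag_mat_def L_def simp del: upt_Suc)
  also have "prod_list \<dots> = (1 :: 'a)" by (simp add: map_replicate_const prod_list_replicate del: upt_Suc)
  also have "Determinant.det B = (\<Sum>i<Suc n. B $$ (i, 0) * cofactor B i 0)"
    by (rule laplace_expansion_column) (auto simp: B_def)
  also have "\<dots> = (\<Sum>i<Suc n. if i = 0 then A 0 0 * cofactor B 0 0 else 0)"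
    using assms by (intro sum.cong) (auto simp: B_def)
  also have "\<dots> = A 0 0 * cofactor B 0 0" by (simp del: sum.lessThan_Suc)
  also have "cofactor B 0 0 = Determinant.det (mat n n (\<lambda>(i, j). A (Suc i) (Suc j) - A (Suc i) 0 * A 0 (Suc j) / A 0 0))"
    unfolding cofactor_def by (simp add: mat_delete_def B_def) (intro arg_cong[of _ _ Determinant.det] eq_matI, auto)
  finally show ?thesis by simp
qed

text \<open>The block is a composite of three maps: the first row acts on coordinate
  \<open>e 0\<close>, the Schur complement acts on the other coordinates of the block, and a shear
  adds multiples of the new coordinate \<open>e 0\<close> to these. The new coordinate already
  contains the whole first row, so the shear restores both the first column and what the Schur
  complement had subtracted. Volume changes only in the first two maps.\<close>

lemma scaling_map_block_linear_pivot:
  fixes A :: "nat \<Rightarrow> nat \<Rightarrow> real" and e :: "nat \<Rightarrow> 'i"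
  assumes fin: "finite I" and inj: "inj_on e {..<Suc n}" and sub: "e ` {..<Suc n} \<subseteq> I" and piv: "A 0 0 \<noteq> 0"
    and IH: "scaling_map I (block_linear (\<lambda>i. e (Suc i)) n
        (\<lambda>i j. A (Suc i) (Suc j) - A (Suc i) 0 * A 0 (Suc j) / A 0 0)) c"
  shows "scaling_map I (block_linear e (Suc n) A) (\<bar>A 0 0\<bar> * c)"
proof -
  define e' where "e' = (\<lambda>i. e (Suc i))"
  have inj': "inj_on e' {..<n}" using inj by (auto simp: inj_on_def e'_def)
  have e0: "e 0 \<notin> e' ` {..<n}" using inj by (auto simp: inj_on_def e'_def)
  have e0': "e' l \<noteq> e 0" if "l < n" for l using e0 that by (metis imageI lessThan_iff)
  have im: "e ` {..<Suc n} = insert (e 0) (e' ` {..<n})"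
    by (auto simp: e'_def lessThan_Suc_eq_insert_0 image_image)
  define S where "S = (\<lambda>i j. A (Suc i) (Suc j) - A (Suc i) 0 * A 0 (Suc j) / A 0 0)"
  define F1 where "F1 = (\<lambda>x :: 'i \<Rightarrow> real. x(e 0 := A 0 0 * x (e 0) + (\<Sum>l<n. A 0 (Suc l) * x (e' l))))"
  define F2 where "F2 = block_linear e' n S"
  define F3 where "F3 = (\<lambda>(x :: 'i \<Rightarrow> real) j. if j \<in> e' ` {..<n} then x j + A (Suc (the_inv_into {..<n} e' j)) 0 / A 0 0 * x (e 0) else x j)"
  have 1: "scaling_map I F1 \<bar>A 0 0\<bar>"
    unfolding F1_def
  proof (rule scaling_map_elementary[OF fin _ piv])
    show "e 0 \<in> I" using sub im by auto
    show "(\<lambda>x. \<Sum>l<n. A 0 (Suc l) * x (e' l)) \<in> borel_measurable (lborel_pow I)"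
      using sub by (intro borel_measurable_sum borel_measurable_times component_measurable) (auto simp: im)
    show "(\<Sum>l<n. A 0 (Suc l) * (x(e 0 := t)) (e' l)) = (\<Sum>l<n. A 0 (Suc l) * x (e' l))" for x t
      using e0' by (intro sum.cong) auto
  qed
  have 2: "scaling_map I F2 c" using IH by (simp add: F2_def S_def e'_def)
  have 3: "scaling_map I F3 1"
    unfolding F3_def
  proof (rule scaling_map_shear[OF fin])
    show "e' ` {..<n} \<subseteq> I" using sub im by auto
    show "(\<lambda>x. A (Suc (the_inv_into {..<n} e' j)) 0 / A 0 0 * x (e 0)) \<in> borel_measurable (lborel_pow I)" for j
      using sub by (intro borel_measurable_times component_measurable) (auto simp: im)
    fix j and x y :: "'i \<Rightarrow> real" assume "\<And>i. i \<notin> e' ` {..<n} \<Longrightarrow> x i = y i"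
    thus "A (Suc (the_inv_into {..<n} e' j)) 0 / A 0 0 * x (e 0) = A (Suc (the_inv_into {..<n} e' j)) 0 / A 0 0 * y (e 0)"
      using e0 by simp
  qed
  have "scaling_map I (\<lambda>x. F3 (F2 (F1 x))) (1 * (c * \<bar>A 0 0\<bar>))"
    by (rule scaling_map_comp[OF scaling_map_comp[OF 1 2] 3])
  also have "(\<lambda>x. F3 (F2 (F1 x))) = block_linear e (Suc n) A"
  proof (intro ext)
    fix x :: "'i \<Rightarrow> real" and j
    have sum: "(\<Sum>l<Suc n. A i l * x (e l)) = A i 0 * x (e 0) + (\<Sum>l<n. A i (Suc l) * x (e' l))" for i
      by (simp add: sum.lessThan_Suc_shift e'_def del: sum.lessThan_Suc)
    have F1e: "F1 x (e' l) = x (e' l)" if "l < n" for l using e0' that by (auto simp: F1_def)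
    consider "j = e 0" | i where "j = e' i" "i < n" | "j \<notin> e ` {..<Suc n}" using im by auto
    thus "F3 (F2 (F1 x)) j = block_linear e (Suc n) A x j"
    proof cases
      case 1
      have "F3 (F2 (F1 x)) (e 0) = F1 x (e 0)" using e0 by (simp add: F3_def F2_def block_linear_out)
      also have "\<dots> = A 0 0 * x (e 0) + (\<Sum>l<n. A 0 (Suc l) * x (e' l))" by (simp add: F1_def)
      also have "\<dots> = block_linear e (Suc n) A x (e 0)" by (simp add: block_linear_in[OF inj] sum del: sum.lessThan_Suc)
      finally show ?thesis using 1 by simp
    next
      case (2 i)
      have a: "F2 (F1 x) (e 0) = A 0 0 * x (e 0) + (\<Sum>l<n. A 0 (Suc l) * x (e' l))"
        using e0 by (simp add: F2_def block_linear_out F1_def)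
      have b: "F2 (F1 x) (e' i) = (\<Sum>l<n. S i l * x (e' l))"
        using 2 by (simp add: F2_def block_linear_in[OF inj'] F1e)
      have "F3 (F2 (F1 x)) (e' i) = (\<Sum>l<n. S i l * x (e' l)) + A (Suc i) 0 / A 0 0 * (A 0 0 * x (e 0) + (\<Sum>l<n. A 0 (Suc l) * x (e' l)))"
        using 2 inj' by (simp add: F3_def a b the_inv_into_f_f)
      also have "\<dots> = A (Suc i) 0 * x (e 0) + (\<Sum>l<n. S i l * x (e' l) + A (Suc i) 0 / A 0 0 * (A 0 (Suc l) * x (e' l)))"
        using piv by (simp add: sum.distrib sum_distrib_left distrib_left)
      also have "(\<Sum>l<n. S i l * x (e' l) + A (Suc i) 0 / A 0 0 * (A 0 (Suc l) * x (e' l))) = (\<Sum>l<n. A (Suc i) (Suc l) * x (e' l))"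
        by (intro sum.cong refl) (simp add: S_def algebra_simps)
      also have "A (Suc i) 0 * x (e 0) + \<dots> = block_linear e (Suc n) A x (e (Suc i))"
        using 2 by (simp add: block_linear_in[OF inj] sum del: sum.lessThan_Suc)
      finally show ?thesis using 2 by (simp add: e'_def)
    next
      case 3
      hence "j \<noteq> e 0" "j \<notin> e' ` {..<n}" using im by auto
      thus ?thesis using 3 by (simp add: F3_def F2_def F1_def block_linear_out)
    qed
  qed
  finally show ?thesis by (simp add: mult.commute)
qed

lemma scaling_map_block_linear:
  fixes A :: "nat \<Rightarrow> nat \<Rightarrow> real" and e :: "nat \<Rightarrow> 'i"
  assumes "finite I" "inj_on e {..<n}" "e ` {..<n} \<subseteq> I" "Determinant.det (mat n n (\<lambda>(i, j). A i j)) \<noteq> 0"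
  shows "scaling_map I (block_linear e n A) \<bar>Determinant.det (mat n n (\<lambda>(i, j). A i j))\<bar>"
  using assms
proof (induction n arbitrary: A e)
  case 0
  have "block_linear e 0 A = (\<lambda>x. x)" by (simp add: block_linear_def fun_eq_iff)
  thus ?case using scaling_map_id by simp
next
  case (Suc n)
  have piv: "scaling_map I (block_linear e (Suc n) B) \<bar>Determinant.det (mat (Suc n) (Suc n) (\<lambda>(i, j). B i j))\<bar>"
    if B: "B 0 0 \<noteq> 0" "Determinant.det (mat (Suc n) (Suc n) (\<lambda>(i, j). B i j)) \<noteq> 0" for B
  proof -
    have "scaling_map I (block_linear (\<lambda>i. e (Suc i)) n (\<lambda>i j. B (Suc i) (Suc j) - B (Suc i) 0 * B 0 (Suc j) / B 0 0))
        \<bar>Determinant.det (mat n n (\<lambda>(i, j). B (Suc i) (Suc j) - B (Suc i) 0 * B 0 (Suc j) / B 0 0))\<bar>"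
    proof (rule Suc.IH[OF Suc.prems(1)])
      show "inj_on (\<lambda>i. e (Suc i)) {..<n}" using Suc.prems(2) by (auto simp: inj_on_def)
      show "(\<lambda>i. e (Suc i)) ` {..<n} \<subseteq> I" using Suc.prems(3) by auto
      show "Determinant.det (mat n n (\<lambda>(i, j). B (Suc i) (Suc j) - B (Suc i) 0 * B 0 (Suc j) / B 0 0)) \<noteq> 0"
        using B(2) unfolding det_schur[of B, OF B(1)] by simp
    qed
    from scaling_map_block_linear_pivot[where A = B, OF Suc.prems(1,2,3) B(1) this]
    show ?thesis unfolding det_schur[of B, OF B(1)] abs_mult .
  qed
  show ?case
  proof (cases "A 0 0 = 0")
    case False
    thus ?thesis using piv[of A] Suc.prems by blast
  next
    case True
    define D where "D = mat (Suc n) (Suc n) (\<lambda>(i, j). A i j)"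
    have D: "D \<in> carrier_mat (Suc n) (Suc n)" by (simp add: D_def)
    have "\<exists>i<Suc n. A i 0 \<noteq> 0"
    proof (rule ccontr)
      assume "\<not> (\<exists>i<Suc n. A i 0 \<noteq> 0)"
      hence "D $$ (i, 0) = 0" if "i < Suc n" for i using that by (simp add: D_def)
      hence "Determinant.det D = 0"
        using laplace_expansion_column[OF D, of 0] by (simp del: sum.lessThan_Suc)
      thus False using Suc.prems(4) by (simp add: D_def)
    qed
    then obtain i where i: "i < Suc n" "A i 0 \<noteq> 0" by blast
    have i0: "i \<noteq> 0" using i(2) True by (metis)
    \<comment> \<open>Adding row i to row 0 yields a nonzero pivot and keeps the determinant;
      afterwards a shear subtracts coordinate \<open>e i\<close> from coordinate \<open>e 0\<close>
      and recovers A.\<close>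
    define B where "B = (\<lambda>k j. if k = 0 then A 0 j + A i j else A k j)"
    have "mat (Suc n) (Suc n) (\<lambda>(i, j). B i j) = addrow 1 0 i D"
      using i by (intro eq_matI) (auto simp: D_def B_def mat_addrow_def)
    hence det: "Determinant.det (mat (Suc n) (Suc n) (\<lambda>(i, j). B i j)) = Determinant.det D"
      using det_addrow[of i "Suc n" 0 D 1] i i0 D by simp
    have "scaling_map I (block_linear e (Suc n) B) \<bar>Determinant.det D\<bar>"
      using piv[of B] True i det Suc.prems(4) by (simp add: B_def D_def)
    moreover have ei: "e i \<noteq> e 0" using Suc.prems(2) i i0 by (auto simp: inj_on_def)
    have "scaling_map I (\<lambda>x. x(e 0 := 1 * x (e 0) + (- x (e i)))) \<bar>1\<bar>"
    proof (rule scaling_map_elementary[OF Suc.prems(1)])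
      show "e 0 \<in> I" using Suc.prems(3) by auto
      show "(\<lambda>x. - x (e i)) \<in> borel_measurable (lborel_pow I)"
        using Suc.prems(3) i by (intro borel_measurable_uminus component_measurable) auto
      show "- (x(e 0 := t)) (e i) = - x (e i)" for x t using ei by simp
    qed simp
    ultimately have "scaling_map I (\<lambda>x. (block_linear e (Suc n) B x)(e 0 := 1 * block_linear e (Suc n) B x (e 0) + (- block_linear e (Suc n) B x (e i)))) (\<bar>1\<bar> * \<bar>Determinant.det D\<bar>)"
      by (rule scaling_map_comp)
    also have "(\<lambda>x. (block_linear e (Suc n) B x)(e 0 := 1 * block_linear e (Suc n) B x (e 0) + (- block_linear e (Suc n) B x (e i)))) = block_linear e (Suc n) A"
    proof (intro ext)
      fix x :: "'i \<Rightarrow> real" and j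
      consider "j = e 0" | k where "j = e k" "k < Suc n" "k \<noteq> 0" | "j \<notin> e ` {..<Suc n}" by force
      thus "((block_linear e (Suc n) B x)(e 0 := 1 * block_linear e (Suc n) B x (e 0) + (- block_linear e (Suc n) B x (e i)))) j = block_linear e (Suc n) A x j"
      proof cases
        case 1
        thus ?thesis using i i0
          by (simp add: block_linear_in[OF Suc.prems(2)] B_def distrib_right sum.distrib del: sum.lessThan_Suc)
      next
        case (2 k)
        hence "e k \<noteq> e 0" using Suc.prems(2) by (auto simp: inj_on_def)
        thus ?thesis using 2 by (simp add: block_linear_in[OF Suc.prems(2)] B_def del: sum.lessThan_Suc)
      next
        case 3
        hence "j \<noteq> e 0" by auto
        thus ?thesis using 3 by (simp add: block_linear_out)
      qed
    qed
    finally show ?thesis by (simp add: D_def)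
  qed
qed

section \<open>Packing and volumes\<close>

text \<open>Cut each translate of T by a point of X along the integer grid and move every piece into
  the unit cube. By hypothesis the pieces stay disjoint there, so the total volume is at most 1. For
  a single point this is Blichfeldt's principle; for several points it counts translates that are
  disjoint modulo the integers.\<close>

lemma packing_bound:
  fixes T :: "('i \<Rightarrow> real) set" and X :: "('i \<Rightarrow> real) set"
  assumes fin: "finite I" and T: "T \<in> sets (lborel_pow I)" and X: "finite X"
    and disj: "\<And>x y s t. x \<in> X \<Longrightarrow> y \<in> X \<Longrightarrow> s \<in> T \<Longrightarrow> t \<in> T \<Longrightarrow>
      (\<forall>j\<in>I. (x j + s j) - (y j + t j) \<in> \<int>) \<Longrightarrow> x = y \<and> s = t"
  shows "of_nat (card X) * emeasure (lborel_pow I) T \<le> 1"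
proof -
  let ?M = "lborel_pow I"
  interpret product_sigma_finite "\<lambda>_ :: 'i. lborel :: real measure" by standard
  define C where "C = PiE I (\<lambda>_. {0..<1::real})"
  define Z where "Z = PiE I (\<lambda>_. UNIV :: int set)"
  have Z: "countable Z" unfolding Z_def by (intro countable_PiE fin) auto
  have Cm: "C \<in> sets ?M" unfolding C_def using fin by (intro sets_PiM_I_finite) auto
  have vol_C: "emeasure ?M C = 1" unfolding C_def using fin by (subst emeasure_PiM) auto
  \<comment> \<open>\<open>sh x z\<close> carries a point u of the unit cube to u + z - x, whose
    translate by x lies in the grid cell of z. Its preimages thus move the pieces of T back into the
    cube without changing their volume.\<close>
  define sh where "sh = (\<lambda>x z (u :: 'i \<Rightarrow> real) j. if j \<in> I then u j + (of_int (z j) - x j) else u j)"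
  have sh: "scaling_map I (sh x z) 1" for x :: "'i \<Rightarrow> real" and z :: "'i \<Rightarrow> int"
    unfolding sh_def by (rule scaling_map_shear[OF fin order_refl]) auto
  define cell where "cell = (\<lambda>x (z :: 'i \<Rightarrow> int). {t \<in> space ?M. \<forall>j\<in>I. of_int (z j) \<le> t j + x j \<and> t j + x j < of_int (z j) + 1})"
  have cell: "cell x z \<in> sets ?M" for x z
    unfolding cell_def
  proof (rule sets.sets_Collect_finite_All[OF _ fin])
    fix j assume "j \<in> I"
    hence "(\<lambda>t. t j) \<in> borel_measurable ?M" by (rule component_measurable)
    thus "{t \<in> space ?M. real_of_int (z j) \<le> t j + x j \<and> t j + x j < real_of_int (z j) + 1} \<in> sets ?M"
      by measurable
  qed
  define D where "D = (\<lambda>x z. sh x z -` (T \<inter> cell x z) \<inter> space ?M)"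
  have Dm: "D x z \<in> sets ?M" for x z
    unfolding D_def using sh[of x z] T cell by (intro measurable_sets[of _ _ ?M]) (auto simp: scaling_map_def)
  have D_emeasure: "emeasure ?M (D x z) = emeasure ?M (T \<inter> cell x z)" for x z
    using scaling_mapD[OF sh[of x z] sets.Int[OF T cell[of x z]]] by (simp add: D_def)
  have D_sub: "D x z \<subseteq> C" for x z
  proof
    fix u assume u: "u \<in> D x z"
    hence "sh x z u \<in> cell x z" "u \<in> space ?M" by (auto simp: D_def)
    hence "0 \<le> u j \<and> u j < 1" if "j \<in> I" for j using that by (auto simp: cell_def sh_def)
    thus "u \<in> C" using \<open>u \<in> space ?M\<close> by (auto simp: C_def space_PiM PiE_def)
  qed
  have D_disj: "x = y \<and> z = z'" if "u \<in> D x z" "u \<in> D y z'" "x \<in> X" "y \<in> X" "z \<in> Z" "z' \<in> Z" for u x y z z'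
  proof -
    have "sh x z u \<in> T" "sh y z' u \<in> T" using that by (auto simp: D_def)
    moreover have "\<forall>j\<in>I. (x j + sh x z u j) - (y j + sh y z' u j) \<in> \<int>"
    proof
      fix j assume "j \<in> I"
      hence "(x j + sh x z u j) - (y j + sh y z' u j) = of_int (z j - z' j)" by (simp add: sh_def)
      thus "(x j + sh x z u j) - (y j + sh y z' u j) \<in> \<int>" by (metis Ints_of_int)
    qed
    ultimately have eq: "x = y" "sh x z u = sh y z' u" using disj that(3,4) by blast+
    have "z j = z' j" if "j \<in> I" for j using fun_cong[OF eq(2), of j] that by (simp add: sh_def eq(1))
    hence "z = z'" using \<open>z \<in> Z\<close> \<open>z' \<in> Z\<close> unfolding Z_def by (intro PiE_ext) auto
    with eq(1) show ?thesis by simp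
  qed
  define E where "E = (\<lambda>x. \<Union>z\<in>Z. D x z)"
  have Em: "E x \<in> sets ?M" for x unfolding E_def using Z Dm by (intro sets.countable_UN'') auto
  have vol_E: "emeasure ?M (E x) = emeasure ?M T" if x: "x \<in> X" for x
  proof -
    have "emeasure ?M (E x) = (\<integral>\<^sup>+ z. emeasure ?M (D x z) \<partial>count_space Z)"
      unfolding E_def
    proof (rule emeasure_UN_countable[OF _ Z])
      show "disjoint_family_on (D x) Z" unfolding disjoint_family_on_def using D_disj x by blast
    qed (use Dm in auto)
    also have "\<dots> = (\<integral>\<^sup>+ z. emeasure ?M (T \<inter> cell x z) \<partial>count_space Z)" by (simp add: D_emeasure)
    also have "\<dots> = emeasure ?M (\<Union>z\<in>Z. T \<inter> cell x z)"
    proof (rule emeasure_UN_countable[OF _ Z, symmetric])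
      show "disjoint_family_on (\<lambda>z. T \<inter> cell x z) Z"
      proof (unfold disjoint_family_on_def, safe, goal_cases)
        case (1 z z' t)
        have "z j = z' j" if "j \<in> I" for j
        proof -
          have "of_int (z j) \<le> t j + x j" "t j + x j < of_int (z j) + 1" "of_int (z' j) \<le> t j + x j" "t j + x j < of_int (z' j) + 1"
            using 1 that by (auto simp: cell_def)
          thus ?thesis by linarith
        qed
        hence "z = z'" using 1(1,2) unfolding Z_def by (intro PiE_ext) auto
        thus ?case using 1 by simp
      qed
    qed (use T cell in auto)
    also have "(\<Union>z\<in>Z. T \<inter> cell x z) = T"
    proof (intro equalityI subsetI)
      fix t assume t: "t \<in> T"
      define z where "z = restrict (\<lambda>j. floor (t j + x j)) I"
      have "z \<in> Z" by (auto simp: Z_def z_def)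
      moreover have "t \<in> cell x z" using t sets.sets_into_space[OF T] by (auto simp: cell_def z_def)
      ultimately show "t \<in> (\<Union>z\<in>Z. T \<inter> cell x z)" using t by blast
    qed auto
    finally show ?thesis .
  qed
  have "of_nat (card X) * emeasure ?M T = (\<Sum>x\<in>X. emeasure ?M (E x))" by (simp add: vol_E)
  also have "\<dots> = emeasure ?M (\<Union>x\<in>X. E x)"
  proof (rule sum_emeasure[OF _ _ X])
    show "disjoint_family_on E X" unfolding disjoint_family_on_def E_def using D_disj by blast
  qed (use Em in auto)
  also have "\<dots> \<le> emeasure ?M C" using D_sub Cm by (intro emeasure_mono) (auto simp: E_def)
  finally show ?thesis by (simp add: vol_C)
qed

section \<open>Volumes of products of balls and of cross-polytopes\<close>

lemma emeasure_ball_power: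
  fixes r :: real
  assumes r: "0 < r"
  shows "emeasure (lborel_pow ({..<k::nat} \<times> {..<m::nat}))
      ({x. \<forall>i<m. sqrt (\<Sum>a<k. (x (a, i))\<^sup>2) \<le> r} \<inter> space (lborel_pow ({..<k} \<times> {..<m}))) =
    ennreal ((unit_ball_vol (real k) * r ^ k) ^ m)"
proof (induction m)
  case 0
  show ?case by (simp add: PiM_empty)
next
  case (Suc m)
  interpret product_sigma_finite "\<lambda>_ :: nat \<times> nat. lborel :: real measure" by standard
  \<comment> \<open>The pairs with second component m carry the new ball, the other pairs the m
    balls of the induction hypothesis.\<close>
  define A where "A = {..<k} \<times> {..<m}"
  define B where "B = {..<k} \<times> {m}"
  have AB: "{..<k} \<times> {..<Suc m} = A \<union> B" "A \<inter> B = {}" "finite A" "finite B" by (auto simp: A_def B_def)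
  define SA where "SA = {x :: nat \<times> nat \<Rightarrow> real. \<forall>i<m. sqrt (\<Sum>a<k. (x (a, i))\<^sup>2) \<le> r} \<inter> space (lborel_pow A)"
  define SB where "SB = {x. sqrt (\<Sum>p\<in>B. (x p)\<^sup>2) \<le> r} \<inter> space (lborel_pow B)"
  define S where "S = {x. \<forall>i<Suc m. sqrt (\<Sum>a<k. (x (a, i))\<^sup>2) \<le> r} \<inter> space (lborel_pow (A \<union> B))"
  have sum_B: "(\<Sum>p\<in>B. (x p)\<^sup>2) = (\<Sum>a<k. (x (a, m))\<^sup>2)" for x :: "nat \<times> nat \<Rightarrow> real"
  proof -
    have "B = (\<lambda>a. (a, m)) ` {..<k}" by (auto simp: B_def)
    thus ?thesis by (simp add: sum.reindex inj_on_def)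
  qed
  have row: "(\<lambda>x. sqrt (\<Sum>a<k. (x (a, i))\<^sup>2)) \<in> borel_measurable (lborel_pow J)"
    if "{..<k} \<times> {i} \<subseteq> J" for i and J :: "(nat \<times> nat) set"
    using that
    by (intro measurable_compose[OF _ borel_measurable_sqrt] borel_measurable_sum borel_measurable_power component_measurable) auto
  have meas: "{x. \<forall>i<q. sqrt (\<Sum>a<k. (x (a, i))\<^sup>2) \<le> r} \<inter> space (lborel_pow J) \<in> sets (lborel_pow J)"
    if J: "{..<k} \<times> {..<q} \<subseteq> J" for q and J :: "(nat \<times> nat) set"
  proof -
    have "{x. \<forall>i<q. sqrt (\<Sum>a<k. (x (a, i))\<^sup>2) \<le> r} \<inter> space (lborel_pow J) =
      {x \<in> space (lborel_pow J). \<forall>i\<in>{..<q}. sqrt (\<Sum>a<k. (x (a, i))\<^sup>2) \<le> r}" by auto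
    also have "\<dots> \<in> sets (lborel_pow J)"
    proof (rule sets.sets_Collect_finite_All)
      fix i assume "i \<in> {..<q}"
      hence "(\<lambda>x. sqrt (\<Sum>a<k. (x (a, i))\<^sup>2)) \<in> borel_measurable (lborel_pow J)"
        using J by (intro row) auto
      thus "{x \<in> space (lborel_pow J). sqrt (\<Sum>a<k. (x (a, i))\<^sup>2) \<le> r} \<in> sets (lborel_pow J)"
        by measurable
    qed simp
    finally show ?thesis .
  qed
  have mS: "S \<in> sets (lborel_pow (A \<union> B))" unfolding S_def by (rule meas) (auto simp: A_def B_def)
  have mA: "SA \<in> sets (lborel_pow A)" unfolding SA_def by (rule meas) (auto simp: A_def)
  have mB: "SB \<in> sets (lborel_pow B)"
  proof -
    have "(\<lambda>x. sqrt (\<Sum>p\<in>B. (x p)\<^sup>2)) \<in> borel_measurable (lborel_pow B)"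
      by (intro measurable_compose[OF _ borel_measurable_sqrt] borel_measurable_sum borel_measurable_power component_measurable) auto
    hence "{x \<in> space (lborel_pow B). sqrt (\<Sum>p\<in>B. (x p)\<^sup>2) \<le> r} \<in> sets (lborel_pow B)" by measurable
    moreover have "SB = {x \<in> space (lborel_pow B). sqrt (\<Sum>p\<in>B. (x p)\<^sup>2) \<le> r}" by (auto simp: SB_def)
    ultimately show ?thesis by simp
  qed
  have "emeasure (lborel_pow (A \<union> B)) S = (\<integral>\<^sup>+ x. indicator S x \<partial>lborel_pow (A \<union> B))" using mS by simp
  also have "\<dots> = (\<integral>\<^sup>+ x. \<integral>\<^sup>+ y. indicator S (merge A B (x, y)) \<partial>lborel_pow B \<partial>lborel_pow A)"
    using AB mS by (intro product_nn_integral_fold) auto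
  also have "\<dots> = (\<integral>\<^sup>+ x. \<integral>\<^sup>+ y. indicator SA x * indicator SB y \<partial>lborel_pow B \<partial>lborel_pow A)"
  proof (intro nn_integral_cong)
    fix x y :: "nat \<times> nat \<Rightarrow> real"
    assume xy: "x \<in> space (lborel_pow A)" "y \<in> space (lborel_pow B)"
    have sp: "merge A B (x, y) \<in> space (lborel_pow (A \<union> B))"
      using xy by (auto simp: space_PiM PiE_def extensional_def merge_def)
    have a: "(\<Sum>a<k. (merge A B (x, y) (a, i))\<^sup>2) = (\<Sum>a<k. (x (a, i))\<^sup>2)" if "i < m" for i
      using that by (intro sum.cong) (auto simp: merge_def A_def)
    have b: "(\<Sum>a<k. (merge A B (x, y) (a, m))\<^sup>2) = (\<Sum>a<k. (y (a, m))\<^sup>2)"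
      by (intro sum.cong) (auto simp: merge_def A_def B_def)
    have "merge A B (x, y) \<in> S \<longleftrightarrow> x \<in> SA \<and> y \<in> SB"
      using sp xy by (auto simp: S_def SA_def SB_def sum_B a b less_Suc_eq)
    thus "indicator S (merge A B (x, y)) = indicator SA x * (indicator SB y :: ennreal)"
      by (auto simp: indicator_def)
  qed
  also have "\<dots> = emeasure (lborel_pow A) SA * emeasure (lborel_pow B) SB"
    using mA mB by (simp add: nn_integral_cmult nn_integral_multc)
  also have "emeasure (lborel_pow A) SA = ennreal ((unit_ball_vol (real k) * r ^ k) ^ m)"
    using Suc.IH by (simp add: SA_def A_def)
  also have "emeasure (lborel_pow B) SB = ennreal (unit_ball_vol (real (card B)) * r ^ card B)"
    unfolding SB_def using AB(4) r by (rule emeasure_cball_aux)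
  also have "card B = k" by (simp add: B_def)
  finally have "emeasure (lborel_pow (A \<union> B)) S = ennreal ((unit_ball_vol (real k) * r ^ k) ^ m) * ennreal (unit_ball_vol (real k) * r ^ k)" .
  also have "\<dots> = ennreal ((unit_ball_vol (real k) * r ^ k) ^ Suc m)"
    using r unit_ball_vol_nonneg[of k] by (subst ennreal_mult'[symmetric]) (auto simp: mult.commute)
  finally show ?case unfolding S_def AB(1) .
qed

text \<open>The slice at value y of the new coordinate is a cross-polytope of radius t - |y|, empty
  when |y| exceeds t, so the volume is an integral of a power.\<close>

lemma emeasure_cross_polytope:
  fixes t :: real
  assumes "finite A" "0 \<le> t"
  shows "emeasure (lborel_pow A) ({x. (\<Sum>i\<in>A. \<bar>x i\<bar>) \<le> t} \<inter> space (lborel_pow A)) =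
    ennreal ((2 * t) ^ card A / fact (card A))"
  using assms
proof (induction arbitrary: t rule: finite_induct)
  case (empty t)
  thus ?case by (simp add: PiM_empty)
next
  case (insert b A t)
  interpret product_sigma_finite "\<lambda>_ :: 'a. lborel :: real measure" by standard
  let ?M = "\<lambda>A. lborel_pow A"
  let ?S = "\<lambda>A t. {x. (\<Sum>i\<in>A. \<bar>x i\<bar>) \<le> t} \<inter> space (?M A)"
  define n where "n = card A"
  have meas: "?S J t \<in> sets (?M J)" if "finite J" for J :: "'a set" and t
  proof -
    have "(\<lambda>x. \<Sum>i\<in>J. \<bar>x i\<bar>) \<in> borel_measurable (?M J)"
      by (intro borel_measurable_sum borel_measurable_abs component_measurable)
    hence "{x \<in> space (?M J). (\<Sum>i\<in>J. \<bar>x i\<bar>) \<le> t} \<in> sets (?M J)" by measurable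
    moreover have "?S J t = {x \<in> space (?M J). (\<Sum>i\<in>J. \<bar>x i\<bar>) \<le> t}" by auto
    ultimately show ?thesis by simp
  qed
  have "emeasure (?M (insert b A)) (?S (insert b A) t) = (\<integral>\<^sup>+ x. indicator (?S (insert b A) t) x \<partial>?M (insert b A))"
    using meas[of "insert b A" t] insert.hyps by simp
  also have "\<dots> = (\<integral>\<^sup>+ y. \<integral>\<^sup>+ x. indicator (?S (insert b A) t) (x(b := y)) \<partial>?M A \<partial>lborel)"
    using insert.hyps meas[of "insert b A" t] by (intro product_nn_integral_insert_rev) auto
  also have "\<dots> = (\<integral>\<^sup>+ y. \<integral>\<^sup>+ x. indicator (?S A (t - \<bar>y\<bar>)) x \<partial>?M A \<partial>lborel)"
  proof (intro nn_integral_cong)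
    fix y :: real and x :: "'a \<Rightarrow> real" assume x: "x \<in> space (?M A)"
    have "x(b := y) \<in> space (?M (insert b A))" using x by (auto simp: space_PiM PiE_def extensional_def)
    moreover have "(\<Sum>i\<in>A. \<bar>(x(b := y)) i\<bar>) = (\<Sum>i\<in>A. \<bar>x i\<bar>)"
      using insert.hyps by (intro sum.cong) auto
    ultimately show "indicator (?S (insert b A) t) (x(b := y)) = (indicator (?S A (t - \<bar>y\<bar>)) x :: ennreal)"
      using insert.hyps x by (auto simp: indicator_def)
  qed
  also have "\<dots> = (\<integral>\<^sup>+ y. emeasure (?M A) (?S A (t - \<bar>y\<bar>)) \<partial>lborel)"
    using meas insert.hyps by simp
  also have "\<dots> = (\<integral>\<^sup>+ y. ennreal ((2 * (t - \<bar>y\<bar>)) ^ n / fact n) * indicator {-t..t} y \<partial>lborel)"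
  proof (intro nn_integral_cong)
    fix y :: real
    show "emeasure (?M A) (?S A (t - \<bar>y\<bar>)) = ennreal ((2 * (t - \<bar>y\<bar>)) ^ n / fact n) * indicator {-t..t} y"
    proof (cases "y \<in> {-t..t}")
      case True
      hence "0 \<le> t - \<bar>y\<bar>" by auto
      thus ?thesis using insert.IH[of "t - \<bar>y\<bar>"] True by (simp add: n_def)
    next
      case False
      hence "t - \<bar>y\<bar> < 0" by auto
      moreover have "0 \<le> (\<Sum>i\<in>A. \<bar>x i\<bar>)" for x :: "'a \<Rightarrow> real" by (rule sum_nonneg) simp
      ultimately have "\<not> (\<Sum>i\<in>A. \<bar>x i\<bar>) \<le> t - \<bar>y\<bar>" for x :: "'a \<Rightarrow> real"
        by (metis not_le less_le_trans)
      hence "?S A (t - \<bar>y\<bar>) = {}" by simp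
      thus ?thesis using False by (simp only: emeasure_empty) simp
    qed
  qed
  also have "\<dots> = ennreal ((2 * t) ^ Suc n / fact (Suc n))"
  proof -
    have t: "0 \<le> t" by fact
    have Suc: "(fact (Suc n) :: real) = real (Suc n) * fact n" by simp
    \<comment> \<open>Splitting at 0 removes the absolute value and leaves two integrals with
      polynomial antiderivatives; the endpoint 0 has measure zero.\<close>
    have "(\<integral>\<^sup>+ y. ennreal ((2 * (t - \<bar>y\<bar>)) ^ n / fact n) * indicator {-t..t} y \<partial>lborel) =
      (\<integral>\<^sup>+ y. ennreal ((2 * (t - \<bar>y\<bar>)) ^ n / fact n) * indicator {-t..0} y + ennreal ((2 * (t - \<bar>y\<bar>)) ^ n / fact n) * indicator {0<..t} y \<partial>lborel)"
      using t by (intro nn_integral_cong) (auto simp: indicator_def)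
    also have "\<dots> = (\<integral>\<^sup>+ y. ennreal ((2 * (t - \<bar>y\<bar>)) ^ n / fact n) * indicator {-t..0} y \<partial>lborel) + (\<integral>\<^sup>+ y. ennreal ((2 * (t - \<bar>y\<bar>)) ^ n / fact n) * indicator {0<..t} y \<partial>lborel)"
      by (rule nn_integral_add) measurable
    also have "(\<integral>\<^sup>+ y. ennreal ((2 * (t - \<bar>y\<bar>)) ^ n / fact n) * indicator {-t..0} y \<partial>lborel) =
        (\<integral>\<^sup>+ y. ennreal ((2 * (t + y)) ^ n / fact n) * indicator {-t..0} y \<partial>lborel)"
      by (intro nn_integral_cong) (auto simp: indicator_def)
    also have "\<dots> = ennreal ((2 * (t + 0)) ^ Suc n / (2 * fact (Suc n)) - (2 * (t + - t)) ^ Suc n / (2 * fact (Suc n)))"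
    proof (rule nn_integral_FTC_Icc[where F = "\<lambda>y. (2 * (t + y)) ^ Suc n / (2 * fact (Suc n))"])
      fix x assume x: "x \<in> {- t..0}"
      have "((\<lambda>y. (2 * (t + y)) ^ Suc n / (2 * fact (Suc n))) has_real_derivative
          (real (Suc n) * (2 * (t + x)) ^ n * 2) / (2 * fact (Suc n))) (at x)"
        by (rule derivative_eq_intros refl | simp)+
      also have "(real (Suc n) * (2 * (t + x)) ^ n * 2) / (2 * fact (Suc n)) = (2 * (t + x)) ^ n / fact n"
        unfolding Suc by (simp del: of_nat_Suc)
      finally show "((\<lambda>y. (2 * (t + y)) ^ Suc n / (2 * fact (Suc n))) has_real_derivative (2 * (t + x)) ^ n / fact n) (at x)" .
      show "0 \<le> (2 * (t + x)) ^ n / fact n" using x by simp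
    qed (use t in auto)
    also have "(\<integral>\<^sup>+ y. ennreal ((2 * (t - \<bar>y\<bar>)) ^ n / fact n) * indicator {0<..t} y \<partial>lborel) =
        (\<integral>\<^sup>+ y. ennreal ((2 * (t - y)) ^ n / fact n) * indicator {0..t} y \<partial>lborel)"
    proof (intro nn_integral_cong_AE)
      have "AE y in lborel. y \<noteq> (0 :: real)" by (rule AE_lborel_singleton)
      thus "AE y in lborel. ennreal ((2 * (t - \<bar>y\<bar>)) ^ n / fact n) * indicator {0<..t} y = ennreal ((2 * (t - y)) ^ n / fact n) * indicator {0..t} y"
        by eventually_elim (auto simp: indicator_def)
    qed
    also have "\<dots> = ennreal (- ((2 * (t - t)) ^ Suc n / (2 * fact (Suc n))) - - ((2 * (t - 0)) ^ Suc n / (2 * fact (Suc n))))"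
    proof (rule nn_integral_FTC_Icc[where F = "\<lambda>y. - ((2 * (t - y)) ^ Suc n / (2 * fact (Suc n)))"])
      fix x assume x: "x \<in> {0..t}"
      have "((\<lambda>y. - ((2 * (t - y)) ^ Suc n / (2 * fact (Suc n)))) has_real_derivative
          (real (Suc n) * (2 * (t - x)) ^ n * 2) / (2 * fact (Suc n))) (at x)"
        by (rule derivative_eq_intros refl | simp)+
      also have "(real (Suc n) * (2 * (t - x)) ^ n * 2) / (2 * fact (Suc n)) = (2 * (t - x)) ^ n / fact n"
        unfolding Suc by (simp del: of_nat_Suc)
      finally show "((\<lambda>y. - ((2 * (t - y)) ^ Suc n / (2 * fact (Suc n)))) has_real_derivative (2 * (t - x)) ^ n / fact n) (at x)" .
      show "0 \<le> (2 * (t - x)) ^ n / fact n" using x by simp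
    qed (use t in auto)
    finally show ?thesis using t
      by (simp del: fact_Suc power_Suc add: zero_power ennreal_plus[symmetric] flip: add_divide_distrib)
  qed
  also have "Suc n = card (insert b A)" using insert.hyps by (simp add: n_def)
  finally show ?case .
qed

section \<open>The index of a fractional ideal over the ring of integers\<close>

text \<open>By the inequality of arithmetic and geometric means. It places the open cross-polytope
  of radius d in the region where the product of the absolute coordinates is below 1.\<close>

lemma prod_less_one_of_sum_less:
  fixes x :: "nat \<Rightarrow> real"
  assumes d: "0 < d" and nn: "\<And>i. i < d \<Longrightarrow> 0 \<le> x i" and s: "(\<Sum>i<d. x i) < real d"
  shows "(\<Prod>i<d. x i) < 1"
proof (cases "\<exists>i<d. x i = 0")
  case True
  hence "(\<Prod>i<d. x i) = 0" by (intro prod_zero) auto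
  also have "(0 :: real) < 1" by simp
  finally show ?thesis .
next
  case False
  hence pos: "0 < x i" if "i < d" for i using nn[OF that] that by (metis less_eq_real_def)
  have "(\<Prod>i<d. x i) powr (1 / card {..<d}) \<le> (\<Sum>i<d. x i / card {..<d})"
    using d by (intro arith_geom_mean) (auto intro: nn)
  hence "(\<Prod>i<d. x i) powr (1 / d) \<le> (\<Sum>i<d. x i) / d" by (simp add: sum_divide_distrib)
  also have "\<dots> < 1" using s d by simp
  finally have *: "(\<Prod>i<d. x i) powr (1 / d) < 1" .
  show ?thesis
  proof (rule ccontr)
    assume "\<not> ?thesis"
    hence "1 \<le> (\<Prod>i<d. x i) powr (1 / d)" by (intro ge_one_powr_ge_zero) auto
    with * show False by simp
  qed
qed

text \<open>Induction on the length of the tail ending at m. If p is the longer and q the shorter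
  tail product, then p is q times one value of H, and the bound on that value contains p under a
  root of order j + 2. Dividing by this root leaves p with exponent (j+1)/(j+2); the (j+1)-th root
  then gives \<sigma> the exponent 1/(k-1) for k = j + 2.\<close>

lemma tail_product_bound:
  fixes H \<sigma> :: "nat \<Rightarrow> real"
  assumes H: "\<And>a. a \<le> m \<Longrightarrow> 0 < H a" and \<sigma>: "\<And>k. 0 < \<sigma> k"
    and bound: "\<And>a k. 1 \<le> k \<Longrightarrow> a + k = Suc m \<Longrightarrow> H a \<le> \<sigma> k * (\<Prod>b<k. H (a + b)) powr (1 / real k)"
    and j: "j \<le> m"
  shows "(\<Prod>b<Suc j. H (m - j + b)) powr (1 / real (Suc j)) \<le> (\<Prod>k=2..j+1. \<sigma> k powr (1 / (real k - 1))) * H m"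
  using j
proof (induction j)
  case 0
  thus ?case using H[of m] by simp
next
  case (Suc j)
  define q where "q = (\<Prod>b<Suc j. H (m - j + b))"
  define p where "p = (\<Prod>b<Suc (Suc j). H (m - Suc j + b))"
  have q0: "0 < q" unfolding q_def using Suc.prems by (intro prod_pos) (auto intro!: H)
  have "p = H (m - Suc j) * (\<Prod>b<Suc j. H (m - Suc j + Suc b))"
    unfolding p_def by (subst prod.lessThan_Suc_shift) simp
  also have "(\<Prod>b<Suc j. H (m - Suc j + Suc b)) = q"
    unfolding q_def using Suc.prems by (intro prod.cong) (auto simp: Suc_diff_Suc)
  finally have pq: "p = H (m - Suc j) * q" .
  have p0: "0 < p" unfolding pq using q0 H[of "m - Suc j"] by simp
  have "H (m - Suc j) \<le> \<sigma> (j + 2) * p powr (1 / real (j + 2))"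
    using bound[of "j + 2" "m - Suc j"] Suc.prems by (simp add: p_def del: prod.lessThan_Suc)
  hence "p \<le> \<sigma> (j + 2) * p powr (1 / real (j + 2)) * q"
    unfolding pq using q0 by (simp add: mult_right_mono)
  hence "p / p powr (1 / real (j + 2)) \<le> \<sigma> (j + 2) * q"
    using p0 by (simp add: field_simps)
  also have "p / p powr (1 / real (j + 2)) = p powr (real (Suc j) / real (j + 2))"
  proof -
    have "p / p powr (1 / real (j + 2)) = p powr (1 - 1 / real (j + 2))" using p0 by (simp add: powr_diff)
    also have "1 - 1 / real (j + 2) = real (Suc j) / real (j + 2)" by (simp add: field_simps)
    finally show ?thesis .
  qed
  finally have "(p powr (real (Suc j) / real (j + 2))) powr (1 / real (Suc j)) \<le> (\<sigma> (j + 2) * q) powr (1 / real (Suc j))"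
    by (intro powr_mono2) auto
  also have "(p powr (real (Suc j) / real (j + 2))) powr (1 / real (Suc j)) = p powr (1 / real (j + 2))"
    by (simp add: powr_powr)
  also have "(\<sigma> (j + 2) * q) powr (1 / real (Suc j)) = \<sigma> (j + 2) powr (1 / real (Suc j)) * q powr (1 / real (Suc j))"
    using \<sigma>[of "j + 2"] q0 by (simp add: powr_mult)
  also have "\<dots> \<le> \<sigma> (j + 2) powr (1 / real (Suc j)) * ((\<Prod>k=2..j+1. \<sigma> k powr (1 / (real k - 1))) * H m)"
    using Suc.IH Suc.prems unfolding q_def by (intro mult_left_mono) auto
  also have "\<dots> = (\<Prod>k=2..Suc j+1. \<sigma> k powr (1 / (real k - 1))) * H m"
  proof -
    have "{2..Suc j + 1} = insert (j + 2) {2..j+1}" by auto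
    thus ?thesis by (simp add: mult_ac)
  qed
  finally show ?case by (simp add: p_def del: prod.lessThan_Suc)
qed

text \<open>The bound of full length m + 1 at index 0 contributes the leading factor
  \<open>\<sigma> (m + 1)\<close>; the tail bound with j = m replaces the remaining product by a
  multiple of \<open>H m\<close>.\<close>

lemma hkz_ratio_bound:
  fixes H \<sigma> :: "nat \<Rightarrow> real"
  assumes H: "\<And>a. a \<le> m \<Longrightarrow> 0 < H a" and \<sigma>: "\<And>k. 0 < \<sigma> k"
    and bound: "\<And>a k. 1 \<le> k \<Longrightarrow> a + k = Suc m \<Longrightarrow> H a \<le> \<sigma> k * (\<Prod>b<k. H (a + b)) powr (1 / real k)"
  shows "H 0 \<le> \<sigma> (m + 1) * (\<Prod>k=2..m+1. \<sigma> k powr (1 / (real k - 1))) * H m"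
proof -
  have "H 0 \<le> \<sigma> (Suc m) * (\<Prod>b<Suc m. H b) powr (1 / real (Suc m))"
    using bound[of "Suc m" 0] by simp
  also have "\<dots> \<le> \<sigma> (Suc m) * ((\<Prod>k=2..m+1. \<sigma> k powr (1 / (real k - 1))) * H m)"
  proof (rule mult_left_mono)
    have "(\<Prod>b<Suc m. H (m - m + b)) powr (1 / real (Suc m)) \<le> (\<Prod>k=2..m+1. \<sigma> k powr (1 / (real k - 1))) * H m"
      by (rule tail_product_bound[OF H \<sigma> bound order_refl])
    thus "(\<Prod>b<Suc m. H b) powr (1 / real (Suc m)) \<le> (\<Prod>k=2..m+1. \<sigma> k powr (1 / (real k - 1))) * H m"
      by (simp only: diff_self_eq_0 add_0)
    show "0 \<le> \<sigma> (Suc m)" using \<sigma>[of "Suc m"] by simp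
  qed
  finally show ?thesis by (simp add: mult.assoc)
qed

context number_field
begin

lemma discriminant_pos: "0 < \<bar>field_discriminant TYPE('k)\<bar>"
  using embedding_det_nonzero by (simp add: discriminant_eq)

lemma sigma_const_pos: "0 < sigma_const TYPE('k) k"
  unfolding sigma_const_def using discriminant_pos unit_ball_vol_pos[of "real k"]
  by (intro mult_pos_pos) (auto simp del: unit_ball_vol_pos)

text \<open>In coordinates with respect to w, congruence modulo the ring of integers is congruence
  modulo the integer grid. If two translates of the body overlap, they yield an element of A whose
  conjugates have absolute sum below d; its norm is below 1 in absolute value, so it is 0. The
  translates by X therefore pack the unit cube.\<close>

lemma fractional_index_bound:
  fixes A X :: "'k set"
  assumes diff: "\<And>a b. a \<in> A \<Longrightarrow> b \<in> A \<Longrightarrow> a - b \<in> A" and OA: "\<O> \<subseteq> A"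
    and norm: "\<And>a. a \<in> A \<Longrightarrow> a \<noteq> 0 \<Longrightarrow> 1 \<le> \<bar>field_norm a\<bar>"
    and X: "finite X" "X \<subseteq> A" and inc: "\<And>x y. x \<in> X \<Longrightarrow> y \<in> X \<Longrightarrow> x \<noteq> y \<Longrightarrow> x - y \<notin> \<O>"
  shows "real (card X) \<le> fact d / real d ^ d * sqrt \<bar>field_discriminant TYPE('k)\<bar>"
proof -
  have "\<forall>a. \<exists>c. a = (\<Sum>i<d. of_rat (c i) * w i)" using basis unfolding rat_basis_def by blast
  then obtain co where co: "\<And>a. a = (\<Sum>i<d. of_rat (co a i) * w i)" unfolding choice_iff by blast
  define I where "I = {..<d}"
  define W where "W = \<bar>embedding_det d \<nu> w\<bar>"
  have W0: "0 < W" using embedding_det_nonzero by (simp add: W_def)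
  let ?M = "lborel_pow I"
  define F where "F = block_linear (\<lambda>i. i) d (\<lambda>k i. \<nu> k (w i))"
  have F: "scaling_map I F W"
    unfolding F_def W_def using embedding_det_nonzero
    by (intro scaling_map_block_linear) (auto simp: I_def)
  have F_in: "F c k = (\<Sum>i<d. \<nu> k (w i) * c i)" if "k < d" for c k
    unfolding F_def using that block_linear_in[of "\<lambda>i. i" d k "\<lambda>k i. \<nu> k (w i)" c] by simp
  define pt where "pt = (\<lambda>a. restrict (\<lambda>i. real_of_rat (co a i)) I)"
  have nu_rat: "\<nu> k (\<Sum>i<d. of_rat (r i) * w i) = (\<Sum>i<d. \<nu> k (w i) * of_rat (r i))" if "k < d" for k r
    using field_hom_rat_combination[OF nu_hom[OF that], of r w "{..<d}"] by (simp add: mult.commute)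
  have inj: "inj_on pt X"
  proof (rule inj_onI)
    fix x y assume eq: "pt x = pt y"
    have "co x i = co y i" if "i < d" for i
      using fun_cong[OF eq, of i] that by (simp add: pt_def I_def)
    hence "(\<Sum>i<d. of_rat (co x i) * w i) = (\<Sum>i<d. of_rat (co y i) * w i)" by simp
    thus "x = y" unfolding co[symmetric] .
  qed
  \<comment> \<open>A radius strictly below d keeps the norms strictly below 1; the value d is
    reached in a limit at the end.\<close>
  have key: "real (card X) * \<rho> ^ d \<le> fact d * W" if \<rho>: "0 < \<rho>" "\<rho> < real d" for \<rho>
  proof -
    \<comment> \<open>Half the radius, because the difference of two points of the body has to stay
      within \<rho>.\<close>
    define S where "S = {y. (\<Sum>k\<in>I. \<bar>y k\<bar>) \<le> \<rho> / 2} \<inter> space ?M"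
    have S: "S \<in> sets ?M"
    proof -
      have "(\<lambda>x. \<Sum>i\<in>I. \<bar>x i\<bar>) \<in> borel_measurable ?M"
        by (intro borel_measurable_sum borel_measurable_abs component_measurable)
      hence "{x \<in> space ?M. (\<Sum>i\<in>I. \<bar>x i\<bar>) \<le> \<rho> / 2} \<in> sets ?M" by measurable
      moreover have "S = {x \<in> space ?M. (\<Sum>i\<in>I. \<bar>x i\<bar>) \<le> \<rho> / 2}" by (auto simp: S_def)
      ultimately show ?thesis by simp
    qed
    define T where "T = F -` S \<inter> space ?M"
    have T: "T \<in> sets ?M" unfolding T_def using F S by (intro measurable_sets[of _ _ ?M]) (auto simp: scaling_map_def)
    have "of_nat (card (pt ` X)) * emeasure ?M T \<le> 1"
    proof (rule packing_bound[OF _ T])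
      show "finite I" "finite (pt ` X)" using X by (auto simp: I_def)
      fix x y s t assume xy: "x \<in> pt ` X" "y \<in> pt ` X" and st: "s \<in> T" "t \<in> T"
        and Z: "\<forall>j\<in>I. (x j + s j) - (y j + t j) \<in> \<int>"
      obtain a b where ab: "a \<in> X" "b \<in> X" "x = pt a" "y = pt b" using xy by auto
      define z where "z = (\<lambda>j. floor ((x j + s j) - (y j + t j)))"
      have z: "of_int (z j) = (x j + s j) - (y j + t j)" if "j < d" for j
        using Z that by (simp add: z_def I_def of_int_floor)
      define r where "r = (\<lambda>j. of_int (z j) - (co a j - co b j))"
      have r: "s j - t j = of_rat (r j)" if "j < d" for j
        using z[OF that] that by (simp add: r_def of_rat_diff ab pt_def I_def)
      define o' where "o' = (\<Sum>j<d. of_int (z j) * w j)"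
      have o': "o' \<in> \<O>" unfolding integers o'_def by (intro exI[of _ z] refl)
      \<comment> \<open>The field element with coordinates s - t; it differs from b - a by an
        integer of the field and so lies in A.\<close>
      define \<delta> where "\<delta> = (\<Sum>j<d. of_rat (r j) * w j)"
      have "\<delta> = o' - ((\<Sum>j<d. of_rat (co a j) * w j) - (\<Sum>j<d. of_rat (co b j) * w j))"
        by (simp add: \<delta>_def o'_def r_def of_rat_diff left_diff_distrib sum_subtractf)
      hence \<delta>: "\<delta> = o' - (a - b)" unfolding co[symmetric] .
      have \<delta>A: "\<delta> \<in> A" unfolding \<delta> using o' OA ab X by (intro diff) auto
      have F\<delta>: "\<nu> k \<delta> = F s k - F t k" if "k < d" for k
        using that by (simp add: \<delta>_def nu_rat F_in r[symmetric] right_diff_distrib sum_subtractf)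
      have "(\<Sum>k<d. \<bar>\<nu> k \<delta>\<bar>) \<le> (\<Sum>k<d. \<bar>F s k\<bar> + \<bar>F t k\<bar>)"
        by (intro sum_mono) (auto simp: F\<delta> abs_triangle_ineq4)
      also have "\<dots> = (\<Sum>k\<in>I. \<bar>F s k\<bar>) + (\<Sum>k\<in>I. \<bar>F t k\<bar>)" by (simp add: sum.distrib I_def)
      also have "\<dots> \<le> \<rho> / 2 + \<rho> / 2" using st by (intro add_mono) (auto simp: T_def S_def)
      also have "\<dots> < real d" using \<rho> by simp
      finally have "(\<Prod>k<d. \<bar>\<nu> k \<delta>\<bar>) < 1"
        by (intro prod_less_one_of_sum_less degree_pos) auto
      hence "\<bar>field_norm \<delta>\<bar> < 1" by (simp add: field_norm_eq abs_prod)
      hence \<delta>0: "\<delta> = 0" using norm[OF \<delta>A] by force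
      hence "a - b \<in> \<O>" using \<delta> o' by simp
      hence "a = b" using inc ab by blast
      moreover have "s j = t j" if "j < d" for j
        using rat_basis_independent[OF basis \<delta>0[unfolded \<delta>_def] that] r[OF that] by simp
      hence "s = t" using st by (intro PiE_ext[of s I "\<lambda>_. UNIV" t]) (auto simp: T_def space_PiM I_def)
      ultimately show "x = y \<and> s = t" using ab by simp
    qed
    moreover have "card (pt ` X) = card X" by (rule card_image[OF inj])
    ultimately have "ennreal W * (of_nat (card X) * emeasure ?M T) \<le> ennreal W * 1"
      by (intro mult_left_mono) auto
    moreover have "ennreal W * emeasure ?M T = ennreal (\<rho> ^ d / fact d)"
    proof -
      have "ennreal W * emeasure ?M T = emeasure ?M S" unfolding T_def by (rule scaling_mapD[OF F S])
      also have "\<dots> = ennreal ((2 * (\<rho> / 2)) ^ card I / fact (card I))"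
        unfolding S_def using \<rho> by (intro emeasure_cross_polytope) (auto simp: I_def)
      finally show ?thesis by (simp add: I_def)
    qed
    moreover have "ennreal W * (of_nat (card X) * emeasure ?M T) = of_nat (card X) * (ennreal W * emeasure ?M T)"
      by (rule mult.left_commute)
    ultimately have "of_nat (card X) * ennreal (\<rho> ^ d / fact d) \<le> ennreal W" by simp
    moreover have "ennreal (real (card X) * (\<rho> ^ d / fact d)) = of_nat (card X) * ennreal (\<rho> ^ d / fact d)"
      using \<rho> by (subst ennreal_mult) (auto simp: ennreal_of_nat_eq_real_of_nat)
    ultimately have "ennreal (real (card X) * (\<rho> ^ d / fact d)) \<le> ennreal W" by simp
    hence "real (card X) * (\<rho> ^ d / fact d) \<le> W" using W0 by (simp add: ennreal_le_iff)
    thus ?thesis by (simp add: field_simps)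
  qed
  have "real (card X) * real d ^ d \<le> fact d * W"
  proof (rule field_le_mult_one_interval)
    fix z :: real assume z: "0 < z" "z < 1"
    \<comment> \<open>Chosen so that \<rho>^d is z times d^d, where z runs through the numbers
      between 0 and 1.\<close>
    define \<rho> where "\<rho> = real d * root d z"
    have "\<rho> ^ d = real d ^ d * z" using degree_pos z by (simp add: \<rho>_def power_mult_distrib)
    moreover have "0 < \<rho>" "\<rho> < real d" using degree_pos z by (auto simp: \<rho>_def)
    ultimately show "z * (real (card X) * real d ^ d) \<le> fact d * W" using key[of \<rho>] by (simp add: mult_ac)
  qed
  thus ?thesis using degree_pos unfolding sqrt_abs_discriminant W_def[symmetric] by (simp add: field_simps)
qed

end

section \<open>Minkowski's bound for the minimum of a form\<close>

text \<open>Coordinates are pairs of a variable a and an index i of a basis element or an embedding.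
  One matrix acts for each fixed a; the counter m of finished blocks lets them act in turn on
  disjoint sets of coordinates, so the determinants multiply.\<close>

lemma scaling_map_first_blocks:
  fixes A :: "nat \<Rightarrow> nat \<Rightarrow> nat \<Rightarrow> real"
  assumes A: "\<And>a. a < k \<Longrightarrow> Determinant.det (mat d d (\<lambda>(i, j). A a i j)) \<noteq> 0" and m: "m \<le> k"
  shows "scaling_map ({..<k} \<times> {..<d})
    (\<lambda>x (a, i). if a < m \<and> i < d then \<Sum>l<d. A a i l * x (a, l) else x (a, i))
    (\<Prod>a<m. \<bar>Determinant.det (mat d d (\<lambda>(i, j). A a i j))\<bar>)"
  using m
proof (induction m)
  case 0
  show ?case using scaling_map_id by simp
next
  case (Suc m)
  let ?F = "\<lambda>m (x :: nat \<times> nat \<Rightarrow> real) (a, i). if a < m \<and> i < d then \<Sum>l<d. A a i l * x (a, l) else x (a, i)"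
  have inj: "inj_on (Pair m) {..<d}" by (auto simp: inj_on_def)
  have "scaling_map ({..<k} \<times> {..<d}) (\<lambda>x. block_linear (Pair m) d (A m) (?F m x))
    (\<bar>Determinant.det (mat d d (\<lambda>(i, j). A m i j))\<bar> * (\<Prod>a<m. \<bar>Determinant.det (mat d d (\<lambda>(i, j). A a i j))\<bar>))"
  proof (rule scaling_map_comp[where F = "?F m" and G = "block_linear (Pair m) d (A m)"])
    show "scaling_map ({..<k} \<times> {..<d}) (?F m) (\<Prod>a<m. \<bar>Determinant.det (mat d d (\<lambda>(i, j). A a i j))\<bar>)"
      by (rule Suc.IH) (use Suc.prems in simp)
    show "scaling_map ({..<k} \<times> {..<d}) (block_linear (Pair m) d (A m)) \<bar>Determinant.det (mat d d (\<lambda>(i, j). A m i j))\<bar>"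
      using Suc.prems by (intro scaling_map_block_linear inj A) auto
  qed
  also have "(\<lambda>x. block_linear (Pair m) d (A m) (?F m x)) = ?F (Suc m)"
  proof (rule ext, rule ext)
    fix x :: "nat \<times> nat \<Rightarrow> real" and p :: "nat \<times> nat"
    obtain a i where p: "p = (a, i)" by (cases p)
    have "block_linear (Pair m) d (A m) (?F m x) (a, i) = ?F (Suc m) x (a, i)"
    proof (cases "a = m \<and> i < d")
      case True
      thus ?thesis using block_linear_in[OF inj, of i "A m" "?F m x"] by simp
    next
      case False
      hence "(a, i) \<notin> Pair m ` {..<d}" by auto
      thus ?thesis using False by (auto simp: block_linear_out)
    qed
    thus "block_linear (Pair m) d (A m) (?F m x) p = ?F (Suc m) x p" by (simp only: p)
  qed
  finally show ?case by (simp add: mult.commute)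
qed

text \<open>The same with the roles exchanged: one matrix on the variables for each fixed second
  index.\<close>

lemma scaling_map_second_blocks:
  fixes A :: "nat \<Rightarrow> nat \<Rightarrow> nat \<Rightarrow> real"
  assumes A: "\<And>i. i < d \<Longrightarrow> Determinant.det (mat k k (\<lambda>(a, b). A i a b)) \<noteq> 0" and m: "m \<le> d"
  shows "scaling_map ({..<k} \<times> {..<d})
    (\<lambda>x (a, i). if i < m \<and> a < k then \<Sum>b<k. A i a b * x (b, i) else x (a, i))
    (\<Prod>i<m. \<bar>Determinant.det (mat k k (\<lambda>(a, b). A i a b))\<bar>)"
  using m
proof (induction m)
  case 0
  show ?case using scaling_map_id by simp
next
  case (Suc m)
  let ?F = "\<lambda>m (x :: nat \<times> nat \<Rightarrow> real) (a, i). if i < m \<and> a < k then \<Sum>b<k. A i a b * x (b, i) else x (a, i)"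
  let ?e = "\<lambda>a. (a, m)"
  have inj: "inj_on ?e {..<k}" by (auto simp: inj_on_def)
  have "scaling_map ({..<k} \<times> {..<d}) (\<lambda>x. block_linear ?e k (A m) (?F m x))
    (\<bar>Determinant.det (mat k k (\<lambda>(i, j). A m i j))\<bar> * (\<Prod>a<m. \<bar>Determinant.det (mat k k (\<lambda>(i, j). A a i j))\<bar>))"
  proof (rule scaling_map_comp[where F = "?F m" and G = "block_linear ?e k (A m)"])
    show "scaling_map ({..<k} \<times> {..<d}) (?F m) (\<Prod>a<m. \<bar>Determinant.det (mat k k (\<lambda>(i, j). A a i j))\<bar>)"
      by (rule Suc.IH) (use Suc.prems in simp)
    show "scaling_map ({..<k} \<times> {..<d}) (block_linear ?e k (A m)) \<bar>Determinant.det (mat k k (\<lambda>(i, j). A m i j))\<bar>"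
      using Suc.prems by (intro scaling_map_block_linear inj A) auto
  qed
  also have "(\<lambda>x. block_linear ?e k (A m) (?F m x)) = ?F (Suc m)"
  proof (rule ext, rule ext)
    fix x :: "nat \<times> nat \<Rightarrow> real" and p :: "nat \<times> nat"
    obtain a i where p: "p = (a, i)" by (cases p)
    have "block_linear ?e k (A m) (?F m x) (a, i) = ?F (Suc m) x (a, i)"
    proof (cases "i = m \<and> a < k")
      case True
      thus ?thesis using block_linear_in[OF inj, of a "A m" "?F m x"] by simp
    next
      case False
      hence "(a, i) \<notin> ?e ` {..<k}" by auto
      thus ?thesis using False by (auto simp: block_linear_out)
    qed
    thus "block_linear ?e k (A m) (?F m x) p = ?F (Suc m) x p" by (simp only: p)
  qed
  finally show ?case by (simp add: mult.commute)
qed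

lemma det_upper_triangular_fun:
  fixes f :: "nat \<Rightarrow> nat \<Rightarrow> 'a::comm_ring_1"
  assumes "\<And>i j. i < n \<Longrightarrow> j < i \<Longrightarrow> f i j = 0"
  shows "Determinant.det (mat n n (\<lambda>(i, j). f i j)) = (\<Prod>i<n. f i i)"
proof -
  let ?A = "mat n n (\<lambda>(i, j). f i j)"
  have "Determinant.det ?A = prod_list (diag_mat ?A)"
    by (rule det_upper_triangular[of _ n]) (auto simp: upper_triangular_def assms)
  also have "diag_mat ?A = map (\<lambda>i. f i i) [0..<n]" by (auto simp: diag_mat_def)
  also have "prod_list \<dots> = (\<Prod>i<n. f i i)"
    by (subst prod.distinct_set_conv_list[symmetric]) (auto simp: atLeast0LessThan)
  finally show ?thesis .
qed

lemma sqrt_prod: "sqrt (\<Prod>x\<in>A. f x) = (\<Prod>x\<in>A. sqrt (f x))"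
  by (induction A rule: infinite_finite_induct) (auto simp: real_sqrt_mult)

lemma power_powr: "0 < x \<Longrightarrow> (x ^ n) powr c = x powr (real n * c)" for x c :: real
  by (subst powr_realpow[symmetric]) (auto simp: powr_powr)

lemma power_le_imp_le_powr:
  fixes Y C :: real
  assumes "0 < k" "0 \<le> Y" "Y ^ k \<le> C"
  shows "Y \<le> C powr (1 / real k)"
proof (cases "Y = 0")
  case False
  hence Y: "0 < Y" using assms by simp
  have "Y = (Y ^ k) powr (1 / real k)"
    using Y assms(1) by (simp add: power_powr)
  also have "\<dots> \<le> C powr (1 / real k)" using assms Y by (intro powr_mono2) auto
  finally show ?thesis .
qed simp

text \<open>The form with given Lagrange coefficients, taken on functions instead of vectors so that
  passing to a tail of the variables is a mere shift of indices.\<close>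

definition lagrange_value :: "nat \<Rightarrow> (nat \<Rightarrow> 'k::field_char_0) \<Rightarrow> (nat \<Rightarrow> nat \<Rightarrow> 'k) \<Rightarrow> (nat \<Rightarrow> 'k) \<Rightarrow> 'k" where
  "lagrange_value k h u x = (\<Sum>a<k. h a * (x a + (\<Sum>b\<in>{a<..<k}. u a b * x b))\<^sup>2)"

context number_field
begin

text \<open>Minkowski's convex body theorem for the product, over all embeddings, of the ellipsoids
  on which the conjugate forms are at most r^2. Two points of the body that are congruent modulo
  integral vectors differ by an integral vector on which the form has norm at most (4 r^2)^d; below
  the minimum \<mu> this forces them to be equal. So the body has volume at most 1, and solving for
  (4 r^2)^d gives the bound.\<close>

lemma minkowski_minimum_bound:
  fixes h :: "nat \<Rightarrow> 'k" and u :: "nat \<Rightarrow> nat \<Rightarrow> 'k"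
  assumes k: "0 < k" and h: "\<And>a. a < k \<Longrightarrow> totally_positive (h a)" and \<mu>: "0 < \<mu>"
    and min: "\<And>x. (\<And>a. a < k \<Longrightarrow> x a \<in> \<O>) \<Longrightarrow> (\<exists>a<k. x a \<noteq> 0) \<Longrightarrow> \<mu> \<le> field_norm (lagrange_value k h u x)"
  shows "\<mu> \<le> sigma_const TYPE('k) k * (\<Prod>a<k. field_norm (h a)) powr (1 / real k)"
proof -
  define I where "I = {..<k} \<times> {..<d}"
  let ?M = "lborel_pow I"
  have fin: "finite I" by (simp add: I_def)
  define D where "D = \<bar>embedding_det d \<nu> w\<bar>"
  have D0: "0 < D" using embedding_det_nonzero by (simp add: D_def)
  define P where "P = (\<Prod>a<k. field_norm (h a))"
  have P0: "0 < P" unfolding P_def by (intro prod_pos field_norm_pos h) auto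
  \<comment> \<open>\<open>F1\<close> passes from coordinates in the integral basis to conjugates,
    separately for each variable. \<open>U\<close> is, in each embedding, a triangular square root
    of the conjugate form, so column i of the image has squared length equal to the i-th conjugate
    of the form.\<close>
  define F1 where "F1 = (\<lambda>(x :: nat \<times> nat \<Rightarrow> real) (a, i). if a < k \<and> i < d then \<Sum>l<d. \<nu> i (w l) * x (a, l) else x (a, i))"
  define U where "U = (\<lambda>i a b. sqrt (\<nu> i (h a)) * (if b = a then 1 else if a < b then \<nu> i (u a b) else 0))"
  define F2 where "F2 = (\<lambda>(x :: nat \<times> nat \<Rightarrow> real) (a, i). if i < d \<and> a < k then \<Sum>b<k. U i a b * x (b, i) else x (a, i))"
  have S1: "scaling_map I F1 (D ^ k)"
    using scaling_map_first_blocks[of k d "\<lambda>_ i l. \<nu> i (w l)" k] embedding_det_nonzero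
    unfolding F1_def I_def D_def by simp
  have hpos: "0 < \<nu> i (h a)" if "i < d" "a < k" for i a using h that by (simp add: totally_positive_iff)
  have detU: "Determinant.det (mat k k (\<lambda>(a, b). U i a b)) = (\<Prod>a<k. sqrt (\<nu> i (h a)))" for i
    by (subst det_upper_triangular_fun) (auto simp: U_def)
  have "(\<Prod>i<d. \<bar>Determinant.det (mat k k (\<lambda>(a, b). U i a b))\<bar>) = (\<Prod>i<d. \<Prod>a<k. sqrt (\<nu> i (h a)))"
    unfolding detU using hpos by (intro prod.cong refl abs_of_nonneg prod_nonneg) (auto intro: less_imp_le)
  also have "\<dots> = (\<Prod>a<k. \<Prod>i<d. sqrt (\<nu> i (h a)))" by (rule prod.swap)
  also have "\<dots> = sqrt P" by (simp add: P_def field_norm_eq sqrt_prod)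
  finally have detU': "(\<Prod>i<d. \<bar>Determinant.det (mat k k (\<lambda>(a, b). U i a b))\<bar>) = sqrt P" .
  have detU0: "Determinant.det (mat k k (\<lambda>(a, b). U i a b)) \<noteq> 0" if "i < d" for i
    unfolding detU using hpos[OF that] by (auto simp: less_le)
  have S2: "scaling_map I F2 (sqrt P)"
    using scaling_map_second_blocks[where A = U and k = k and d = d and m = d, OF detU0 order_refl]
    unfolding F2_def I_def detU' .
  define F where "F = (\<lambda>x. F2 (F1 x))"
  have F: "scaling_map I F (sqrt P * D ^ k)" unfolding F_def by (rule scaling_map_comp[OF S1 S2])
  have F_diff: "F (\<lambda>p. s p - t p) (a, i) = F s (a, i) - F t (a, i)" for s t a i
    by (simp add: F_def F1_def F2_def right_diff_distrib sum_subtractf)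
  have F_value: "(\<Sum>a<k. (F z (a, i))\<^sup>2) = \<nu> i (lagrange_value k h u x)"
    if i: "i < d" and x: "\<And>a. a < k \<Longrightarrow> x a = (\<Sum>l<d. of_int (c a l) * w l)"
      and z: "\<And>a l. a < k \<Longrightarrow> l < d \<Longrightarrow> z (a, l) = of_int (c a l)" for i x z and c :: "nat \<Rightarrow> nat \<Rightarrow> int"
  proof -
    have F1z: "F1 z (a, i) = \<nu> i (x a)" if "a < k" for a
    proof -
      have "F1 z (a, i) = (\<Sum>l<d. of_int (c a l) * \<nu> i (w l))"
        using that i by (simp add: F1_def z mult.commute)
      also have "\<dots> = \<nu> i (x a)" unfolding x[OF that] nu_int_combination[OF i] ..
      finally show ?thesis .
    qed
    have Fz: "F z (a, i) = sqrt (\<nu> i (h a)) * \<nu> i (x a + (\<Sum>b\<in>{a<..<k}. u a b * x b))" if a: "a < k" for a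
    proof -
      have "F z (a, i) = (\<Sum>b<k. U i a b * \<nu> i (x b))" using i a by (simp add: F_def F2_def F1z)
      also have "\<dots> = sqrt (\<nu> i (h a)) * (\<Sum>b<k. (if b = a then \<nu> i (x b) else 0) + (if a < b then \<nu> i (u a b) * \<nu> i (x b) else 0))"
        unfolding sum_distrib_left by (intro sum.cong refl) (auto simp: U_def)
      also have "(\<Sum>b<k. (if b = a then \<nu> i (x b) else 0) + (if a < b then \<nu> i (u a b) * \<nu> i (x b) else 0)) =
          \<nu> i (x a) + (\<Sum>b<k. if a < b then \<nu> i (u a b) * \<nu> i (x b) else 0)"
        using a by (simp add: sum.distrib)
      also have "(\<Sum>b<k. if a < b then \<nu> i (u a b) * \<nu> i (x b) else 0) = (\<Sum>b\<in>{a<..<k}. \<nu> i (u a b) * \<nu> i (x b))"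
        by (subst sum.inter_filter[symmetric]) (auto intro!: sum.cong)
      finally show ?thesis using i by (simp add: nu_add nu_sum nu_mult)
    qed
    show ?thesis
      unfolding lagrange_value_def using i hpos[OF i]
      by (subst nu_sum[OF i], intro sum.cong refl) (simp add: Fz nu_mult nu_power power_mult_distrib less_imp_le)
  qed
  have key: "(unit_ball_vol (real k) * r ^ k) ^ d \<le> sqrt P * D ^ k" if r: "0 < r" "(4 * r\<^sup>2) ^ d < \<mu>" for r
  proof -
    define S where "S = {x. \<forall>i<d. sqrt (\<Sum>a<k. (x (a, i))\<^sup>2) \<le> r} \<inter> space ?M"
    have S: "S \<in> sets ?M"
    proof -
      have "S = {x \<in> space ?M. \<forall>i\<in>{..<d}. sqrt (\<Sum>a<k. (x (a, i))\<^sup>2) \<le> r}" by (auto simp: S_def)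
      also have "\<dots> \<in> sets ?M"
      proof (rule sets.sets_Collect_finite_All)
        fix i assume "i \<in> {..<d}"
        hence "(\<lambda>x. sqrt (\<Sum>a<k. (x (a, i))\<^sup>2)) \<in> borel_measurable ?M"
          by (intro measurable_compose[OF _ borel_measurable_sqrt] borel_measurable_sum borel_measurable_power component_measurable)
             (auto simp: I_def)
        thus "{x \<in> space ?M. sqrt (\<Sum>a<k. (x (a, i))\<^sup>2) \<le> r} \<in> sets ?M" by measurable
      qed simp
      finally show ?thesis .
    qed
    define T where "T = F -` S \<inter> space ?M"
    have T: "T \<in> sets ?M" unfolding T_def using F S by (intro measurable_sets[of _ _ ?M]) (auto simp: scaling_map_def)
    \<comment> \<open>The packing with a single translate: an overlap is a difference of two points
      of T with integer coordinates.\<close>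
    have "of_nat (card {\<lambda>_ :: nat \<times> nat. 0 :: real}) * emeasure ?M T \<le> 1"
    proof (rule packing_bound[OF fin T])
      fix p q s t :: "nat \<times> nat \<Rightarrow> real"
      assume pq: "p \<in> {\<lambda>_. 0}" "q \<in> {\<lambda>_. 0}" and st: "s \<in> T" "t \<in> T"
        and Z: "\<forall>j\<in>I. (p j + s j) - (q j + t j) \<in> \<int>"
      define c where "c = (\<lambda>a l. floor (s (a, l) - t (a, l)))"
      have c: "s (a, l) - t (a, l) = of_int (c a l)" if "a < k" "l < d" for a l
        using Z pq that by (simp add: c_def I_def of_int_floor)
      define x where "x = (\<lambda>a. \<Sum>l<d. of_int (c a l) * w l)"
      have xO: "x a \<in> \<O>" for a unfolding integers x_def by (intro exI[of _ "c a"] refl)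
      have le: "\<nu> i (lagrange_value k h u x) \<le> 4 * r\<^sup>2" and ge: "0 \<le> \<nu> i (lagrange_value k h u x)" if i: "i < d" for i
      proof -
        have v: "\<nu> i (lagrange_value k h u x) = (\<Sum>a<k. (F (\<lambda>p. s p - t p) (a, i))\<^sup>2)"
          by (rule F_value[OF i, symmetric]) (auto simp: x_def c)
        thus "0 \<le> \<nu> i (lagrange_value k h u x)" by (simp add: sum_nonneg)
        \<comment> \<open>The triangle inequality in each embedding doubles the radius, which is the
          source of the factor 4.\<close>
        have "L2_set (\<lambda>a. F s (a, i) + - F t (a, i)) {..<k} \<le> L2_set (\<lambda>a. F s (a, i)) {..<k} + L2_set (\<lambda>a. - F t (a, i)) {..<k}"
          by (rule L2_set_triangle_ineq)
        also have "\<dots> \<le> r + r" using st i by (intro add_mono) (auto simp: T_def S_def L2_set_def)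
        finally have "sqrt (\<nu> i (lagrange_value k h u x)) \<le> 2 * r" by (simp add: v F_diff L2_set_def)
        hence "(sqrt (\<nu> i (lagrange_value k h u x)))\<^sup>2 \<le> (2 * r)\<^sup>2"
          using v by (intro power_mono) (auto simp: sum_nonneg)
        thus "\<nu> i (lagrange_value k h u x) \<le> 4 * r\<^sup>2"
          using v by (simp add: sum_nonneg power_mult_distrib)
      qed
      have "field_norm (lagrange_value k h u x) \<le> (\<Prod>i<d. 4 * r\<^sup>2)"
        unfolding field_norm_eq using le ge by (intro prod_mono) auto
      hence "field_norm (lagrange_value k h u x) < \<mu>" using r(2) by simp
      hence x0: "x a = 0" if "a < k" for a using min[of x] xO that by (metis not_le)
      have "c a l = 0" if "a < k" "l < d" for a l
      proof -
        have "(\<Sum>l<d. of_rat (of_int (c a l)) * w l) = 0" using x0[OF that(1)] by (simp add: x_def)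
        from rat_basis_independent[OF basis this that(2)] show ?thesis by simp
      qed
      hence "s j = t j" if "j \<in> I" for j using that c by (auto simp: I_def)
      hence "s = t" using st by (intro PiE_ext[of s I "\<lambda>_. UNIV" t]) (auto simp: T_def space_PiM)
      thus "p = q \<and> s = t" using pq by simp
    qed simp
    hence "emeasure ?M T \<le> 1" by simp
    hence "ennreal (sqrt P * D ^ k) * emeasure ?M T \<le> ennreal (sqrt P * D ^ k) * 1" by (rule mult_left_mono) simp
    also have "ennreal (sqrt P * D ^ k) * emeasure ?M T = emeasure ?M S"
      unfolding T_def by (rule scaling_mapD[OF F S])
    also have "emeasure ?M S = ennreal ((unit_ball_vol (real k) * r ^ k) ^ d)"
      unfolding S_def I_def by (rule emeasure_ball_power[OF r(1)])
    finally have "ennreal ((unit_ball_vol (real k) * r ^ k) ^ d) \<le> ennreal (sqrt P * D ^ k)" by simp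
    thus ?thesis using P0 D0 by (simp add: ennreal_le_iff)
  qed
  define \<omega> where "\<omega> = unit_ball_vol (real k)"
  have w0: "0 < \<omega>" unfolding \<omega>_def by (rule unit_ball_vol_pos) simp
  show ?thesis
  proof (rule field_le_mult_one_interval)
    fix z :: real assume z: "0 < z" "z < 1"
    define y where "y = z * \<mu>"
    have y: "0 < y" "y < \<mu>" using z \<mu> by (auto simp: y_def)
    \<comment> \<open>Now (4 r^2)^d equals y, which is below \<mu>. Squaring removes the square root
      of P, and the k-th root then produces the shape of \<open>sigma_const\<close>.\<close>
    define r where "r = sqrt (root d y / 4)"
    have r0: "0 < r" using y degree_pos by (simp add: r_def)
    have r2: "r\<^sup>2 = root d y / 4" using y degree_pos by (simp add: r_def less_imp_le)
    have r2d: "(4 * r\<^sup>2) ^ d = y" using y degree_pos by (simp add: r2)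
    have "((\<omega> * r ^ k) ^ d)\<^sup>2 \<le> (sqrt P * D ^ k)\<^sup>2"
      using key[OF r0] r2d y w0 r0 by (intro power_mono) (auto simp: \<omega>_def)
    also have "(sqrt P * D ^ k)\<^sup>2 = P * (D\<^sup>2) ^ k" using P0 by (simp add: power_mult_distrib power_mult[symmetric] mult.commute)
    also have "((\<omega> * r ^ k) ^ d)\<^sup>2 = \<omega> ^ (2 * d) * ((r\<^sup>2) ^ d) ^ k"
      by (simp add: power_mult_distrib power_mult[symmetric] mult_ac)
    also have "(r\<^sup>2) ^ d = y / 4 ^ d" using r2d by (simp add: power_mult_distrib field_simps)
    finally have "\<omega> ^ (2 * d) * (y / 4 ^ d) ^ k \<le> P * (D\<^sup>2) ^ k" .
    hence "(y / 4 ^ d) ^ k \<le> P * (D\<^sup>2) ^ k / \<omega> ^ (2 * d)"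
      using w0 by (simp add: pos_le_divide_eq mult.commute)
    hence "y / 4 ^ d \<le> (P * (D\<^sup>2) ^ k / \<omega> ^ (2 * d)) powr (1 / real k)"
      using k y by (intro power_le_imp_le_powr) auto
    also have "\<dots> = P powr (1 / real k) * D\<^sup>2 * \<omega> powr (- 2 * real d / real k)"
    proof -
      have "((D\<^sup>2) ^ k) powr (1 / real k) = D\<^sup>2"
        using D0 k by (subst power_powr) auto
      moreover have "(\<omega> ^ (2 * d)) powr (1 / real k) = \<omega> powr (2 * real d / real k)"
        using w0 by (subst power_powr) auto
      moreover have "\<omega> powr (- 2 * real d / real k) = 1 / \<omega> powr (2 * real d / real k)"
        by (simp add: powr_minus_divide)
      moreover have "(P * (D\<^sup>2) ^ k / \<omega> ^ (2 * d)) powr (1 / real k) =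
          P powr (1 / real k) * ((D\<^sup>2) ^ k) powr (1 / real k) / (\<omega> ^ (2 * d)) powr (1 / real k)"
        using P0 D0 w0 by (subst powr_divide, simp, simp, subst powr_mult) auto
      ultimately show ?thesis by (simp only:) simp
    qed
    finally have "y \<le> 4 ^ d * (P powr (1 / real k) * D\<^sup>2 * \<omega> powr (- 2 * real d / real k))"
      by (simp add: pos_divide_le_eq mult.commute)
    also have "\<dots> = sigma_const TYPE('k) k * P powr (1 / real k)"
      by (simp add: sigma_const_def degree[symmetric] discriminant_eq D_def \<omega>_def mult_ac)
    finally show "z * \<mu> \<le> sigma_const TYPE('k) k * (\<Prod>a<k. field_norm (h a)) powr (1 / real k)"
      by (simp add: y_def P_def)
  qed
qed

end

section \<open>Lattices in a quadratic space\<close>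

lemma lagrange_value_Suc:
  "lagrange_value (Suc k) h u x = h 0 * (x 0 + (\<Sum>b<k. u 0 (Suc b) * x (Suc b)))\<^sup>2 +
     lagrange_value k (\<lambda>a. h (Suc a)) (\<lambda>a b. u (Suc a) (Suc b)) (\<lambda>a. x (Suc a))"
proof -
  have 1: "(\<Sum>b\<in>{0<..<Suc k}. u 0 b * x b) = (\<Sum>b<k. u 0 (Suc b) * x (Suc b))"
  proof -
    have "{0<..<Suc k} = Suc ` {..<k}"
      by (auto simp: image_iff gr0_conv_Suc)
    thus ?thesis by (simp add: sum.reindex)
  qed
  have 2: "(\<Sum>b\<in>{Suc a<..<Suc k}. u (Suc a) b * x b) = (\<Sum>b\<in>{a<..<k}. u (Suc a) (Suc b) * x (Suc b))" for a
  proof -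
    have "{Suc a<..<Suc k} = Suc ` {a<..<k}"
    proof (rule Set.set_eqI)
      show "x \<in> {Suc a<..<Suc k} \<longleftrightarrow> x \<in> Suc ` {a<..<k}" for x by (cases x) auto
    qed
    thus ?thesis by (simp add: sum.reindex)
  qed
  show ?thesis
    unfolding lagrange_value_def by (subst sum.lessThan_Suc_shift) (simp add: 1 2)
qed

lemma lagrange_value_cong:
  "(\<And>a. a < k \<Longrightarrow> x a = y a) \<Longrightarrow> lagrange_value k h u x = lagrange_value k h u y"
  unfolding lagrange_value_def by (intro sum.cong refl arg_cong2[of _ _ _ _ "(*)"] arg_cong[of _ _ "\<lambda>t. t\<^sup>2"] arg_cong2[of _ _ _ _ "(+)"]) auto

section \<open>Ideals of the ring of integers\<close>

lemma ring_integer_ring: "ring (integer_ring :: 'k::field_char_0 ring)"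
proof (rule ringI)
  show "abelian_group (integer_ring :: 'k ring)"
  proof (rule abelian_groupI)
    fix x :: 'k assume "x \<in> \<O>"
    thus "\<exists>y\<in>\<O>. y \<oplus>\<^bsub>integer_ring\<^esub> x = \<zero>\<^bsub>integer_ring\<^esub>"
      using integers_minus[of x] by (intro bexI[of _ "- x"]) (simp_all add: integer_ring_def)
  qed (use integers_add integers_0 in \<open>auto simp: integer_ring_def\<close>)
  show "Group.monoid (integer_ring :: 'k ring)"
    by (rule monoidI) (use integers_mult integers_1 in \<open>auto simp: integer_ring_def\<close>)
qed (auto simp: integer_ring_def algebra_simps)

lemma ideal_integer_ringI:
  fixes I :: "'k::field_char_0 set"
  assumes "I \<subseteq> \<O>" "0 \<in> I" "\<And>x y. x \<in> I \<Longrightarrow> y \<in> I \<Longrightarrow> x + y \<in> I"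
    "\<And>a x. a \<in> \<O> \<Longrightarrow> x \<in> I \<Longrightarrow> a * x \<in> I"
  shows "ideal I integer_ring"
proof -
  interpret R: ring "integer_ring :: 'k ring" by (rule ring_integer_ring)
  have neg: "\<ominus>\<^bsub>integer_ring\<^esub> x = - x" if "x \<in> \<O>" for x :: 'k
  proof (rule R.minus_equality)
    show "- x \<oplus>\<^bsub>integer_ring\<^esub> x = \<zero>\<^bsub>integer_ring\<^esub>" by (simp add: integer_ring_def)
  qed (use that integers_minus in auto)
  have "- x \<in> I" if "x \<in> I" for x
    using assms(4)[of "- 1" x] integers_minus[OF integers_1] that by simp
  hence "subgroup I (add_monoid integer_ring)"
    using assms(1-3) neg
    by (intro R.add.subgroupI) (auto simp: integer_ring_def)
  moreover have "x \<otimes>\<^bsub>integer_ring\<^esub> a \<in> I" "a \<otimes>\<^bsub>integer_ring\<^esub> x \<in> I" if "a \<in> I" "x \<in> \<O>" for a x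
    using assms(4)[OF that(2,1)] by (simp_all add: integer_ring_def mult.commute)
  ultimately show ?thesis by (intro idealI ring_integer_ring)
qed

text \<open>A single class puts I into the class of the whole ring; an equation a I = b \<O> then
  exhibits b / a as a generator.\<close>

lemma class_number_1_principal:
  fixes I :: "'k::field_char_0 set"
  assumes cn: "class_number TYPE('k) = 1" and I: "I \<in> nonzero_ideals"
  shows "\<exists>g. g \<noteq> 0 \<and> I = (\<lambda>x. g * x) ` \<O>"
proof -
  have one: "\<O> \<in> (nonzero_ideals :: 'k set set)"
  proof -
    have "\<O> \<noteq> {0 :: 'k}" using integers_1 by (metis singletonD zero_neq_one)
    thus ?thesis using ring.oneideal[OF ring_integer_ring] by (simp add: nonzero_ideals_def)
  qed
  have refl: "(\<O>, \<O> :: 'k set) \<in> ideal_equivalence"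
  proof -
    have "\<exists>a\<in>\<O> - {0}. \<exists>b\<in>\<O> - {0}. (\<lambda>x. a * x) ` \<O> = (\<lambda>x. b * x) ` (\<O> :: 'k set)"
      using integers_1 by (intro bexI[of _ 1]) auto
    thus ?thesis unfolding ideal_equivalence_def using one by simp
  qed
  obtain c where c: "(nonzero_ideals :: 'k set set) // ideal_equivalence = {c}"
    using cn unfolding class_number_def by (elim card_1_singletonE)
  have "ideal_equivalence `` {I} \<in> {c}" "ideal_equivalence `` {\<O> :: 'k set} \<in> {c}"
    unfolding c[symmetric] by (rule quotientI[OF I], rule quotientI[OF one])
  hence eq: "ideal_equivalence `` {I} = ideal_equivalence `` {\<O>}" by simp
  have "\<O> \<in> ideal_equivalence `` {I}" unfolding eq by (rule ImageI[OF refl]) simp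
  hence "(I, \<O>) \<in> ideal_equivalence" by (rule Image_singleton_iff[THEN iffD1])
  hence "\<exists>a\<in>\<O> - {0}. \<exists>b\<in>\<O> - {0}. (\<lambda>x. a * x) ` I = (\<lambda>x. b * x) ` \<O>"
    by (simp only: ideal_equivalence_def mem_Collect_eq case_prod_conv simp_thms)
  then obtain a b where ab: "a \<in> \<O> - {0}" "b \<in> \<O> - {0}" "(\<lambda>x. a * x) ` I = (\<lambda>x. b * x) ` \<O>"
    by (elim bexE)
  have a0: "a \<noteq> 0" using ab(1) by simp
  have "I = (\<lambda>x. x / a) ` (\<lambda>x. a * x) ` I" using a0 by (simp add: image_image)
  also have "\<dots> = (\<lambda>x. b / a * x) ` \<O>" unfolding ab(3) by (simp add: image_image)
  finally have "I = (\<lambda>x. b / a * x) ` \<O>" .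
  moreover have "b / a \<noteq> 0" using a0 ab(2) by simp
  ultimately show ?thesis by (intro exI[of _ "b / a"] conjI)
qed

locale quadratic_form_space =
  number_field d w \<nu> + V: finite_dimensional_vector_space smul Basis
  for d :: nat and w :: "nat \<Rightarrow> 'k::field_char_0" and \<nu> :: "nat \<Rightarrow> 'k \<Rightarrow> real"
    and smul :: "'k \<Rightarrow> 'v::ab_group_add \<Rightarrow> 'v" and Basis :: "'v set" +
  fixes Q :: "'v \<Rightarrow> 'k"
  assumes quadratic: "quadratic_space smul Q"
    and positive: "\<And>x. x \<noteq> 0 \<Longrightarrow> totally_positive (Q x)"
begin

section \<open>The bilinear form, generated lattices and minimal vectors\<close>

abbreviation B :: "'v \<Rightarrow> 'v \<Rightarrow> 'k" where "B \<equiv> bilinear_form_of Q"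

lemma Q_smul: "Q (smul a x) = a\<^sup>2 * Q x"
  using quadratic by (simp add: quadratic_space_def)

lemma Q_add: "Q (x + y) = Q x + Q y + 2 * B x y"
  by (simp add: bilinear_form_of_def field_simps)

lemma Q_0: "Q 0 = 0"
  using Q_smul[of 0 0] by simp

lemma B_commute: "B x y = B y x"
  by (simp add: bilinear_form_of_def add.commute)

lemma B_linear: "Vector_Spaces.linear smul (*) (\<lambda>x. B x y)"
  using quadratic by (simp add: quadratic_space_def)

lemma B_add_left: "B (x + y) z = B x z + B y z"
proof -
  interpret Vector_Spaces.linear smul "(*)" "\<lambda>x. B x z" by (rule B_linear)
  show ?thesis by (rule add)
qed

lemma B_smul_left: "B (smul a x) z = a * B x z"
proof -
  interpret Vector_Spaces.linear smul "(*)" "\<lambda>x. B x z" by (rule B_linear)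
  show ?thesis by (rule scale)
qed

lemma B_diff_left: "B (x - y) z = B x z - B y z"
proof -
  interpret Vector_Spaces.linear smul "(*)" "\<lambda>x. B x z" by (rule B_linear)
  show ?thesis by (rule diff)
qed

lemma B_sum_left: "B (\<Sum>i\<in>I. f i) z = (\<Sum>i\<in>I. B (f i) z)"
proof -
  interpret Vector_Spaces.linear smul "(*)" "\<lambda>x. B x z" by (rule B_linear)
  show ?thesis by (rule sum)
qed

lemma B_self: "B x x = Q x"
proof -
  have "Q (x + x) = 4 * Q x" using Q_smul[of 2 x] V.scale_left_distrib[of 1 1 x] by simp
  thus ?thesis by (simp add: bilinear_form_of_def)
qed

lemma Q_eq_0: "Q x = 0 \<longleftrightarrow> x = 0"
proof
  assume "Q x = 0"
  show "x = 0"
  proof (rule ccontr)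
    assume "x \<noteq> 0"
    hence "0 < field_norm (Q x)" by (intro field_norm_pos positive)
    thus False using \<open>Q x = 0\<close> field_norm_eq_0[of 0] by simp
  qed
qed (simp add: Q_0)

lemma norm_Q_pos: "x \<noteq> 0 \<Longrightarrow> 0 < field_norm (Q x)"
  by (intro field_norm_pos positive)

lemma norm_Q_smul: "field_norm (Q (smul a x)) = (field_norm a)\<^sup>2 * field_norm (Q x)"
  by (simp add: Q_smul field_norm_mult field_norm_power)

lemma Q_sum_family: "Q (\<Sum>i<n. smul (c i) (v i)) = (\<Sum>i<n. \<Sum>j<n. c i * c j * B (v i) (v j))"
proof -
  let ?y = "\<Sum>i<n. smul (c i) (v i)"
  have "Q ?y = B ?y ?y" by (simp add: B_self)
  also have "\<dots> = (\<Sum>i<n. c i * B (v i) ?y)" by (simp add: B_sum_left B_smul_left)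
  also have "\<dots> = (\<Sum>i<n. c i * (\<Sum>j<n. c j * B (v i) (v j)))"
  proof (intro sum.cong refl arg_cong2[of _ _ _ _ "(*)"])
    fix i
    have "B (v i) ?y = B ?y (v i)" by (rule B_commute)
    also have "\<dots> = (\<Sum>j<n. c j * B (v j) (v i))" by (simp add: B_sum_left B_smul_left)
    also have "\<dots> = (\<Sum>j<n. c j * B (v i) (v j))" by (simp add: B_commute[of "v i"])
    finally show "B (v i) ?y = (\<Sum>j<n. c j * B (v i) (v j))" .
  qed
  finally show ?thesis by (simp add: sum_distrib_left mult.assoc)
qed

text \<open>Generators form a list that may contain repetitions or dependent vectors, so a
  projection keeps the index n and merely replaces the generators by their images.\<close>

definition gen :: "nat \<Rightarrow> (nat \<Rightarrow> 'v) \<Rightarrow> 'v set" where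
  "gen n g = {\<Sum>i<n. smul (c i) (g i) | c. \<forall>i<n. c i \<in> \<O>}"

lemma gen_memI: "(\<And>i. i < n \<Longrightarrow> c i \<in> \<O>) \<Longrightarrow> (\<Sum>i<n. smul (c i) (g i)) \<in> gen n g"
  unfolding gen_def by blast

lemma gen_memE:
  assumes "x \<in> gen n g"
  obtains c where "\<forall>i<n. c i \<in> \<O>" "x = (\<Sum>i<n. smul (c i) (g i))"
  using assms unfolding gen_def by blast

lemma gen_0: "0 \<in> gen n g"
  using gen_memI[of n "\<lambda>_. 0" g] by (simp add: integers_0)

lemma gen_add: "x \<in> gen n g \<Longrightarrow> y \<in> gen n g \<Longrightarrow> x + y \<in> gen n g"
proof (elim gen_memE)
  fix c c' assume c: "\<forall>i<n. c i \<in> \<O>" "\<forall>i<n. c' i \<in> \<O>"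
    "x = (\<Sum>i<n. smul (c i) (g i))" "y = (\<Sum>i<n. smul (c' i) (g i))"
  have "x + y = (\<Sum>i<n. smul (c i + c' i) (g i))" by (simp add: c V.scale_left_distrib sum.distrib)
  also have "\<dots> \<in> gen n g" using c by (intro gen_memI integers_add) auto
  finally show ?thesis .
qed

lemma gen_smul: "a \<in> \<O> \<Longrightarrow> x \<in> gen n g \<Longrightarrow> smul a x \<in> gen n g"
proof (elim gen_memE)
  fix c assume c: "a \<in> \<O>" "\<forall>i<n. c i \<in> \<O>" "x = (\<Sum>i<n. smul (c i) (g i))"
  have "smul a x = (\<Sum>i<n. smul (a * c i) (g i))" by (simp add: c V.scale_sum_right)
  also have "\<dots> \<in> gen n g" using c by (intro gen_memI integers_mult) auto
  finally show ?thesis .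
qed

lemma gen_diff: "x \<in> gen n g \<Longrightarrow> y \<in> gen n g \<Longrightarrow> x - y \<in> gen n g"
proof -
  assume xy: "x \<in> gen n g" "y \<in> gen n g"
  have "- 1 \<in> (\<O> :: 'k set)" by (rule integers_minus[OF integers_1])
  from gen_add[OF xy(1) gen_smul[OF this xy(2)]] show ?thesis by simp
qed

lemma gen_sum: "(\<And>i. i \<in> I \<Longrightarrow> f i \<in> gen n g) \<Longrightarrow> (\<Sum>i\<in>I. f i) \<in> gen n g"
  by (induction I rule: infinite_finite_induct) (auto simp: gen_0 gen_add)

lemma gen_generator: "i < n \<Longrightarrow> g i \<in> gen n g"
proof -
  assume i: "i < n"
  have "(\<Sum>j<n. smul (if j = i then 1 else 0) (g j)) = (\<Sum>j<n. if j = i then g j else 0)"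
    by (intro sum.cong) auto
  hence "g i = (\<Sum>j<n. smul (if j = i then 1 else 0) (g j))" using i by simp
  also have "\<dots> \<in> gen n g" by (intro gen_memI) (auto simp: integers_0 integers_1)
  finally show ?thesis .
qed

lemma gen_subset: "(\<And>i. i < m \<Longrightarrow> v i \<in> gen n g) \<Longrightarrow> gen m v \<subseteq> gen n g"
  by (auto elim!: gen_memE intro!: gen_sum gen_smul)

lemma gen_subset_span: "gen n g \<subseteq> V.span (g ` {..<n})"
proof
  fix x assume "x \<in> gen n g"
  then obtain c where "\<forall>i<n. c i \<in> \<O>" "x = (\<Sum>i<n. smul (c i) (g i))" by (rule gen_memE)
  moreover have "(\<Sum>i<n. smul (c i) (g i)) \<in> V.span (g ` {..<n})"
    by (intro V.span_sum V.span_scale V.span_base) auto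
  ultimately show "x \<in> V.span (g ` {..<n})" by simp
qed

text \<open>The Gram entries of the generators have a common denominator D, so D Q takes integral
  values on the lattice. The norms of Q at nonzero vectors, multiplied by D^d, are then positive
  integers, and these have a least element.\<close>

lemma minimal_vector_exists:
  assumes "y0 \<in> gen n g" "y0 \<noteq> 0"
  shows "\<exists>v\<in>gen n g. v \<noteq> 0 \<and> (\<forall>y\<in>gen n g. y \<noteq> 0 \<longrightarrow> field_norm (Q v) \<le> field_norm (Q y))"
proof -
  have "finite ((\<lambda>(i, j). B (g i) (g j)) ` ({..<n} \<times> {..<n}))" by simp
  from common_integral_multiple[OF this]
  obtain D :: int where D: "0 < D" "\<forall>a\<in>(\<lambda>(i, j). B (g i) (g j)) ` ({..<n} \<times> {..<n}). of_int D * a \<in> \<O>"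
    by (elim exE conjE)
  have DB: "of_int D * B (g i) (g j) \<in> \<O>" if "i < n" "j < n" for i j
    using D(2) that by (intro D(2)[THEN bspec] image_eqI[of _ _ "(i, j)"]) auto
  have DQ: "of_int D * Q y \<in> \<O>" if y: "y \<in> gen n g" for y
  proof -
    obtain c where c: "\<forall>i<n. c i \<in> \<O>" "y = (\<Sum>i<n. smul (c i) (g i))" using y by (rule gen_memE)
    have "of_int D * Q y = (\<Sum>i<n. \<Sum>j<n. c i * c j * (of_int D * B (g i) (g j)))"
      unfolding c(2) Q_sum_family by (simp add: sum_distrib_left mult_ac)
    also have "\<dots> \<in> \<O>"
    proof (intro integers_sum)
      fix i j assume "i \<in> {..<n}" "j \<in> {..<n}"
      thus "c i * c j * (of_int D * B (g i) (g j)) \<in> \<O>"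
        using c(1) by (intro integers_mult[OF integers_mult DB]) simp_all
    qed
    finally show ?thesis .
  qed
  define f where "f = (\<lambda>y. nat (floor (field_norm (of_int D * Q y))))"
  have f: "real (f y) = real_of_int D ^ d * field_norm (Q y)" if y: "y \<in> gen n g" "y \<noteq> 0" for y
  proof -
    have "field_norm (of_int D * Q y) = real_of_int D ^ d * field_norm (Q y)"
      by (simp add: field_norm_eq nu_mult nu_of_int prod.distrib)
    moreover have "0 < real_of_int D ^ d * field_norm (Q y)" using D(1) norm_Q_pos[OF y(2)] by simp
    ultimately show ?thesis using field_norm_Ints[OF DQ[OF y(1)]] by (simp add: f_def of_int_floor)
  qed
  obtain v where v: "v \<in> gen n g \<and> v \<noteq> 0" "\<forall>y. y \<in> gen n g \<and> y \<noteq> 0 \<longrightarrow> f v \<le> f y"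
    using ex_has_least_nat[of "\<lambda>y. y \<in> gen n g \<and> y \<noteq> 0" y0 f] assms by blast
  have "field_norm (Q v) \<le> field_norm (Q y)" if y: "y \<in> gen n g" "y \<noteq> 0" for y
  proof -
    have "real (f v) \<le> real (f y)" using v(2) y by simp
    hence "real_of_int D ^ d * field_norm (Q v) \<le> real_of_int D ^ d * field_norm (Q y)"
      using f[of v] f[of y] v(1) y by simp
    thus ?thesis using D(1) by (simp add: mult_le_cancel_left_pos)
  qed
  thus ?thesis using v(1) by blast
qed

definition coeff_module :: "'v set \<Rightarrow> 'v \<Rightarrow> 'k set" where
  "coeff_module L v = {a. smul a v \<in> L}"

text \<open>Since Q (a v) = a^2 Q v, minimality of v forces the squared norm of a to be at least
  1.\<close>

lemma coeff_module_norm: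
  assumes "v \<noteq> 0" "\<forall>y\<in>L. y \<noteq> 0 \<longrightarrow> field_norm (Q v) \<le> field_norm (Q y)"
    "a \<in> coeff_module L v" "a \<noteq> 0"
  shows "1 \<le> \<bar>field_norm a\<bar>"
proof -
  have "field_norm (Q v) \<le> field_norm (Q (smul a v))"
    using assms by (auto simp: coeff_module_def)
  hence "1 \<le> (field_norm a)\<^sup>2" using norm_Q_pos[OF assms(1)] by (simp add: norm_Q_smul)
  thus ?thesis by (simp add: abs_le_square_iff[of 1, simplified])
qed

text \<open>Pairing a v with v recovers a as an integral combination of the quotients
  \<open>B (g i) v / Q v\<close>, so a common denominator of these serves every a. It turns the
  fractional ideal into an ideal of the ring of integers.\<close>

lemma coeff_module_integral_multiple:
  assumes "v \<noteq> 0"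
  shows "\<exists>D::int. 0 < D \<and> (\<forall>a\<in>coeff_module (gen n g) v. of_int D * a \<in> \<O>)"
proof -
  have "finite ((\<lambda>i. B (g i) v / Q v) ` {..<n})" by simp
  from common_integral_multiple[OF this]
  obtain D :: int where D: "0 < D" "\<forall>a\<in>(\<lambda>i. B (g i) v / Q v) ` {..<n}. of_int D * a \<in> \<O>"
    by (elim exE conjE)
  have "of_int D * a \<in> \<O>" if "a \<in> coeff_module (gen n g) v" for a
  proof -
    have "smul a v \<in> gen n g" using that by (simp add: coeff_module_def)
    then obtain c where c: "\<forall>i<n. c i \<in> \<O>" "smul a v = (\<Sum>i<n. smul (c i) (g i))" by (rule gen_memE)
    have "a * Q v = B (smul a v) v" by (simp add: B_smul_left B_self)
    also have "\<dots> = (\<Sum>i<n. c i * B (g i) v)" unfolding c(2) by (simp add: B_sum_left B_smul_left)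
    finally have "a = (\<Sum>i<n. c i * B (g i) v) / Q v" using assms by (simp add: Q_eq_0 field_simps)
    hence "of_int D * a = (\<Sum>i<n. c i * (of_int D * (B (g i) v / Q v)))"
      by (simp add: sum_distrib_left sum_divide_distrib mult_ac)
    also have "\<dots> \<in> \<O>"
    proof (rule integers_sum)
      fix i assume "i \<in> {..<n}"
      thus "c i * (of_int D * (B (g i) v / Q v)) \<in> \<O>" using c(1) D(2) by (intro integers_mult[of "c i"]) blast+
    qed
    finally show ?thesis .
  qed
  thus ?thesis using D(1) by blast
qed

text \<open>If the class number is 1, the coefficient module of a minimal vector is principal, and its
  generator times the vector is again minimal.\<close>

lemma good_minimal_vector_exists:
  assumes "y0 \<in> gen n g" "y0 \<noteq> 0"
  shows "\<exists>v\<in>gen n g. v \<noteq> 0 \<and> (\<forall>y\<in>gen n g. y \<noteq> 0 \<longrightarrow> field_norm (Q v) \<le> field_norm (Q y)) \<and>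
    (class_number TYPE('k) = 1 \<longrightarrow> coeff_module (gen n g) v \<subseteq> \<O>)"
proof -
  obtain v where v: "v \<in> gen n g" "v \<noteq> 0" "\<forall>y\<in>gen n g. y \<noteq> 0 \<longrightarrow> field_norm (Q v) \<le> field_norm (Q y)"
    using minimal_vector_exists[OF assms] by blast
  show ?thesis
  proof (cases "class_number TYPE('k) = 1")
    case False
    thus ?thesis using v by blast
  next
    case True
    define A where "A = coeff_module (gen n g) v"
    obtain D :: int where D: "0 < D" "\<forall>a\<in>A. of_int D * a \<in> \<O>"
      using coeff_module_integral_multiple[OF v(2)] unfolding A_def by blast
    define I where "I = (\<lambda>a. of_int D * a) ` A"
    have A1: "1 \<in> A" using v(1) by (simp add: A_def coeff_module_def)
    have "ideal I integer_ring"
    proof (rule ideal_integer_ringI)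
      show "I \<subseteq> \<O>" using D(2) by (auto simp: I_def)
      have "0 \<in> A" by (simp add: A_def coeff_module_def gen_0)
      thus "0 \<in> I" unfolding I_def by (intro image_eqI[of _ _ 0]) auto
    next
      fix x y assume "x \<in> I" "y \<in> I"
      then obtain a b where "a \<in> A" "b \<in> A" "x = of_int D * a" "y = of_int D * b" by (auto simp: I_def)
      moreover from this have "a + b \<in> A" by (simp add: A_def coeff_module_def V.scale_left_distrib gen_add)
      ultimately show "x + y \<in> I" unfolding I_def by (intro image_eqI[of _ _ "a + b"]) (auto simp: distrib_left)
    next
      fix a x :: 'k assume a: "a \<in> \<O>" and "x \<in> I"
      then obtain b where b: "b \<in> A" "x = of_int D * b" by (auto simp: I_def)
      have "smul (a * b) v = smul a (smul b v)" by simp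
      hence "a * b \<in> A" using b(1) gen_smul[OF a, of "smul b v"] by (simp add: A_def coeff_module_def)
      thus "a * x \<in> I" unfolding I_def b(2) by (intro image_eqI[of _ _ "a * b"]) (auto simp: mult_ac)
    qed
    moreover have "I \<noteq> {0}" using A1 D(1) unfolding I_def by (metis (no_types, lifting) imageI mult.right_neutral of_int_eq_0_iff order_less_irrefl singletonD)
    ultimately obtain \<gamma> where \<gamma>: "\<gamma> \<noteq> 0" "I = (\<lambda>x. \<gamma> * x) ` \<O>"
      using class_number_1_principal[OF True, of I] by (auto simp: nonzero_ideals_def)
    define \<alpha> where "\<alpha> = \<gamma> / of_int D"
    have \<alpha>0: "\<alpha> \<noteq> 0" using \<gamma>(1) D(1) by (simp add: \<alpha>_def)
    have A: "A = (\<lambda>x. \<alpha> * x) ` \<O>"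
    proof -
      have "A = (\<lambda>x. x / of_int D) ` I" using D(1) by (simp add: I_def image_image)
      thus ?thesis unfolding \<gamma>(2) by (simp add: image_image \<alpha>_def)
    qed
    have \<alpha>A: "\<alpha> \<in> A" unfolding A using integers_1 by (intro image_eqI[of _ _ 1]) auto
    \<comment> \<open>Minimality bounds the absolute norm of \<alpha> below by 1, and 1 = \<alpha> c
      with c integral bounds it above by 1; hence scaling by \<alpha> preserves the norm of the
      form.\<close>
    obtain c where c: "c \<in> \<O>" "1 = \<alpha> * c" using A1 unfolding A by auto
    have "1 \<le> \<bar>field_norm \<alpha>\<bar>" by (rule coeff_module_norm[OF v(2,3)]) (use \<alpha>A \<alpha>0 in \<open>auto simp: A_def\<close>)
    moreover have "1 \<le> \<bar>field_norm c\<bar>" using c by (intro field_norm_ge_1) auto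
    moreover have "\<bar>field_norm \<alpha>\<bar> * \<bar>field_norm c\<bar> = 1"
      using c(2) by (metis abs_mult abs_one field_norm_1 field_norm_mult)
    ultimately have "\<bar>field_norm \<alpha>\<bar> = 1" by (smt (verit) mult_le_cancel_left1)
    hence "(field_norm \<alpha>)\<^sup>2 = 1" by (metis power2_abs power_one)
    hence "field_norm (Q (smul \<alpha> v)) = field_norm (Q v)" by (simp add: norm_Q_smul)
    moreover have "smul \<alpha> v \<in> gen n g" using \<alpha>A by (simp add: A_def coeff_module_def)
    moreover have "smul \<alpha> v \<noteq> 0" using \<alpha>0 v(2) by simp
    moreover have "coeff_module (gen n g) (smul \<alpha> v) \<subseteq> \<O>"
    proof
      fix a :: 'k assume "a \<in> coeff_module (gen n g) (smul \<alpha> v)"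
      hence "a * \<alpha> \<in> A" by (simp add: coeff_module_def A_def)
      then obtain x where "x \<in> \<O>" "a * \<alpha> = \<alpha> * x" unfolding A by auto
      thus "a \<in> \<O>" using \<alpha>0 by (simp add: mult.commute)
    qed
    ultimately show ?thesis using v(3) by (intro bexI[of _ "smul \<alpha> v"]) auto
  qed
qed

end

section \<open>Orthogonal projection along a minimal vector\<close>

context quadratic_form_space
begin

text \<open>Scaling v by a unit preserves the norm of the form and divides the coefficient module by
  that unit, so minimality and integrality of the coefficients survive the balancing.\<close>

lemma balanced_minimal_vector_exists:
  assumes l: "admissible_lambda TYPE('k) l" and "y0 \<in> gen n g" "y0 \<noteq> 0"
  shows "\<exists>v\<in>gen n g. v \<noteq> 0 \<and> (\<forall>y\<in>gen n g. y \<noteq> 0 \<longrightarrow> field_norm (Q v) \<le> field_norm (Q y)) \<and>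
    (class_number TYPE('k) = 1 \<longrightarrow> coeff_module (gen n g) v \<subseteq> \<O>) \<and>
    (\<forall>p<d. \<forall>q<d. \<nu> p (Q v) \<le> l * \<nu> q (Q v))"
proof -
  obtain v where v: "v \<in> gen n g" "v \<noteq> 0" "\<forall>y\<in>gen n g. y \<noteq> 0 \<longrightarrow> field_norm (Q v) \<le> field_norm (Q y)"
    "class_number TYPE('k) = 1 \<longrightarrow> coeff_module (gen n g) v \<subseteq> \<O>"
    using good_minimal_vector_exists[OF assms(2,3)] by blast
  obtain \<epsilon> where e: "\<epsilon> \<in> \<O>" "1 / \<epsilon> \<in> \<O>" "\<epsilon> \<noteq> 0"
    "\<forall>p<d. \<forall>q<d. \<nu> p (\<epsilon>\<^sup>2 * Q v) \<le> l * \<nu> q (\<epsilon>\<^sup>2 * Q v)"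
    using balancing_unit[OF l positive[OF v(2)]] unfolding ball_embeddings by blast
  have "(field_norm \<epsilon>)\<^sup>2 = 1"
    using field_norm_unit[OF e(1-3)] by (metis power2_abs power_one)
  hence "field_norm (Q (smul \<epsilon> v)) = field_norm (Q v)" by (simp add: norm_Q_smul)
  moreover have "smul \<epsilon> v \<in> gen n g" by (rule gen_smul[OF e(1) v(1)])
  moreover have "smul \<epsilon> v \<noteq> 0" using e(3) v(2) by simp
  moreover have "coeff_module (gen n g) (smul \<epsilon> v) \<subseteq> \<O>" if cn: "class_number TYPE('k) = 1"
  proof
    fix a :: 'k assume "a \<in> coeff_module (gen n g) (smul \<epsilon> v)"
    hence "a * \<epsilon> \<in> coeff_module (gen n g) v" by (simp add: coeff_module_def)
    hence "a * \<epsilon> \<in> \<O>" using v(4) cn by blast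
    from integers_mult[OF this e(2)] show "a \<in> \<O>" using e(3) by simp
  qed
  ultimately show ?thesis using v(3) e(4) by (intro bexI[of _ "smul \<epsilon> v"]) (auto simp: Q_smul)
qed

definition proj :: "'v \<Rightarrow> 'v \<Rightarrow> 'v" where
  "proj v x = x - smul (B x v / Q v) v"

lemma proj_smul: "proj v (smul a x) = smul a (proj v x)"
  by (simp add: proj_def B_smul_left V.scale_right_diff_distrib)

lemma proj_add: "proj v (x + y) = proj v x + proj v y"
  by (simp add: proj_def B_add_left add_divide_distrib V.scale_left_distrib)

lemma proj_diff: "proj v (x - y) = proj v x - proj v y"
  by (simp add: proj_def B_diff_left diff_divide_distrib V.scale_left_diff_distrib)

lemma proj_0: "proj v 0 = 0"
  using proj_smul[of v 0 0] by simp

lemma proj_sum: "proj v (\<Sum>i\<in>I. f i) = (\<Sum>i\<in>I. proj v (f i))"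
  by (induction I rule: infinite_finite_induct) (auto simp: proj_add proj_0)

lemma proj_self: "v \<noteq> 0 \<Longrightarrow> proj v v = 0"
  by (simp add: proj_def B_self Q_eq_0)

lemma B_proj: "v \<noteq> 0 \<Longrightarrow> B (proj v x) v = 0"
  by (simp add: proj_def B_diff_left B_smul_left B_self Q_eq_0)

lemma proj_gen: "proj v ` gen n g = gen n (\<lambda>i. proj v (g i))"
proof (intro equalityI subsetI)
  fix y assume "y \<in> proj v ` gen n g"
  then obtain x where x: "x \<in> gen n g" "y = proj v x" by blast
  from x(1) obtain c where c: "\<forall>i<n. c i \<in> \<O>" "x = (\<Sum>i<n. smul (c i) (g i))" by (rule gen_memE)
  show "y \<in> gen n (\<lambda>i. proj v (g i))" using c(1) unfolding x(2) c(2) proj_sum proj_smul by (intro gen_memI) simp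
next
  fix y assume "y \<in> gen n (\<lambda>i. proj v (g i))"
  then obtain c where c: "\<forall>i<n. c i \<in> \<O>" "y = (\<Sum>i<n. smul (c i) (proj v (g i)))" by (rule gen_memE)
  have "y = proj v (\<Sum>i<n. smul (c i) (g i))" by (simp add: c(2) proj_sum proj_smul)
  moreover have "(\<Sum>i<n. smul (c i) (g i)) \<in> gen n g" using c(1) by (intro gen_memI) simp
  ultimately show "y \<in> proj v ` gen n g" by blast
qed

text \<open>The vector v lies in the span of the generators but not in that of their projections,
  which are orthogonal to it; adding it to the projections recovers the span of the generators. This
  drop in dimension drives the induction.\<close>

lemma dim_proj:
  assumes v: "v \<in> gen n g" "v \<noteq> 0"
  shows "V.dim (g ` {..<n}) = Suc (V.dim ((\<lambda>i. proj v (g i)) ` {..<n}))"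
proof -
  define S where "S = (\<lambda>i. proj v (g i)) ` {..<n}"
  have "B x v = 0" if "x \<in> V.span S" for x
    using that
  proof (induction rule: V.span_induct_alt)
    case base
    show ?case using B_smul_left[of 0 0 v] by simp
  next
    case (step c x y)
    thus ?case using B_proj[OF v(2)] by (auto simp: S_def B_add_left B_smul_left)
  qed
  hence "v \<notin> V.span S" using v(2) B_self[of v] Q_eq_0[of v] by metis
  moreover have "V.span (insert v S) = V.span (g ` {..<n})"
  proof (rule V.span_eq[THEN iffD2], intro conjI subsetI)
    fix x assume "x \<in> insert v S"
    moreover have vs: "v \<in> V.span (g ` {..<n})" using gen_subset_span v(1) by blast
    moreover have "proj v (g i) \<in> V.span (g ` {..<n})" if "i < n" for i
      unfolding proj_def using that by (intro V.span_diff V.span_scale vs V.span_base[of "g i"]) auto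
    ultimately show "x \<in> V.span (g ` {..<n})" by (auto simp: S_def)
  next
    fix x assume "x \<in> g ` {..<n}"
    then obtain i where i: "i < n" "x = g i" by auto
    have "x = proj v (g i) + smul (B (g i) v / Q v) v" by (simp add: proj_def i)
    also have "\<dots> \<in> V.span (insert v S)"
      using i by (intro V.span_add V.span_scale V.span_base) (auto simp: S_def)
    finally show "x \<in> V.span (insert v S)" .
  qed
  ultimately have "V.dim (g ` {..<n}) = V.dim S + 1"
    by (metis V.dim_insert V.dim_span)
  thus ?thesis by (simp add: S_def)
qed

lemma gen_Suc_memI:
  assumes "a \<in> \<O>" "\<And>j. j < m \<Longrightarrow> c j \<in> \<O>"
  shows "smul a (v 0) + (\<Sum>j<m. smul (c j) (v (Suc j))) \<in> gen (Suc m) v"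
proof -
  have "smul a (v 0) + (\<Sum>j<m. smul (c j) (v (Suc j))) = (\<Sum>i<Suc m. smul (case_nat a c i) (v i))"
    by (subst sum.lessThan_Suc_shift) simp
  also have "\<dots> \<in> gen (Suc m) v" using assms by (intro gen_memI) (auto split: nat.split)
  finally show ?thesis .
qed

text \<open>Subtracting the lifts, with the coefficients found in the projection, leaves a lattice
  vector whose projection vanishes, hence a multiple of \<open>v 0\<close>.\<close>

lemma lift_decomposition:
  assumes v0: "v 0 \<noteq> 0" and v: "\<And>j. j < m \<Longrightarrow> v (Suc j) \<in> gen n g"
    and v': "\<And>j. j < m \<Longrightarrow> proj (v 0) (v (Suc j)) = v' j"
    and x: "x \<in> gen n g" "proj (v 0) x \<in> gen m v'"
  shows "\<exists>c a. (\<forall>j<m. c j \<in> \<O>) \<and> a \<in> coeff_module (gen n g) (v 0) \<and>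
    x = smul a (v 0) + (\<Sum>j<m. smul (c j) (v (Suc j)))"
proof -
  obtain c where c: "\<forall>i<m. c i \<in> \<O>" "proj (v 0) x = (\<Sum>i<m. smul (c i) (v' i))" using x(2) by (rule gen_memE)
  define y where "y = x - (\<Sum>j<m. smul (c j) (v (Suc j)))"
  have y: "y \<in> gen n g" unfolding y_def using c(1) v x(1) by (intro gen_diff gen_sum gen_smul) auto
  have "proj (v 0) y = proj (v 0) x - (\<Sum>j<m. smul (c j) (proj (v 0) (v (Suc j))))"
    unfolding y_def proj_diff proj_sum proj_smul ..
  also have "\<dots> = 0" by (simp add: c(2) v')
  finally have "y = smul (B y (v 0) / Q (v 0)) (v 0)" by (simp add: proj_def)
  hence "B y (v 0) / Q (v 0) \<in> coeff_module (gen n g) (v 0)" using y by (simp add: coeff_module_def)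
  moreover have "x = y + (\<Sum>j<m. smul (c j) (v (Suc j)))" by (simp add: y_def)
  hence "x = smul (B y (v 0) / Q (v 0)) (v 0) + (\<Sum>j<m. smul (c j) (v (Suc j)))"
    using \<open>y = smul (B y (v 0) / Q (v 0)) (v 0)\<close> by (metis)
  ultimately show ?thesis using c(1) by (intro exI[of _ c] exI[of _ "B y (v 0) / Q (v 0)"]) simp
qed

text \<open>Bounds the index of L in K through finite sets of pairwise incongruent elements, so that
  finiteness of the quotient comes out as a consequence.\<close>

definition incongruent_bound :: "'v set \<Rightarrow> 'v set \<Rightarrow> real \<Rightarrow> bool" where
  "incongruent_bound K L b \<longleftrightarrow>
     (\<forall>X. finite X \<and> X \<subseteq> K \<and> (\<forall>x\<in>X. \<forall>y\<in>X. x \<noteq> y \<longrightarrow> x - y \<notin> L) \<longrightarrow> real (card X) \<le> b)"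

lemma incongruent_boundD:
  assumes "incongruent_bound K L b" "finite X" "X \<subseteq> K" "\<And>x y. x \<in> X \<Longrightarrow> y \<in> X \<Longrightarrow> x \<noteq> y \<Longrightarrow> x - y \<notin> L"
  shows "real (card X) \<le> b"
  using assms unfolding incongruent_bound_def by blast

definition minkowski_const :: real where
  "minkowski_const = fact d / real d ^ d * \<bar>embedding_det d \<nu> w\<bar>"

lemma minkowski_const_eq: "minkowski_const = fact d / real d ^ d * sqrt \<bar>field_discriminant TYPE('k)\<bar>"
  by (simp add: minkowski_const_def sqrt_abs_discriminant)

lemma minkowski_const_nonneg: "0 \<le> minkowski_const"
  by (simp add: minkowski_const_def)

text \<open>Sort the incongruent elements by the classes of their projections, of which there are at
  most b. Within one class, the difference from a fixed representative is a combination of the lifts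
  plus a coefficient times \<open>v 0\<close>; distinct elements have coefficients that are
  incongruent modulo the ring of integers, so \<open>fractional_index_bound\<close> limits their
  number.\<close>

lemma incongruent_bound_lift:
  assumes v0: "v 0 \<in> gen n g" "v 0 \<noteq> 0"
    and min: "\<forall>y\<in>gen n g. y \<noteq> 0 \<longrightarrow> field_norm (Q (v 0)) \<le> field_norm (Q y)"
    and v: "\<And>j. j < m \<Longrightarrow> v (Suc j) \<in> gen n g"
    and v': "\<And>j. j < m \<Longrightarrow> proj (v 0) (v (Suc j)) = v' j"
    and b: "incongruent_bound (gen n (\<lambda>i. proj (v 0) (g i))) (gen m v') b"
  shows "incongruent_bound (gen n g) (gen (Suc m) v) (minkowski_const * b)"
  unfolding incongruent_bound_def
proof (intro allI impI, elim conjE)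
  fix X assume X: "finite X" "X \<subseteq> gen n g" and inc: "\<forall>x\<in>X. \<forall>y\<in>X. x \<noteq> y \<longrightarrow> x - y \<notin> gen (Suc m) v"
  define \<pi> where "\<pi> = proj (v 0)"
  define cl where "cl = (\<lambda>x. {y \<in> X. \<pi> x - \<pi> y \<in> gen m v'})"
  have refl: "x \<in> cl x" if "x \<in> X" for x using that by (simp add: cl_def gen_0)
  have cl_eq: "cl x = cl y" if xy: "\<pi> x - \<pi> y \<in> gen m v'" for x y
  proof -
    have yx: "\<pi> y - \<pi> x \<in> gen m v'" using gen_diff[OF gen_0 xy] by simp
    have "\<pi> y - \<pi> z \<in> gen m v'" if "\<pi> x - \<pi> z \<in> gen m v'" for z using gen_add[OF yx that] by simp
    moreover have "\<pi> x - \<pi> z \<in> gen m v'" if "\<pi> y - \<pi> z \<in> gen m v'" for z using gen_add[OF xy that] by simp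
    ultimately show ?thesis unfolding cl_def by blast
  qed
  \<comment> \<open>The choice depends only on the set \<open>cl x\<close>, so elements with
    congruent projections receive the same representative.\<close>
  define r where "r = (\<lambda>x. SOME y. y \<in> cl x)"
  have r: "r x \<in> cl x" if "x \<in> X" for x unfolding r_def using refl[OF that] by (rule someI)
  have rX: "r x \<in> X" if "x \<in> X" for x using r[OF that] by (simp add: cl_def)
  have r_eq: "r x = r y" if "\<pi> x - \<pi> y \<in> gen m v'" for x y unfolding r_def cl_eq[OF that] ..
  have rr: "\<pi> x - \<pi> (r x) \<in> gen m v'" if "x \<in> X" for x using r[OF that] by (simp add: cl_def)
  define R where "R = r ` X"
  have finR: "finite R" using X by (simp add: R_def)
  have R_inc: "x = y" if xy: "x \<in> R" "y \<in> R" "\<pi> x - \<pi> y \<in> gen m v'" for x y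
  proof -
    obtain x' y' where x': "x' \<in> X" "x = r x'" and y': "y' \<in> X" "y = r y'" using xy by (auto simp: R_def)
    have "r x' = r x" using r_eq[OF rr[OF x'(1)]] x'(2) by simp
    moreover have "r y' = r y" using r_eq[OF rr[OF y'(1)]] y'(2) by simp
    moreover have "r x = r y" by (rule r_eq[OF xy(3)])
    ultimately show ?thesis using x' y' by simp
  qed
  have inj: "inj_on \<pi> R" by (rule inj_onI, rule R_inc) (auto simp: gen_0)
  have "real (card (\<pi> ` R)) \<le> b"
  proof (rule incongruent_boundD[OF b])
    show "finite (\<pi> ` R)" using finR by simp
    have "R \<subseteq> gen n g" using X rX by (auto simp: R_def)
    thus "\<pi> ` R \<subseteq> gen n (\<lambda>i. proj (v 0) (g i))" unfolding proj_gen[symmetric] \<pi>_def by blast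
    fix s t assume "s \<in> \<pi> ` R" "t \<in> \<pi> ` R" "s \<noteq> t"
    thus "s - t \<notin> gen m v'" using R_inc by blast
  qed
  hence cR: "real (card R) \<le> b" by (simp add: card_image[OF inj])
  define A where "A = coeff_module (gen n g) (v 0)"
  have fiber: "real (card {x \<in> X. r x = \<rho>}) \<le> minkowski_const" if \<rho>: "\<rho> \<in> R" for \<rho>
  proof -
    define Y where "Y = {x \<in> X. r x = \<rho>}"
    have \<rho>X: "\<rho> \<in> X" using \<rho> rX by (auto simp: R_def)
    have "\<forall>x\<in>Y. \<exists>c a. (\<forall>j<m. c j \<in> \<O>) \<and> a \<in> A \<and> x - \<rho> = smul a (v 0) + (\<Sum>j<m. smul (c j) (v (Suc j)))"
    proof
      fix x assume x: "x \<in> Y"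
      have "x - \<rho> \<in> gen n g" using x \<rho>X X by (intro gen_diff) (auto simp: Y_def)
      moreover have "proj (v 0) (x - \<rho>) \<in> gen m v'"
        using rr[of x] x by (simp add: Y_def proj_diff \<pi>_def)
      ultimately show "\<exists>c a. (\<forall>j<m. c j \<in> \<O>) \<and> a \<in> A \<and> x - \<rho> = smul a (v 0) + (\<Sum>j<m. smul (c j) (v (Suc j)))"
        unfolding A_def by (intro lift_decomposition[of v, OF v0(2) v v'])
    qed
    then obtain c a where ca: "\<And>x. x \<in> Y \<Longrightarrow> \<forall>j<m. c x j \<in> \<O>" "\<And>x. x \<in> Y \<Longrightarrow> a x \<in> A"
      "\<And>x. x \<in> Y \<Longrightarrow> x - \<rho> = smul (a x) (v 0) + (\<Sum>j<m. smul (c x j) (v (Suc j)))"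
      unfolding bchoice_iff by blast
    have key: "x = y" if xy: "x \<in> Y" "y \<in> Y" "a x - a y \<in> \<O>" for x y
    proof -
      have "x - y = (x - \<rho>) - (y - \<rho>)" by simp
      also have "\<dots> = smul (a x - a y) (v 0) + (\<Sum>j<m. smul (c x j - c y j) (v (Suc j)))"
        unfolding ca(3)[OF xy(1)] ca(3)[OF xy(2)]
        by (simp add: V.scale_left_diff_distrib sum_subtractf algebra_simps)
      also have "\<dots> \<in> gen (Suc m) v"
        using ca(1)[OF xy(1)] ca(1)[OF xy(2)] by (intro gen_Suc_memI xy(3)) (auto intro: integers_diff)
      finally show ?thesis using inc xy by (auto simp: Y_def)
    qed
    have "inj_on a Y" by (rule inj_onI, rule key) (auto simp: integers_0)
    hence "card Y = card (a ` Y)" by (simp add: card_image)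
    also have "real \<dots> \<le> minkowski_const"
      unfolding minkowski_const_eq
    proof (rule fractional_index_bound)
      fix p q assume "p \<in> A" "q \<in> A"
      thus "p - q \<in> A" by (simp add: A_def coeff_module_def V.scale_left_diff_distrib gen_diff)
    next
      show "\<O> \<subseteq> A" using v0(1) by (auto simp: A_def coeff_module_def intro: gen_smul)
      show "finite (a ` Y)" "a ` Y \<subseteq> A" using X ca(2) by (auto simp: Y_def)
    next
      fix p assume "p \<in> A" "p \<noteq> 0"
      thus "1 \<le> \<bar>field_norm p\<bar>" unfolding A_def by (rule coeff_module_norm[OF v0(2) min])
    next
      fix p q assume "p \<in> a ` Y" "q \<in> a ` Y" "p \<noteq> q"
      thus "p - q \<notin> \<O>" using key by auto
    qed
    finally show ?thesis by (simp add: Y_def)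
  qed
  have "real (card X) = (\<Sum>x\<in>X. 1)" by simp
  also have "\<dots> = (\<Sum>\<rho>\<in>R. \<Sum>x\<in>{x \<in> X. r x = \<rho>}. 1)" unfolding R_def by (rule sum.image_gen[OF X(1)])
  also have "\<dots> = (\<Sum>\<rho>\<in>R. real (card {x \<in> X. r x = \<rho>}))" by simp
  also have "\<dots> \<le> (\<Sum>\<rho>\<in>R. minkowski_const)" by (intro sum_mono fiber)
  also have "\<dots> = minkowski_const * real (card R)" by simp
  also have "\<dots> \<le> minkowski_const * b" using cR minkowski_const_nonneg by (rule mult_left_mono)
  finally show "real (card X) \<le> minkowski_const * b" .
qed

text \<open>What the induction carries. The minimality clause ranges over all of L, not only over
  the submodule generated by v; this makes the minima of both agree. The clause on tails bounds the
  norm of each outer coefficient by the norms of the form that starts at its index, which is the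
  hypothesis of Minkowski's bound.\<close>

definition reduced_family :: "real \<Rightarrow> nat \<Rightarrow> 'v set \<Rightarrow> (nat \<Rightarrow> 'v) \<Rightarrow> (nat \<Rightarrow> 'k) \<Rightarrow> (nat \<Rightarrow> nat \<Rightarrow> 'k) \<Rightarrow> bool" where
  "reduced_family l m L v h u \<longleftrightarrow>
     (\<forall>i<m. v i \<in> L) \<and>
     (\<forall>x. Q (\<Sum>i<m. smul (x i) (v i)) = lagrange_value m h u x) \<and>
     (\<forall>i<m. totally_positive (h i)) \<and>
     (\<forall>i<m. \<forall>p<d. \<forall>q<d. \<nu> p (h i) \<le> l * \<nu> q (h i)) \<and>
     (\<forall>i j. i < j \<and> j < m \<longrightarrow> (\<forall>p<d. \<bar>\<nu> p (u i j)\<bar> \<le> beta_const TYPE('k))) \<and>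
     (0 < m \<longrightarrow> h 0 = Q (v 0) \<and> (\<forall>y\<in>L. y \<noteq> 0 \<longrightarrow> field_norm (h 0) \<le> field_norm (Q y))) \<and>
     (\<forall>i<m. \<forall>x. (\<forall>j<m - i. x j \<in> \<O>) \<and> (\<exists>j<m - i. x j \<noteq> 0) \<longrightarrow>
        field_norm (h i) \<le> field_norm (lagrange_value (m - i) (\<lambda>a. h (i + a)) (\<lambda>a b. u (i + a) (i + b)) x)) \<and>
     incongruent_bound L (gen m v) (minkowski_const ^ m) \<and>
     (class_number TYPE('k) = 1 \<longrightarrow> L \<subseteq> gen m v)"

lemma
  assumes "reduced_family l m L v h u"
  shows reduced_family_mem: "i < m \<Longrightarrow> v i \<in> L"
    and reduced_family_expansion: "Q (\<Sum>i<m. smul (x i) (v i)) = lagrange_value m h u x"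
    and reduced_family_pos: "i < m \<Longrightarrow> totally_positive (h i)"
    and reduced_family_balanced: "i < m \<Longrightarrow> p < d \<Longrightarrow> q < d \<Longrightarrow> \<nu> p (h i) \<le> l * \<nu> q (h i)"
    and reduced_family_beta: "i < j \<Longrightarrow> j < m \<Longrightarrow> p < d \<Longrightarrow> \<bar>\<nu> p (u i j)\<bar> \<le> beta_const TYPE('k)"
    and reduced_family_first: "0 < m \<Longrightarrow> h 0 = Q (v 0)"
    and reduced_family_min: "0 < m \<Longrightarrow> y \<in> L \<Longrightarrow> y \<noteq> 0 \<Longrightarrow> field_norm (h 0) \<le> field_norm (Q y)"
    and reduced_family_tail: "i < m \<Longrightarrow> \<forall>j<m - i. x j \<in> \<O> \<Longrightarrow> \<exists>j<m - i. x j \<noteq> 0 \<Longrightarrow>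
        field_norm (h i) \<le> field_norm (lagrange_value (m - i) (\<lambda>a. h (i + a)) (\<lambda>a b. u (i + a) (i + b)) x)"
    and reduced_family_index: "incongruent_bound L (gen m v) (minkowski_const ^ m)"
    and reduced_family_class_number: "class_number TYPE('k) = 1 \<Longrightarrow> L \<subseteq> gen m v"
proof -
  show "field_norm (h 0) \<le> field_norm (Q y)" if "0 < m" "y \<in> L" "y \<noteq> 0"
  proof -
    have "0 < m \<longrightarrow> h 0 = Q (v 0) \<and> (\<forall>y\<in>L. y \<noteq> 0 \<longrightarrow> field_norm (h 0) \<le> field_norm (Q y))"
      using assms unfolding reduced_family_def by (elim conjE)
    thus ?thesis using that by blast
  qed
qed (use assms in \<open>simp_all add: reduced_family_def\<close>)

lemma nu_lagrange_value_nonneg: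
  assumes "\<And>a. a < k \<Longrightarrow> totally_positive (h a)" "p < d"
  shows "0 \<le> \<nu> p (lagrange_value k h u x)"
  unfolding lagrange_value_def nu_sum[OF assms(2)] nu_mult[OF assms(2)] nu_power[OF assms(2)]
  using assms by (intro sum_nonneg mult_nonneg_nonneg) (auto simp: totally_positive_iff less_imp_le)

text \<open>In the embedding numbered 0, which exists because the degree is positive, all summands
  are nonnegative, so each vanishes. By the triangular shape the later variables vanish first, and
  then the leading one.\<close>

lemma lagrange_value_eq_0:
  fixes h x :: "nat \<Rightarrow> 'k"
  assumes "\<And>a. a < k \<Longrightarrow> totally_positive (h a)" "lagrange_value k h u x = 0" "a < k"
  shows "x a = 0"
  using assms
proof (induction k arbitrary: h u x a)
  case 0
  thus ?case by simp
next
  case (Suc k)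
  define t where "t = x 0 + (\<Sum>b<k. u 0 (Suc b) * x (Suc b))"
  define q where "q = lagrange_value k (\<lambda>a. h (Suc a)) (\<lambda>a b. u (Suc a) (Suc b)) (\<lambda>a. x (Suc a))"
  have sum0: "h 0 * t\<^sup>2 + q = 0" using Suc.prems(2) by (simp add: lagrange_value_Suc t_def q_def)
  have "\<nu> 0 (h 0) * (\<nu> 0 t)\<^sup>2 + \<nu> 0 q = 0"
    using arg_cong[OF sum0, of "\<nu> 0"] degree_pos by (simp add: nu_add nu_mult nu_power nu_0)
  moreover have h0: "0 < \<nu> 0 (h 0)" using Suc.prems(1)[of 0] degree_pos by (simp add: totally_positive_iff)
  moreover have "0 \<le> \<nu> 0 q" unfolding q_def using Suc.prems(1) degree_pos by (intro nu_lagrange_value_nonneg) auto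
  moreover have "0 \<le> \<nu> 0 (h 0) * (\<nu> 0 t)\<^sup>2" using h0 by simp
  ultimately have "\<nu> 0 (h 0) * (\<nu> 0 t)\<^sup>2 = 0" "\<nu> 0 q = 0" by linarith+
  hence t0: "t = 0" and q0: "q = 0" using h0 degree_pos by (auto simp: nu_eq_0 nu_0)
  have rest: "x (Suc b) = 0" if "b < k" for b
    using Suc.IH[of "\<lambda>a. h (Suc a)" "\<lambda>a b. u (Suc a) (Suc b)" "\<lambda>a. x (Suc a)" b] Suc.prems(1) q0 that
    by (simp add: q_def)
  have "x 0 = 0" using t0 rest by (simp add: t_def)
  thus ?case using rest Suc.prems(3) by (cases a) auto
qed

lemma reduced_family_0:
  assumes "V.dim (g ` {..<n}) = 0"
  shows "reduced_family l 0 (gen n g) v h u"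
proof -
  have "g ` {..<n} \<subseteq> {0}" using assms by simp
  hence "gen n g \<subseteq> {0}" by (auto elim!: gen_memE simp: image_subset_iff)
  moreover have "0 \<in> gen 0 v" by (rule gen_0)
  moreover have "real (card X) \<le> 1" if "X \<subseteq> {0}" for X :: "'v set"
    using card_mono[OF _ that] by simp
  ultimately show ?thesis
    unfolding reduced_family_def incongruent_bound_def lagrange_value_def
    by (auto simp: Q_0 dest: subset_trans)
qed

text \<open>Translating the lifts by integral multiples of \<open>v0\<close> changes neither their
  projections nor the form on the later indices. Only the first row of inner coefficients moves, and
  there rounding brings every conjugate within \<beta>.\<close>

lemma reduced_family_Suc:
  assumes l: "admissible_lambda TYPE('k) l" and dim: "V.dim (g ` {..<n}) = Suc m"
    and IH: "\<And>g. V.dim (g ` {..<n}) = m \<Longrightarrow> \<exists>v h u. reduced_family l m (gen n g) v h u"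
  shows "\<exists>v h u. reduced_family l (Suc m) (gen n g) v h u"
proof -
  have "\<not> g ` {..<n} \<subseteq> {0}" using dim by (metis V.dim_eq_0 Zero_neq_Suc)
  then obtain i where "i < n" "g i \<noteq> 0" by auto
  then obtain v0 where v0: "v0 \<in> gen n g" "v0 \<noteq> 0"
    "\<forall>y\<in>gen n g. y \<noteq> 0 \<longrightarrow> field_norm (Q v0) \<le> field_norm (Q y)"
    "class_number TYPE('k) = 1 \<longrightarrow> coeff_module (gen n g) v0 \<subseteq> \<O>"
    "\<forall>p<d. \<forall>q<d. \<nu> p (Q v0) \<le> l * \<nu> q (Q v0)"
    using balanced_minimal_vector_exists[OF l gen_generator] by blast
  define g' where "g' = (\<lambda>i. proj v0 (g i))"
  have "V.dim (g' ` {..<n}) = m" using dim_proj[OF v0(1,2)] dim by (simp add: g'_def)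
  from IH[OF this] obtain v' h' u' where red: "reduced_family l m (gen n g') v' h' u'" by blast
  have v'_in: "v' j \<in> proj v0 ` gen n g" if "j < m" for j
    using reduced_family_mem[OF red that] unfolding g'_def proj_gen .
  have "\<forall>j. \<exists>y. j < m \<longrightarrow> y \<in> gen n g \<and> proj v0 y = v' j"
  proof
    fix j
    show "\<exists>y. j < m \<longrightarrow> y \<in> gen n g \<and> proj v0 y = v' j"
    proof (cases "j < m")
      case True
      from v'_in[OF True] obtain y where "y \<in> gen n g" "v' j = proj v0 y" by (elim imageE)
      thus ?thesis by (intro exI[of _ y]) simp
    qed simp
  qed
  then obtain y where y: "\<And>j. j < m \<Longrightarrow> y j \<in> gen n g" "\<And>j. j < m \<Longrightarrow> proj v0 (y j) = v' j"
    unfolding choice_iff by blast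
  have "\<forall>j. \<exists>a. a \<in> \<O> \<and> (\<forall>p<d. \<bar>\<nu> p (B (y j) v0 / Q v0) - \<nu> p a\<bar> \<le> beta_const TYPE('k))"
  proof
    fix j
    from integer_within_beta[of "\<lambda>p. \<nu> p (B (y j) v0 / Q v0)"]
    show "\<exists>a. a \<in> \<O> \<and> (\<forall>p<d. \<bar>\<nu> p (B (y j) v0 / Q v0) - \<nu> p a\<bar> \<le> beta_const TYPE('k))"
      by (simp only: Bex_def)
  qed
  then obtain a where a: "\<And>j. a j \<in> \<O>"
    "\<And>j p. p < d \<Longrightarrow> \<bar>\<nu> p (B (y j) v0 / Q v0) - \<nu> p (a j)\<bar> \<le> beta_const TYPE('k)"
    unfolding choice_iff by blast
  \<comment> \<open>The coefficient of \<open>v0\<close> in the translated lift, whose remaining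
    part is \<open>v' j\<close>; it becomes the inner coefficient at row 0 and column j + 1.\<close>
  define u0 where "u0 = (\<lambda>j. B (y j) v0 / Q v0 - a j)"
  define v where "v = case_nat v0 (\<lambda>j. y j - smul (a j) v0)"
  define h where "h = case_nat (Q v0) h'"
  define u where "u = (\<lambda>i j. case i of 0 \<Rightarrow> u0 (j - 1) | Suc i' \<Rightarrow> u' i' (j - 1))"
  have simps: "v 0 = v0" "\<And>j. v (Suc j) = y j - smul (a j) v0" "h 0 = Q v0" "\<And>i. h (Suc i) = h' i"
    "\<And>j. u 0 (Suc j) = u0 j" "\<And>i j. u (Suc i) (Suc j) = u' i j"
    by (auto simp: v_def h_def u_def)
  have vS: "v (Suc j) \<in> gen n g" if "j < m" for j
    unfolding simps using y(1)[OF that] a(1) v0(1) by (intro gen_diff gen_smul)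
  have pv: "proj (v 0) (v (Suc j)) = v' j" if "j < m" for j
    using y(2)[OF that] v0(2) by (simp add: simps proj_diff proj_smul proj_self)
  have vdec: "v (Suc j) = v' j + smul (u0 j) v0" if "j < m" for j
  proof -
    have "v' j = y j - smul (B (y j) v0 / Q v0) v0" using y(2)[OF that] by (simp add: proj_def)
    thus ?thesis by (simp add: simps u0_def V.scale_left_diff_distrib)
  qed
  have orth: "B (v' j) v0 = 0" if "j < m" for j using B_proj[OF v0(2)] y(2)[OF that] by metis
  have expansion: "Q (\<Sum>i<Suc m. smul (x i) (v i)) = lagrange_value (Suc m) h u x" for x
  proof -
    define t where "t = x 0 + (\<Sum>j<m. u0 j * x (Suc j))"
    define z where "z = (\<Sum>j<m. smul (x (Suc j)) (v' j))"
    have "(\<Sum>i<Suc m. smul (x i) (v i)) = smul (x 0) v0 + (\<Sum>j<m. smul (x (Suc j)) (v (Suc j)))"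
      by (subst sum.lessThan_Suc_shift) (simp add: simps(1))
    also have "(\<Sum>j<m. smul (x (Suc j)) (v (Suc j))) = (\<Sum>j<m. smul (x (Suc j)) (v' j) + smul (u0 j * x (Suc j)) v0)"
      by (intro sum.cong refl) (simp add: vdec V.scale_right_distrib mult.commute)
    also have "\<dots> = z + smul (\<Sum>j<m. u0 j * x (Suc j)) v0" by (simp add: z_def sum.distrib V.scale_sum_left)
    also have "smul (x 0) v0 + \<dots> = smul t v0 + z" by (simp add: t_def V.scale_left_distrib)
    finally have "Q (\<Sum>i<Suc m. smul (x i) (v i)) = t\<^sup>2 * Q v0 + Q z + 2 * B (smul t v0) z"
      by (simp add: Q_add Q_smul)
    also have "B (smul t v0) z = t * B z v0" by (simp add: B_smul_left B_commute[of v0])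
    also have "B z v0 = 0" by (simp add: z_def B_sum_left B_smul_left orth)
    also have "Q z = lagrange_value m h' u' (\<lambda>j. x (Suc j))"
      unfolding z_def by (rule reduced_family_expansion[OF red])
    finally show ?thesis by (simp add: lagrange_value_Suc simps t_def mult.commute)
  qed
  have hpos: "totally_positive (h i)" if "i < Suc m" for i
    using that reduced_family_pos[OF red] positive[OF v0(2)] by (cases i) (auto simp: simps)
  have v_in: "v i \<in> gen n g" if "i < Suc m" for i
    using that vS v0(1) by (cases i) (auto simp: simps(1))
  have "reduced_family l (Suc m) (gen n g) v h u"
    unfolding reduced_family_def
  proof (intro conjI)
    show "\<forall>i<Suc m. v i \<in> gen n g" using v_in by blast
    show "\<forall>x. Q (\<Sum>i<Suc m. smul (x i) (v i)) = lagrange_value (Suc m) h u x" by (intro allI expansion)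
    show "\<forall>i<Suc m. totally_positive (h i)" using hpos by blast
    show "\<forall>i<Suc m. \<forall>p<d. \<forall>q<d. \<nu> p (h i) \<le> l * \<nu> q (h i)"
    proof (intro allI impI)
      fix i p q assume "i < Suc m" "p < d" "q < d"
      thus "\<nu> p (h i) \<le> l * \<nu> q (h i)"
        using reduced_family_balanced[OF red] v0(5) by (cases i) (auto simp: simps)
    qed
    show "\<forall>i j. i < j \<and> j < Suc m \<longrightarrow> (\<forall>p<d. \<bar>\<nu> p (u i j)\<bar> \<le> beta_const TYPE('k))"
    proof (intro allI impI)
      fix i j p assume ij: "i < j \<and> j < Suc m" and p: "p < d"
      then obtain j' where j': "j = Suc j'" by (cases j) auto
      show "\<bar>\<nu> p (u i j)\<bar> \<le> beta_const TYPE('k)"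
      proof (cases i)
        case 0
        thus ?thesis using a(2)[OF p, of j'] p by (simp add: j' simps u0_def nu_diff)
      next
        case (Suc i')
        thus ?thesis using reduced_family_beta[OF red, of i' j' p] ij p by (simp add: j' simps)
      qed
    qed
    show "0 < Suc m \<longrightarrow> h 0 = Q (v 0) \<and> (\<forall>y\<in>gen n g. y \<noteq> 0 \<longrightarrow> field_norm (h 0) \<le> field_norm (Q y))"
      using v0(3) by (simp add: simps)
    show "\<forall>i<Suc m. \<forall>x. (\<forall>j<Suc m - i. x j \<in> \<O>) \<and> (\<exists>j<Suc m - i. x j \<noteq> 0) \<longrightarrow>
        field_norm (h i) \<le> field_norm (lagrange_value (Suc m - i) (\<lambda>a. h (i + a)) (\<lambda>a b. u (i + a) (i + b)) x)"
    proof (intro allI impI, elim conjE)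
      fix i and x :: "nat \<Rightarrow> 'k" assume i: "i < Suc m" and x: "\<forall>j<Suc m - i. x j \<in> \<O>" "\<exists>j<Suc m - i. x j \<noteq> 0"
      show "field_norm (h i) \<le> field_norm (lagrange_value (Suc m - i) (\<lambda>a. h (i + a)) (\<lambda>a b. u (i + a) (i + b)) x)"
      proof (cases i)
        case 0
        let ?y = "\<Sum>i<Suc m. smul (x i) (v i)"
        have "?y \<in> gen n g" using x(1) v_in 0 by (intro gen_sum gen_smul) auto
        \<comment> \<open>Positive definiteness turns a nonzero coefficient vector into a nonzero
          lattice vector, to which the minimality of \<open>v0\<close> over the whole lattice
          applies.\<close>
        moreover have "?y \<noteq> 0"
        proof
          assume "?y = 0"
          hence lv: "lagrange_value (Suc m) h u x = 0" using expansion[of x] Q_0 by simp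
          obtain j where j: "j < Suc m" "x j \<noteq> 0" using x(2) 0 by auto
          have "x j = 0"
          proof (rule lagrange_value_eq_0[OF _ lv j(1)])
            show "totally_positive (h a)" if "a < Suc m" for a using that by (rule hpos)
          qed
          thus False using j(2) by simp
        qed
        ultimately have "field_norm (h 0) \<le> field_norm (Q ?y)" using v0(3) unfolding simps(3) by blast
        thus ?thesis unfolding expansion by (simp add: 0)
      next
        case (Suc i')
        hence i': "i' < m" using i by simp
        have "field_norm (h' i') \<le> field_norm (lagrange_value (m - i') (\<lambda>a. h' (i' + a)) (\<lambda>a b. u' (i' + a) (i' + b)) x)"
          by (rule reduced_family_tail[OF red i']) (use x in \<open>simp_all add: Suc\<close>)
        thus ?thesis by (simp add: Suc simps)
      qed
    qed
    have "incongruent_bound (gen n g) (gen (Suc m) v) (minkowski_const * minkowski_const ^ m)"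
    proof (rule incongruent_bound_lift)
      show "v 0 \<in> gen n g" "v 0 \<noteq> 0" "\<forall>y\<in>gen n g. y \<noteq> 0 \<longrightarrow> field_norm (Q (v 0)) \<le> field_norm (Q y)"
        using v0 by (auto simp: simps)
      show "incongruent_bound (gen n (\<lambda>i. proj (v 0) (g i))) (gen m v') (minkowski_const ^ m)"
        unfolding simps(1) g'_def[symmetric] by (rule reduced_family_index[OF red])
    qed (use vS pv in auto)
    thus "incongruent_bound (gen n g) (gen (Suc m) v) (minkowski_const ^ Suc m)" by simp
    show "class_number TYPE('k) = 1 \<longrightarrow> gen n g \<subseteq> gen (Suc m) v"
    proof (intro impI subsetI)
      fix x assume cn: "class_number TYPE('k) = 1" and x: "x \<in> gen n g"
      have "proj (v 0) x \<in> gen n g'" unfolding g'_def simps proj_gen[symmetric] using x by blast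
      hence px: "proj (v 0) x \<in> gen m v'" using reduced_family_class_number[OF red cn] by (rule rev_subsetD)
      have "v 0 \<noteq> 0" using v0(2) by (simp add: simps(1))
      hence "\<exists>c a. (\<forall>j<m. c j \<in> \<O>) \<and> a \<in> coeff_module (gen n g) (v 0) \<and>
          x = smul a (v 0) + (\<Sum>j<m. smul (c j) (v (Suc j)))"
      proof (rule lift_decomposition[of v, OF _ _ _ x px])
        show "v (Suc j) \<in> gen n g" if "j < m" for j using that by (rule vS)
        show "proj (v 0) (v (Suc j)) = v' j" if "j < m" for j using that by (rule pv)
      qed
      then obtain c b where c: "\<forall>j<m. c j \<in> \<O>" "b \<in> coeff_module (gen n g) (v 0)"
        "x = smul b (v 0) + (\<Sum>j<m. smul (c j) (v (Suc j)))" by (elim exE conjE)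
      have "b \<in> \<O>" using c(2) v0(4) cn by (auto simp: simps(1))
      thus "x \<in> gen (Suc m) v" unfolding c(3) using c(1) by (intro gen_Suc_memI) auto
    qed
  qed
  thus ?thesis by blast
qed

theorem reduced_family_exists:
  assumes "admissible_lambda TYPE('k) l" "V.dim (g ` {..<n}) = m"
  shows "\<exists>v h u. reduced_family l m (gen n g) v h u"
  using assms(2)
proof (induction m arbitrary: g)
  case 0
  thus ?case using reduced_family_0 by blast
next
  case (Suc m)
  show ?case by (rule reduced_family_Suc[OF assms(1) Suc.prems Suc.IH])
qed

end

section \<open>The reduced sublattice\<close>

text \<open>Padding with zeros restricts a form to its first variables; this leads from the tails of
  a reduced family to the blocks of indices used in Minkowski's bound.\<close>

lemma lagrange_value_truncate:
  assumes "k \<le> m" "\<And>b. k \<le> b \<Longrightarrow> b < m \<Longrightarrow> x b = 0"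
  shows "lagrange_value m h u x = lagrange_value k h u x"
proof -
  have "lagrange_value m h u x = (\<Sum>a<k. h a * (x a + (\<Sum>b\<in>{a<..<m}. u a b * x b))\<^sup>2)"
    unfolding lagrange_value_def
  proof (rule sum.mono_neutral_right)
    show "\<forall>a\<in>{..<m} - {..<k}. h a * (x a + (\<Sum>b\<in>{a<..<m}. u a b * x b))\<^sup>2 = 0"
    proof
      fix a assume a: "a \<in> {..<m} - {..<k}"
      have "(\<Sum>b\<in>{a<..<m}. u a b * x b) = 0" using a assms(2) by (intro sum.neutral) auto
      moreover have "x a = 0" using a assms(2) by auto
      ultimately show "h a * (x a + (\<Sum>b\<in>{a<..<m}. u a b * x b))\<^sup>2 = 0" by simp
    qed
  qed (use assms(1) in auto)
  also have "\<dots> = lagrange_value k h u x"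
    unfolding lagrange_value_def
  proof (rule sum.cong[OF refl])
    fix a assume "a \<in> {..<k}"
    have "(\<Sum>b\<in>{a<..<m}. u a b * x b) = (\<Sum>b\<in>{a<..<k}. u a b * x b)"
      using assms by (intro sum.mono_neutral_right) auto
    thus "h a * (x a + (\<Sum>b\<in>{a<..<m}. u a b * x b))\<^sup>2 = h a * (x a + (\<Sum>b\<in>{a<..<k}. u a b * x b))\<^sup>2" by simp
  qed
  finally show ?thesis .
qed

context quadratic_form_space
begin

text \<open>The index bound for the ring of integers over itself, tested on one element. It permits
  raising the exponent from n to n^2.\<close>

lemma minkowski_const_ge_1: "1 \<le> minkowski_const"
proof -
  have "real (card {0 :: 'k}) \<le> minkowski_const"
    unfolding minkowski_const_eq
    by (rule fractional_index_bound[of \<O>]) (auto simp: integers_0 intro: integers_diff field_norm_ge_1)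
  thus ?thesis by simp
qed

text \<open>Apply Minkowski's bound to every block of consecutive indices that starts between i and
  j and ends at j. Its hypothesis is the clause on tails, evaluated at vectors that vanish beyond
  the block; \<open>hkz_ratio_bound\<close> combines the resulting inequalities.\<close>

lemma reduced_family_ratio:
  assumes red: "reduced_family l n L v h u" and ij: "i < j" "j < n"
  shows "field_norm (h i) \<le> alpha_const TYPE('k) (j - i) * field_norm (h j)"
proof -
  define H where "H = (\<lambda>a. field_norm (h (i + a)))"
  have "H 0 \<le> sigma_const TYPE('k) (j - i + 1) *
      (\<Prod>k=2..j-i+1. sigma_const TYPE('k) k powr (1 / (real k - 1))) * H (j - i)"
  proof (rule hkz_ratio_bound)
    show "0 < H a" if "a \<le> j - i" for a
      unfolding H_def using that ij by (intro field_norm_pos reduced_family_pos[OF red]) auto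
    show "0 < sigma_const TYPE('k) k" for k by (rule sigma_const_pos)
    fix a k :: nat assume k: "1 \<le> k" and ak: "a + k = Suc (j - i)"
    have in_n: "i + a < n" using k ak ij by simp
    have k_le: "k \<le> n - (i + a)" using k ak ij by simp
    have "field_norm (h (i + a)) \<le> sigma_const TYPE('k) k * (\<Prod>b<k. field_norm (h (i + a + b))) powr (1 / real k)"
    proof (rule minkowski_minimum_bound[where u = "\<lambda>b c. u (i + a + b) (i + a + c)"])
      show "0 < k" using k by simp
      show "totally_positive (h (i + a + b))" if "b < k" for b
        using that k_le by (intro reduced_family_pos[OF red]) simp
      show "0 < field_norm (h (i + a))" by (intro field_norm_pos reduced_family_pos[OF red] in_n)
      fix x :: "nat \<Rightarrow> 'k" assume xO: "\<And>b. b < k \<Longrightarrow> x b \<in> \<O>" and ex: "\<exists>b<k. x b \<noteq> 0"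
      define y where "y = (\<lambda>b. if b < k then x b else 0)"
      have "field_norm (h (i + a)) \<le> field_norm (lagrange_value (n - (i + a)) (\<lambda>b. h (i + a + b)) (\<lambda>b c. u (i + a + b) (i + a + c)) y)"
      proof (rule reduced_family_tail[OF red in_n])
        show "\<forall>b<n - (i + a). y b \<in> \<O>" using xO by (simp add: y_def integers_0)
        obtain b where "b < k" "x b \<noteq> 0" using ex by blast
        thus "\<exists>b<n - (i + a). y b \<noteq> 0" using k_le by (intro exI[of _ b]) (simp add: y_def)
      qed
      also have "lagrange_value (n - (i + a)) (\<lambda>b. h (i + a + b)) (\<lambda>b c. u (i + a + b) (i + a + c)) y =
          lagrange_value k (\<lambda>b. h (i + a + b)) (\<lambda>b c. u (i + a + b) (i + a + c)) y"
        by (rule lagrange_value_truncate[OF k_le]) (simp add: y_def)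
      also have "\<dots> = lagrange_value k (\<lambda>b. h (i + a + b)) (\<lambda>b c. u (i + a + b) (i + a + c)) x"
        by (rule lagrange_value_cong) (simp add: y_def)
      finally show "field_norm (h (i + a)) \<le>
          field_norm (lagrange_value k (\<lambda>b. h (i + a + b)) (\<lambda>b c. u (i + a + b) (i + a + c)) x)" .
    qed
    thus "H a \<le> sigma_const TYPE('k) k * (\<Prod>b<k. H (a + b)) powr (1 / real k)"
      by (simp add: H_def add.assoc)
  qed
  thus ?thesis using ij by (simp add: H_def alpha_const_def)
qed

section \<open>From a reduced family to a basis, its form and the quotient\<close>

lemma reduced_family_independent:
  assumes red: "reduced_family l n L v h u" and "(\<Sum>i<n. smul (x i) (v i)) = 0" "i < n"
  shows "x i = 0"
proof (rule lagrange_value_eq_0[OF _ _ assms(3)])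
  show "totally_positive (h a)" if "a < n" for a using that by (rule reduced_family_pos[OF red])
  show "lagrange_value n h u x = 0" using reduced_family_expansion[OF red, of x] assms(2) Q_0 by simp
qed

lemma reduced_family_unique:
  assumes red: "reduced_family l n L v h u"
    and "(\<Sum>i<n. smul (x i) (v i)) = (\<Sum>i<n. smul (y i) (v i))" "i < n"
  shows "x i = y i"
proof -
  have "(\<Sum>i<n. smul (x i - y i) (v i)) = 0"
    using assms(2) by (simp add: V.scale_left_diff_distrib sum_subtractf)
  from reduced_family_independent[OF red this assms(3)] show ?thesis by simp
qed

lemma reduced_family_inj:
  assumes red: "reduced_family l n L v h u"
  shows "inj_on v {..<n}"
proof (rule inj_onI)
  fix i j assume ij: "i \<in> {..<n}" "j \<in> {..<n}" "v i = v j"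
  have e: "v k = (\<Sum>a<n. smul (if a = k then 1 else 0) (v a))" if "k < n" for k
  proof -
    have "(\<Sum>a<n. smul (if a = k then 1 else 0) (v a)) = (\<Sum>a<n. if a = k then v a else 0)"
      by (intro sum.cong) auto
    thus ?thesis using that by simp
  qed
  have "(if i = i then 1 else 0 :: 'k) = (if i = j then 1 else 0)"
    using ij e[of i] e[of j] by (intro reduced_family_unique[OF red, of "\<lambda>a. if a = i then 1 else 0" "\<lambda>a. if a = j then 1 else 0" i]) auto
  thus "i = j" by (simp split: if_splits)
qed

text \<open>Under injectivity, coefficients attached to elements correspond to coefficients attached
  to positions; elements outside a finite subset receive the coefficient 0.\<close>

lemma integral_span_family:
  assumes inj: "inj_on g {..<n}"
  shows "integral_span smul (g ` {..<n}) = gen n g"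
proof (intro equalityI subsetI)
  fix x assume "x \<in> integral_span smul (g ` {..<n})"
  then obtain T c where T: "x = (\<Sum>s\<in>T. smul (c s) s)" "finite T" "T \<subseteq> g ` {..<n}" "c ` T \<subseteq> \<O>"
    unfolding integral_span_def by blast
  have "x = (\<Sum>s\<in>g ` {..<n}. smul (if s \<in> T then c s else 0) s)"
    unfolding T(1) using T(3) by (intro sum.mono_neutral_cong_left) auto
  also have "\<dots> = (\<Sum>i<n. smul (if g i \<in> T then c (g i) else 0) (g i))" by (simp add: sum.reindex[OF inj])
  also have "\<dots> \<in> gen n g" using T(4) by (intro gen_memI) (auto simp: integers_0)
  finally show "x \<in> gen n g" .
next
  fix x assume "x \<in> gen n g"
  then obtain c where c: "\<forall>i<n. c i \<in> \<O>" "x = (\<Sum>i<n. smul (c i) (g i))" by (rule gen_memE)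
  define c' where "c' = (\<lambda>s. c (the_inv_into {..<n} g s))"
  have c': "c' (g i) = c i" if "i < n" for i using that inj by (simp add: c'_def the_inv_into_f_f)
  have "x = (\<Sum>s\<in>g ` {..<n}. smul (c' s) s)" by (simp add: c(2) sum.reindex[OF inj] c')
  moreover have "c' ` g ` {..<n} \<subseteq> \<O>" using c(1) c' by auto
  ultimately show "x \<in> integral_span smul (g ` {..<n})"
    unfolding integral_span_def by (intro CollectI exI[of _ "g ` {..<n}"] exI[of _ c']) auto
qed

lemma reduced_family_span:
  assumes red: "reduced_family l n L v h u" and dim: "V.dim UNIV = n"
  shows "V.span (v ` {..<n}) = UNIV"
proof -
  have inj: "inj_on v {..<n}" by (rule reduced_family_inj[OF red])
  have "V.independent (v ` {..<n})"
  proof (rule V.independent_if_scalars_zero)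
    fix f x assume f: "(\<Sum>x\<in>v ` {..<n}. smul (f x) x) = 0" and "x \<in> v ` {..<n}"
    then obtain i where i: "i < n" "x = v i" by auto
    have "(\<Sum>i<n. smul (f (v i)) (v i)) = 0" using f by (simp add: sum.reindex[OF inj])
    from reduced_family_independent[OF red this i(1)] show "f x = 0" by (simp add: i(2))
  qed simp
  moreover have "card (v ` {..<n}) = n" by (simp add: card_image[OF inj])
  ultimately have "UNIV \<subseteq> V.span (v ` {..<n})"
    using V.card_ge_dim_independent[of "v ` {..<n}" UNIV] dim by simp
  thus ?thesis by auto
qed

lemma reduced_family_lattice_basis:
  assumes red: "reduced_family l n L v h u"
  shows "lattice_basis smul n v (gen n v)"
  unfolding lattice_basis_def bij_betw_def
proof
  show "inj_on (\<lambda>c. \<Sum>i<n. smul (c $ i) (v i)) (integral_vecs n)"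
  proof (rule inj_onI)
    fix x y :: "'k Matrix.vec"
    assume xy: "x \<in> integral_vecs n" "y \<in> integral_vecs n"
      and eq: "(\<Sum>i<n. smul (x $ i) (v i)) = (\<Sum>i<n. smul (y $ i) (v i))"
    have "x $ i = y $ i" if "i < n" for i by (rule reduced_family_unique[OF red eq that])
    thus "x = y" using xy by (intro eq_vecI) (auto simp: integral_vecs_def)
  qed
  show "(\<lambda>c. \<Sum>i<n. smul (c $ i) (v i)) ` integral_vecs n = gen n v"
  proof (intro equalityI subsetI)
    fix y assume "y \<in> (\<lambda>c. \<Sum>i<n. smul (c $ i) (v i)) ` integral_vecs n"
    thus "y \<in> gen n v" by (auto simp: integral_vecs_def intro!: gen_memI)
  next
    fix y assume "y \<in> gen n v"
    then obtain c where c: "\<forall>i<n. c i \<in> \<O>" "y = (\<Sum>i<n. smul (c i) (v i))" by (rule gen_memE)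
    have "y = (\<Sum>i<n. smul (vec n c $ i) (v i))" by (simp add: c(2))
    moreover have "vec n c \<in> integral_vecs n" using c(1) by (simp add: integral_vecs_def)
    ultimately show "y \<in> (\<lambda>c. \<Sum>i<n. smul (c $ i) (v i)) ` integral_vecs n" by (rule image_eqI)
  qed
qed

lemma form_value_gram:
  assumes "x \<in> carrier_vec n"
  shows "form_value (mat n n (\<lambda>(i, j). B (v i) (v j))) x = Q (\<Sum>i<n. smul (x $ i) (v i))"
proof -
  have "form_value (mat n n (\<lambda>(i, j). B (v i) (v j))) x = (\<Sum>i<n. x $ i * (\<Sum>j<n. B (v i) (v j) * x $ j))"
    using assms unfolding form_value_def scalar_prod_def
    by (intro sum.cong) (auto simp: scalar_prod_def atLeast0LessThan intro!: sum.cong)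
  also have "\<dots> = Q (\<Sum>i<n. smul (x $ i) (v i))"
    unfolding Q_sum_family sum_distrib_left by (intro sum.cong refl) (simp add: mult_ac)
  finally show ?thesis .
qed

text \<open>Stated for any part M of the lattice that contains the first vector, so that it serves
  both the lattice and its sublattice.\<close>

lemma reduced_family_lattice_min:
  assumes red: "reduced_family l n L v h u" and n: "0 < n" and M: "M \<subseteq> L" "v 0 \<in> M"
  shows "lattice_min Q M = field_norm (h 0)"
  unfolding lattice_min_def
proof (rule Least_equality)
  have "h 0 \<noteq> 0" using field_norm_pos[OF reduced_family_pos[OF red n]] field_norm_eq_0[of "h 0"] by auto
  hence "v 0 \<noteq> 0" using reduced_family_first[OF red n] Q_0 by auto
  thus "\<exists>x\<in>M. x \<noteq> 0 \<and> field_norm (h 0) = field_norm (Q x)"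
    using M(2) reduced_family_first[OF red n] by (intro bexI[of _ "v 0"]) auto
next
  fix r assume "\<exists>x\<in>M. x \<noteq> 0 \<and> r = field_norm (Q x)"
  then obtain x where x: "x \<in> M" "x \<noteq> 0" "r = field_norm (Q x)" by blast
  show "field_norm (h 0) \<le> r" unfolding x(3) using x M by (intro reduced_family_min[OF red n]) auto
qed

text \<open>At integral vectors the Gram form takes the values of Q on the sublattice, so minimality
  over the whole lattice bounds them, and the first unit vector attains the bound.\<close>

lemma reduced_family_form_min:
  assumes red: "reduced_family l n (gen N g) v h u" and n: "0 < n"
  shows "form_min n (mat n n (\<lambda>(i, j). B (v i) (v j))) = field_norm (h 0)"
  unfolding form_min_def
proof (rule Least_equality)
  let ?A = "mat n n (\<lambda>(i, j). B (v i) (v j))"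
  have e: "(\<Sum>i<n. smul (unit_vec n 0 $ i) (v i)) = v 0"
  proof -
    have "(\<Sum>i<n. smul (unit_vec n 0 $ i) (v i)) = (\<Sum>i<n. if i = 0 then v i else 0)"
      using n by (intro sum.cong) (auto simp: unit_vec_def)
    thus ?thesis using n by simp
  qed
  have u: "unit_vec n 0 \<in> integral_vecs n"
    by (auto simp: integral_vecs_def unit_vec_def integers_0 integers_1)
  have "form_value ?A (unit_vec n 0) = Q (\<Sum>i<n. smul (unit_vec n 0 $ i) (v i))"
    by (rule form_value_gram) simp
  hence "form_value ?A (unit_vec n 0) = h 0"
    unfolding e using reduced_family_first[OF red n] by simp
  moreover have "unit_vec n 0 \<noteq> (0\<^sub>v n :: 'k Matrix.vec)"
  proof
    assume "unit_vec n 0 = (0\<^sub>v n :: 'k Matrix.vec)"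
    hence "unit_vec n 0 $ 0 = (0\<^sub>v n $ 0 :: 'k)" by simp
    thus False using n by simp
  qed
  ultimately show "\<exists>x\<in>integral_vecs n. x \<noteq> 0\<^sub>v n \<and> field_norm (h 0) = field_norm (form_value ?A x)"
    using u by (intro bexI[of _ "unit_vec n 0"]) auto
next
  let ?A = "mat n n (\<lambda>(i, j). B (v i) (v j))"
  fix r assume "\<exists>x\<in>integral_vecs n. x \<noteq> 0\<^sub>v n \<and> r = field_norm (form_value ?A x)"
  then obtain x where x: "x \<in> integral_vecs n" "x \<noteq> 0\<^sub>v n" "r = field_norm (form_value ?A x)" by blast
  let ?y = "\<Sum>i<n. smul (x $ i) (v i)"
  have xc: "x \<in> carrier_vec n" using x(1) by (simp add: integral_vecs_def)
  have "?y \<in> gen N g" using x(1) reduced_family_mem[OF red]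
    by (intro gen_sum gen_smul) (auto simp: integral_vecs_def)
  moreover have "?y \<noteq> 0"
  proof
    assume y: "?y = 0"
    have "x $ i = 0" if "i < n" for i by (rule reduced_family_independent[OF red y that])
    hence "x = 0\<^sub>v n" using xc by (intro eq_vecI) auto
    thus False using x(2) by simp
  qed
  ultimately show "field_norm (h 0) \<le> r"
    unfolding x(3) form_value_gram[OF xc] by (intro reduced_family_min[OF red n])
qed

lemma reduced_family_HKZ:
  assumes red: "reduced_family l n (gen N g) v h u" and D1: "admissible_D1 TYPE('k) D\<^sub>1"
  shows "HKZ_reduced D\<^sub>1 l n (mat n n (\<lambda>(i, j). B (v i) (v j)))"
  unfolding HKZ_reduced_def
proof (intro exI conjI)
  let ?A = "mat n n (\<lambda>(i, j). B (v i) (v j))"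
  show "lagrange_expansion n ?A h u"
    unfolding lagrange_expansion_def
    by (simp add: form_value_gram reduced_family_expansion[OF red] lagrange_value_def)
  show "weakly_reduced D\<^sub>1 l n ?A h"
    unfolding weakly_reduced_def ball_embeddings
  proof (intro conjI allI impI)
    show "field_norm (h 0) = form_min n ?A" if "0 < n" by (rule reduced_family_form_min[OF red that, symmetric])
    show "field_norm (h i) \<le> alpha_bar TYPE('k) D\<^sub>1 (j - i) * field_norm (h j)" if ij: "i < j \<and> j < n" for i j
    proof -
      have "field_norm (h i) \<le> alpha_const TYPE('k) (j - i) * field_norm (h j)"
        using ij by (intro reduced_family_ratio[OF red]) auto
      also have "\<dots> \<le> alpha_bar TYPE('k) D\<^sub>1 (j - i) * field_norm (h j)"
      proof (rule mult_right_mono)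
        have "1 \<le> j - i" using ij by linarith
        thus "alpha_const TYPE('k) (j - i) \<le> alpha_bar TYPE('k) D\<^sub>1 (j - i)"
          using D1 unfolding admissible_D1_def by simp
        show "0 \<le> field_norm (h j)" using ij field_norm_pos[OF reduced_family_pos[OF red, of j]] by simp
      qed
      finally show ?thesis .
    qed
    show "\<nu> p (h i) \<le> l * \<nu> q (h i)" if "i < n" "p < d" "q < d" for i p q
      by (rule reduced_family_balanced[OF red that])
  qed
  show "\<forall>i j. i < j \<and> j < n \<longrightarrow> (\<forall>\<nu>\<in>real_embeddings. \<bar>\<nu> (u i j)\<bar> \<le> beta_const TYPE('k))"
    unfolding ball_embeddings using reduced_family_beta[OF red] by simp
qed

text \<open>One representative from each class gives pairwise incongruent elements, and an infinite
  quotient would contain finite subsets of every size.\<close>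

lemma quotient_card_le:
  assumes b: "incongruent_bound (gen N g) (gen n v) b" and sub: "gen n v \<subseteq> gen N g"
  shows "finite (lattice_quotient (gen N g) (gen n v)) \<and> real (card (lattice_quotient (gen N g) (gen n v))) \<le> b"
proof -
  define K where "K = gen N g"
  define L where "L = gen n v"
  define R where "R = {(x, y). x \<in> K \<and> y \<in> K \<and> x - y \<in> L}"
  have quot: "lattice_quotient K L = K // R" by (simp add: lattice_quotient_def R_def)
  have "equiv K R"
  proof (rule equivI)
    show "R \<subseteq> K \<times> K" by (auto simp: R_def)
    show "refl_on K R" by (auto simp: refl_on_def R_def L_def gen_0)
    show "sym R"
    proof (rule symI)
      fix x y assume xy: "(x, y) \<in> R"
      hence "x - y \<in> L" by (simp add: R_def)
      hence "0 - (x - y) \<in> L" unfolding L_def by (rule gen_diff[OF gen_0])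
      thus "(y, x) \<in> R" using xy by (simp add: R_def)
    qed
    show "trans R"
    proof (rule transI)
      fix x y z assume xy: "(x, y) \<in> R" "(y, z) \<in> R"
      hence "x - y \<in> L" "y - z \<in> L" by (simp_all add: R_def)
      hence "(x - y) + (y - z) \<in> L" unfolding L_def by (rule gen_add)
      thus "(x, z) \<in> R" using xy by (simp add: R_def)
    qed
  qed
  have bound: "real (card F) \<le> b" if F: "finite F" "F \<subseteq> K // R" for F
  proof -
    define f where "f = (\<lambda>c :: 'v set. SOME x. x \<in> c)"
    have f: "f c \<in> c" if "c \<in> F" for c
    proof -
      have "c \<in> K // R" using F(2) that by auto
      hence "c \<noteq> {}" by (rule in_quotient_imp_non_empty[OF \<open>equiv K R\<close>])
      thus ?thesis unfolding f_def by (simp add: some_in_eq)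
    qed
    have same: "c = c'" if "c \<in> F" "c' \<in> F" "f c - f c' \<in> L" for c c'
    proof -
      have q: "c \<in> K // R" "c' \<in> K // R" using that F(2) by auto
      have "f c \<in> K" "f c' \<in> K"
        using in_quotient_imp_subset[OF \<open>equiv K R\<close>] q f that by blast+
      hence "(f c, f c') \<in> R" using that(3) by (simp add: R_def)
      thus ?thesis using quotient_eqI[OF \<open>equiv K R\<close> q f[OF that(1)] f[OF that(2)]] by simp
    qed
    have "inj_on f F" by (rule inj_onI, rule same) (auto simp: L_def gen_0)
    hence "card F = card (f ` F)" by (simp add: card_image)
    also have "real \<dots> \<le> b"
    proof (rule incongruent_boundD[OF b[folded K_def L_def]])
      show "finite (f ` F)" using F(1) by simp
      show "f ` F \<subseteq> K" using in_quotient_imp_subset[OF \<open>equiv K R\<close>] F(2) f by blast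
      fix x y assume "x \<in> f ` F" "y \<in> f ` F" "x \<noteq> y"
      thus "x - y \<notin> L" using same by auto
    qed
    finally show ?thesis .
  qed
  have fin: "finite (K // R)"
  proof (rule ccontr)
    assume inf: "infinite (K // R)"
    obtain k :: nat where k: "b < real k" using reals_Archimedean2 by blast
    obtain F where "finite F" "card F = k" "F \<subseteq> K // R"
      using infinite_arbitrarily_large[OF inf, of k] by blast
    thus False using bound[of F] k by simp
  qed
  show ?thesis using fin bound[OF fin order_refl] quot unfolding K_def L_def by simp
qed

end

theorem theorem3p11:
  fixes smul :: "'k::field_char_0 \<Rightarrow> 'v::ab_group_add \<Rightarrow> 'v"
    and Q :: "'v \<Rightarrow> 'k"
    and \<Lambda> :: "'v set"
    and n d :: nat
    and D\<^sub>1 l :: real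
  assumes "totally_real_number_field TYPE('k)"
    and "d = number_field_degree TYPE('k)"
    and "admissible_D1 TYPE('k) D\<^sub>1"
    and "admissible_lambda TYPE('k) l"
    and "positive_definite_lattice smul Q n \<Lambda>"
  shows "\<exists>L. L \<subseteq> \<Lambda> \<and> positive_definite_lattice smul Q n L \<and> free_lattice smul L \<and>
           lattice_min Q L = lattice_min Q \<Lambda> \<and>
           (\<exists>u. HKZ_reduced_basis smul Q D\<^sub>1 l n u L) \<and>
           finite (lattice_quotient \<Lambda> L) \<and>
           real (card (lattice_quotient \<Lambda> L))
             \<le> (fact d / real d ^ d * sqrt \<bar>field_discriminant TYPE('k)\<bar>) ^ (n\<^sup>2) \<and>
           (class_number TYPE('k) = 1 \<longrightarrow> \<Lambda> = L)"
proof -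
  obtain w :: "nat \<Rightarrow> 'k" and \<nu> where nf: "number_field d w \<nu>"
    using number_field_exists[OF assms(1,2)] by (elim exE)
  have qs: "quadratic_space smul Q" and dim: "Vector_Spaces.vector_space.dim smul (UNIV :: 'v set) = n"
    and span: "Modules.module.span smul \<Lambda> = UNIV" and pos: "\<And>x. x \<noteq> 0 \<Longrightarrow> totally_positive (Q x)"
    using assms(5) unfolding positive_definite_lattice_def by auto
  have "\<exists>S. finite S \<and> \<Lambda> = integral_span smul S"
    using assms(5) unfolding positive_definite_lattice_def by (elim conjE)
  then obtain S where S: "finite S" "\<Lambda> = integral_span smul S" by (elim exE conjE)
  interpret W: Vector_Spaces.vector_space smul using qs by (simp add: quadratic_space_def)
  have "\<Lambda> \<subseteq> W.span S"
  proof
    fix x assume "x \<in> \<Lambda>"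
    then obtain T c where T: "x = (\<Sum>s\<in>T. smul (c s) s)" "T \<subseteq> S"
      unfolding S(2) integral_span_def by blast
    show "x \<in> W.span S" unfolding T(1) using T(2) by (intro W.span_sum W.span_scale W.span_base) auto
  qed
  hence "W.span \<Lambda> \<subseteq> W.span S" by (metis W.span_mono W.span_span)
  hence spanS: "W.span S = UNIV" using span by auto
  obtain Basis where Basis: "W.independent Basis" "UNIV \<subseteq> W.span Basis"
    by (rule W.basis_exists[of UNIV])
  have "finite Basis" using W.independent_span_bound[OF S(1) Basis(1)] spanS by auto
  interpret number_field d w \<nu> by (rule nf)
  interpret quadratic_form_space d w \<nu> smul Basis Q
    using \<open>finite Basis\<close> Basis qs pos by unfold_locales auto
  obtain g where g: "bij_betw g {..<card S} S"
    using ex_bij_betw_nat_finite[OF S(1)] by (auto simp: atLeast0LessThan)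
  define N where "N = card S"
  have gS: "g ` {..<N} = S" and ginj: "inj_on g {..<N}" using g by (auto simp: bij_betw_def N_def)
  have \<Lambda>: "\<Lambda> = gen N g" using integral_span_family[OF ginj] S(2) gS by simp
  have "W.dim (g ` {..<N}) = n"
    unfolding gS using dim spanS W.dim_span[of S] by simp
  from reduced_family_exists[OF assms(4) this]
  obtain v h u where red: "reduced_family l n (gen N g) v h u" by (elim exE)
  define L where "L = gen n v"
  have sub: "L \<subseteq> gen N g" unfolding L_def by (rule gen_subset) (rule reduced_family_mem[OF red])
  have lb: "lattice_basis smul n v L" unfolding L_def by (rule reduced_family_lattice_basis[OF red])
  have "W.span L = UNIV"
  proof -
    have "v ` {..<n} \<subseteq> L" unfolding L_def using gen_generator by auto
    hence "W.span (v ` {..<n}) \<subseteq> W.span L" by (rule W.span_mono)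
    thus ?thesis using reduced_family_span[OF red dim] by auto
  qed
  moreover have "L = integral_span smul (v ` {..<n})"
    unfolding L_def by (rule integral_span_family[OF reduced_family_inj[OF red], symmetric])
  ultimately have pdl: "positive_definite_lattice smul Q n L"
    unfolding positive_definite_lattice_def using qs dim pos by (intro conjI exI[of _ "v ` {..<n}"]) auto
  have min: "lattice_min Q L = lattice_min Q \<Lambda>"
  proof (cases "n = 0")
    \<comment> \<open>In rank 0 there is no nonzero vector and \<open>LEAST\<close> has nothing to
      choose from; the minima agree because both lattices are {0}.\<close>
    case True
    hence "(UNIV :: 'v set) \<subseteq> {0}" using dim V.dim_eq_0[of UNIV] by simp
    hence all0: "x = 0" for x :: 'v using UNIV_I[of x] by (blast dest: subsetD)
    have "x \<in> L \<longleftrightarrow> x \<in> \<Lambda>" for x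
      by (subst (1 2) all0[of x]) (simp add: L_def \<Lambda> gen_0)
    hence "L = \<Lambda>" by (rule Set.set_eqI)
    thus ?thesis by simp
  next
    case False
    have "v 0 \<in> L" unfolding L_def using False by (intro gen_generator) simp
    hence "lattice_min Q L = field_norm (h 0)"
      by (intro reduced_family_lattice_min[OF red _ sub]) (use False in simp_all)
    moreover have "lattice_min Q (gen N g) = field_norm (h 0)"
      by (rule reduced_family_lattice_min[OF red _ order_refl reduced_family_mem[OF red]]) (use False in simp_all)
    ultimately show ?thesis by (simp add: \<Lambda>)
  qed
  have quot: "finite (lattice_quotient \<Lambda> L)" "real (card (lattice_quotient \<Lambda> L)) \<le> minkowski_const ^ n"
    using quotient_card_le[OF reduced_family_index[OF red] sub[unfolded L_def]] unfolding \<Lambda> L_def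
    by (rule conjunct1, rule conjunct2)
  have "minkowski_const ^ n \<le> minkowski_const ^ (n\<^sup>2)"
    by (intro power_increasing minkowski_const_ge_1) (simp add: power2_eq_square)
  hence card: "real (card (lattice_quotient \<Lambda> L)) \<le> minkowski_const ^ (n\<^sup>2)" using quot(2) by simp
  have "HKZ_reduced_basis smul Q D\<^sub>1 l n v L"
    unfolding HKZ_reduced_basis_def using lb reduced_family_HKZ[OF red assms(3)] by simp
  moreover have "free_lattice smul L" unfolding free_lattice_def using lb by blast
  moreover have "\<Lambda> = L" if "class_number TYPE('k) = 1"
    unfolding \<Lambda> by (rule equalityI[OF reduced_family_class_number[OF red that, folded L_def] sub])
  ultimately show ?thesis
    using sub pdl min quot(1) card unfolding \<Lambda>[symmetric] minkowski_const_eq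
    by (intro exI[of _ L] conjI exI[of _ v] impI)
qed

end
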